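(* Let $T$ be an oriented 1-tangle diagram in the annulus with loop number 0, let $L_{T^0}$ be the link in $S^2\times S^1$ obtained by closing $T$, and let $L_{T^0}'$ be the link in $S^3$ obtained from $L_{T^0}$ by collapsing to a point the complement of an open 3-ball in $S^2\times S^1$ containing $L_{T^0}$. Then there is an isomorphism of bigraded $\mathbb F$-vector spaces $$V\otimes\operatorname{Khr}(L_{T^0}')\;\longrightarrow\;H^*((C_0,\partial_0)),$$ where $V$ is a two-dimensional bigraded vector space, $\operatorname{Khr}$ is reduced Khovanov homology over $\mathbb F$ with $\operatorname{Khr}^{(h,q)}$ placed in bigrading $(h,h+q)$, and $(C_0,\partial_0)$ is the cochain complex associated to $T$ as in the context.
   Context: **Vector spaces and maps.** $\mathbb F$ is the field with two elements. Vector spaces carry bigradings $(h,q)$ (homological, quantum), shown as superscripts; $V[h,q]$ is $V$ with bigradings shifted up by $(h,q)$. $A=\langle e^{(0,1)},x^{(0,-1)}\rangle$. $\eta,\dot\eta:\mathbb F\to A$, $\eta(1)=e$, $\dot\eta(1)=x$. $\epsilon,\dot\epsilon:A\to\mathbb F$, $\epsilon(e)=0,\epsilon(x)=1$, $\dot\epsilon(e)=1,\dot\epsilon(x)=0$. $m:A\otimes A\to A$ is commutative with unit $e$ and $m(x\otimes x)=0$; $\Delta(e)=e\otimes x+x\otimes e$, $\Delta(x)=x\otimes x$. $I_r=\mathrm{id}_{A^{\otimes r}}$. $\Sigma_r:A^{\otimes r}\to A^{\otimes r}$ is the sum over the $r$ tensor factors of the map acting as $e\mapsto0$, $x\mapsto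 e$ on that factor and as the identity on the others ($\Sigma_0=0$). Tensor signs are omitted. **The space $(W_0,L_0)$.** $(W_0,L_0)=\langle\alpha_0^{(0,0)},\beta_0^{(0,-2)}\rangle$, with operators $a_0=\mathrm{id}$ and $c_0:\alpha_0\mapsto\beta_0,\ \beta_0\mapsto0$. (This is a Lagrangian intersection space in the traceless character variety $R^*(T^2,2)$; $C_0$ arises as a morphism complex in its twisted Fukaya category with the conjectured $A_\infty$ operations, which amounts to the following explicit description.) **Tangle diagrams.** Fix points $p_1,p_2$ on the outer, inner bounding circle of the annulus at the same angle. An oriented 1-tangle diagram in the annulus is a planar diagram of a tangle (in annulus $\times[0,1]$) with one arc joining $p_1$ and $p_2$ and possibly closed components. Loop number 0 means that no strands loop around the annulus: $T$ is disjoint from some radial segment at an angle different from that of $p_1,p_2$, so all resolutions have winding number 0. The link $L_{T^0}'\subset S^3$ is equivalently the link with planar diagram obtained by closing $T$ with an arc from $p_2$ to $p_1$ along that segment (crossing no strands). The marked component for reduced Khovanov homology is the one containing the arc component of $T$; $\operatorname{Khr}$ is normalized so that the unknot has $\mathbb F$ in bigrading $(0,0)$ and the right trefoil has $\mathbb F$ in bigradings $(0,2),(2,6),(3,8)$. **Planar tangles and saddles.** A planar 1-tangle is a compact embedded 1-manifold in the annulus with boundary $\{p_1,p_2\}$: an arc component, oriented from $p_1$ to $p_2$, and circles. It is of type $P_0(r)$ if its arc is isotopic to the radial segment and it has $r$ circles. A saddle is a local band surgery between planar tangles. If it splits a circle $C$ from, or merges a circle $C$ with, the arc component, it is called right or left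 according to the side of the arc component to which $C$ is adjacent along the merging band (for a split, the band of the reverse merge); the other circles inside $C$ are enclosed ($r_e$ many), those outside $C$ non-enclosed ($r_n$ many), $r=r_e+r_n$. The map assigned to a saddle $P_0(r_1)\to P_0(r_2)$, $(W_0,L_0)\otimes A^{\otimes r_1}\to(W_0,L_0)\otimes A^{\otimes r_2}$ (one factor $A$ per circle, maps acting on the appropriate factors), is: split of one circle into two: $a_0\Delta I_r$; merge of two circles: $a_0mI_r$; split from the right: $(a_0\dot\eta+c_0\eta)I_r+c_0\dot\eta I_{r_n}\Sigma_{r_e}$; merge with the right: $(a_0\dot\epsilon+c_0\epsilon)I_r+c_0\dot\epsilon I_{r_n}\Sigma_{r_e}$; split from the left: $a_0\dot\eta I_r+c_0\dot\eta I_{r_n}\Sigma_{r_e}$; merge with the left: $a_0\dot\epsilon I_r+c_0\dot\epsilon I_{r_n}\Sigma_{r_e}$. **The cochain complex.** Let $T$ have $m$ crossings, $m_\pm$ of them positive/negative. The 0-resolution (1-resolution) of a crossing is the one in which the overpass turns left (right). For $i\in\{0,1\}^m$ let $T_i$, of type $P_0(c_i)$, be the resolution and $r(i)$ the number of 1's in $i$. Then $C_0=\bigoplus_i(W_0,L_0)\otimes A^{\otimes c_i}[r(i)+h_T,2r(i)+q_T]$, $[h_T,q_T]=[-m_-,m_+-3m_-]$, and $\partial_0$ (of bigrading $(1,1)$) is the sum, over pairs $i,j$ differing in one bit that is $0$ in $i$ and $1$ in $j$, of the maps assigned to the saddles $T_i\to T_j$. *)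

theory Defs
  imports "HOL-Library.FuncSet" "HOL-Library.Z2" "HOL-Library.Product_Plus" "HOL-Combinatorics.Transposition"
begin

section \<open>Diagrams\<close>

text \<open>
  Cutting the annulus along the radial segment that a diagram of loop number 0 avoids gives a strip,
  and this identification can be chosen to preserve orientation and to send the outer boundary to
  the bottom and the inner boundary to the top.  A diagram in general position with respect to the
  height, as can be achieved by a planar isotopy, is a list of elementary pieces, read from bottom
  to top.  The piece at index \<open>t\<close> lies between the levels \<open>t\<close> and \<open>t + 1\<close>, and the strands
  meeting a level are numbered from the left, starting with 0.

  The argument \<open>k\<close> is the position at which the event happens: \<open>Cup k\<close> is a local minimum whose
  two ends get positions \<open>k, k + 1\<close> at the upper level; \<open>Cap k\<close> is a local maximum joining the
  strands \<open>k, k + 1\<close> of the lower level; \<open>Over_NE k\<close> and \<open>Over_NW k\<close> are the crossings of the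
  strands \<open>k, k + 1\<close> whose overpass runs from bottom left to top right and from bottom right to
  top left; \<open>Vert k\<close> consists of two parallel vertical strands and \<open>Horiz k\<close> of a cap with a cup
  above it (the two ways of smoothing a crossing).
\<close>

datatype piece = Cup nat | Cap nat | Over_NE nat | Over_NW nat | Vert nat | Horiz nat

type_synonym point = "nat \<times> nat"  \<comment> \<open>level, position\<close>

fun position :: "piece \<Rightarrow> nat" where
  "position (Cup k) = k"
| "position (Cap k) = k"
| "position (Over_NE k) = k"
| "position (Over_NW k) = k"
| "position (Vert k) = k"
| "position (Horiz k) = k"

fun fits :: "nat \<Rightarrow> piece \<Rightarrow> bool" where
  "fits n (Cup k) \<longleftrightarrow> k \<le> n"
| "fits n p \<longleftrightarrow> position p + 2 \<le> n"

fun strands_above :: "nat \<Rightarrow> piece \<Rightarrow> nat" where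
  "strands_above n (Cup k) = n + 2"
| "strands_above n (Cap k) = n - 2"
| "strands_above n p = n"

text \<open>\<open>diagram n D m\<close>: the word \<open>D\<close> is a diagram with \<open>n\<close> end points at the bottom and \<open>m\<close> end
  points at the top.\<close>

fun diagram :: "nat \<Rightarrow> piece list \<Rightarrow> nat \<Rightarrow> bool" where
  "diagram n [] m \<longleftrightarrow> n = m"
| "diagram n (p # D) m \<longleftrightarrow> fits n p \<and> diagram (strands_above n p) D m"

definition width :: "nat \<Rightarrow> piece list \<Rightarrow> nat \<Rightarrow> nat" where
  "width n D t = foldl strands_above n (take t D)"

definition points :: "nat \<Rightarrow> piece list \<Rightarrow> point set" where
  "points n D = {(t, i). t \<le> length D \<and> i < width n D t}"

text \<open>\<open>passes p i j\<close>: a strand of \<open>p\<close> leads from position \<open>i\<close> below to position \<open>j\<close> above.\<close>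

fun passes :: "piece \<Rightarrow> nat \<Rightarrow> nat \<Rightarrow> bool" where
  "passes (Cup k) i j \<longleftrightarrow> j = (if i < k then i else i + 2)"
| "passes (Cap k) i j \<longleftrightarrow> i = (if j < k then j else j + 2)"
| "passes (Over_NE k) i j \<longleftrightarrow> j = transpose k (k + 1) i"
| "passes (Over_NW k) i j \<longleftrightarrow> j = transpose k (k + 1) i"
| "passes (Vert k) i j \<longleftrightarrow> j = i"
| "passes (Horiz k) i j \<longleftrightarrow> j = i \<and> i \<notin> {k, k + 1}"

definition runs :: "nat \<Rightarrow> piece list \<Rightarrow> (point \<times> point) set" where
  "runs n D = {((t, i), (t + 1, j)) | t i j. t < length D \<and> passes (D ! t) i j}
     \<inter> points n D \<times> points n D"

definition turns :: "nat \<Rightarrow> piece list \<Rightarrow> (point \<times> point) set" where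
  "turns n D =
     ({((t, k), (t, k + 1)) | t k. t < length D \<and> D ! t \<in> {Cap k, Horiz k}} \<union>
      {((t + 1, k), (t + 1, k + 1)) | t k. t < length D \<and> D ! t \<in> {Cup k, Horiz k}})
     \<inter> points n D \<times> points n D"

definition component :: "nat \<Rightarrow> piece list \<Rightarrow> point \<Rightarrow> point set" where
  "component n D p = {q. (p, q) \<in> (runs n D \<union> turns n D \<union> (runs n D \<union> turns n D)\<inverse>)\<^sup>*}"

definition components :: "nat \<Rightarrow> piece list \<Rightarrow> point set set" where
  "components n D = component n D ` points n D"

text \<open>An orientation says for every point whether its strand crosses the level upwards.\<close>

definition orientation :: "nat \<Rightarrow> piece list \<Rightarrow> (point \<Rightarrow> bool) \<Rightarrow> bool" where
  "orientation n D up \<longleftrightarrow>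
     (\<forall>(p, q) \<in> runs n D. up p = up q) \<and> (\<forall>(p, q) \<in> turns n D. up p \<noteq> up q)"

definition oriented_tangle :: "piece list \<Rightarrow> (point \<Rightarrow> bool) \<Rightarrow> bool" where
  "oriented_tangle T up \<longleftrightarrow> diagram 1 T 1 \<and> orientation 1 T up"

definition crossings :: "piece list \<Rightarrow> nat set" where
  "crossings D = {t. t < length D \<and> (\<exists>k. D ! t \<in> {Over_NE k, Over_NW k})}"

fun positive_piece :: "piece \<Rightarrow> bool \<Rightarrow> bool \<Rightarrow> bool" where
  "positive_piece (Over_NE k) a b \<longleftrightarrow> a = b"
| "positive_piece (Over_NW k) a b \<longleftrightarrow> a \<noteq> b"
| "positive_piece p a b \<longleftrightarrow> False"

definition positive_crossings :: "piece list \<Rightarrow> (point \<Rightarrow> bool) \<Rightarrow> nat set" where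
  "positive_crossings D up = {t \<in> crossings D.
     positive_piece (D ! t) (up (t, position (D ! t))) (up (t, position (D ! t) + 1))}"

definition n_pos :: "piece list \<Rightarrow> (point \<Rightarrow> bool) \<Rightarrow> int" where
  "n_pos D up = int (card (positive_crossings D up))"

definition n_neg :: "piece list \<Rightarrow> (point \<Rightarrow> bool) \<Rightarrow> int" where
  "n_neg D up = int (card (crossings D - positive_crossings D up))"

text \<open>In the 0-resolution the overpass turns left: an overpass heading to the top right turns to the
  top left, one heading to the top left turns to the bottom left.\<close>

fun smooth :: "bool \<Rightarrow> piece \<Rightarrow> piece" where
  "smooth b (Over_NE k) = (if b then Horiz k else Vert k)"
| "smooth b (Over_NW k) = (if b then Vert k else Horiz k)"
| "smooth b p = p"

text \<open>Vertices of the cube \<open>{0,1}\<^sup>m\<close> are encoded as the sets of crossings with bit 1.\<close>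

definition resolve :: "piece list \<Rightarrow> nat set \<Rightarrow> piece list" where
  "resolve D i = map (\<lambda>t. smooth (t \<in> i) (D ! t)) [0..<length D]"

text \<open>The closing arc becomes the leftmost strand.\<close>

fun shift_piece :: "piece \<Rightarrow> piece" where
  "shift_piece (Cup k) = Cup (k + 1)"
| "shift_piece (Cap k) = Cap (k + 1)"
| "shift_piece (Over_NE k) = Over_NE (k + 1)"
| "shift_piece (Over_NW k) = Over_NW (k + 1)"
| "shift_piece (Vert k) = Vert (k + 1)"
| "shift_piece (Horiz k) = Horiz (k + 1)"

definition tangle_closure :: "piece list \<Rightarrow> piece list" where
  "tangle_closure T = Cup 0 # map shift_piece T @ [Cap 0]"

definition closure_orientation :: "(point \<Rightarrow> bool) \<Rightarrow> point \<Rightarrow> bool" where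
  "closure_orientation up = (\<lambda>(t, i). if i = 0 then \<not> up (0, 0) else up (t - 1, i - 1))"


section \<open>Planar 1-tangles\<close>

text \<open>Here \<open>S\<close> is a diagram with one end point \<open>(0, 0)\<close> (that is, \<open>p\<^sub>1\<close>) at the bottom, one end
  point \<open>p\<^sub>2\<close> at the top, and no crossings.\<close>

definition arc_component :: "piece list \<Rightarrow> point set" where
  "arc_component S = component 1 S (0, 0)"

definition circles :: "piece list \<Rightarrow> point set set" where
  "circles S = components 1 S - {arc_component S}"

text \<open>
  Gap \<open>g\<close> of a level is the interval between its points \<open>g - 1\<close> and \<open>g\<close> (or the boundary of the
  strip).  \<open>same_region p g h\<close>: inside the piece \<open>p\<close>, gap \<open>g\<close> below and gap \<open>h\<close> above border the
  same region.  For \<open>Horiz k\<close> the gaps \<open>k\<close> and \<open>k + 2\<close> on both sides border the region between the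
  cap and the cup.
\<close>

fun same_region :: "piece \<Rightarrow> nat \<Rightarrow> nat \<Rightarrow> bool" where
  "same_region (Cup k) g h \<longleftrightarrow> (g \<le> k \<and> h = g) \<or> (k \<le> g \<and> h = g + 2)"
| "same_region (Cap k) g h \<longleftrightarrow> (h \<le> k \<and> g = h) \<or> (k \<le> h \<and> g = h + 2)"
| "same_region (Vert k) g h \<longleftrightarrow> h = g"
| "same_region (Horiz k) g h \<longleftrightarrow>
     (h = g \<and> g \<noteq> k + 1) \<or> (g = k \<and> h = k + 2) \<or> (g = k + 2 \<and> h = k)"
| "same_region p g h \<longleftrightarrow> False"

text \<open>The gaps \<open>(t, g)\<close> that lie in the component of the complement of the circle \<open>c\<close> touching the
  boundary of the strip.\<close>

inductive outside :: "piece list \<Rightarrow> point set \<Rightarrow> nat \<Rightarrow> nat \<Rightarrow> bool" for S c where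
  boundary: "outside S c 0 0"
| to_right: "outside S c t g \<Longrightarrow> (t, g) \<in> points 1 S - c \<Longrightarrow> outside S c t (g + 1)"
| to_left: "outside S c t (g + 1) \<Longrightarrow> (t, g) \<in> points 1 S - c \<Longrightarrow> outside S c t g"
| upwards: "outside S c t g \<Longrightarrow> t < length S \<Longrightarrow> same_region (S ! t) g h \<Longrightarrow> outside S c (t + 1) h"
| downwards: "outside S c (t + 1) h \<Longrightarrow> t < length S \<Longrightarrow> same_region (S ! t) g h \<Longrightarrow> outside S c t g"

definition enclosed_by :: "piece list \<Rightarrow> point set \<Rightarrow> point set \<Rightarrow> bool" where
  "enclosed_by S c d \<longleftrightarrow> d \<noteq> c \<and> (\<forall>(t, g) \<in> d. \<not> outside S c t g)"

text \<open>
  The band at index \<open>t\<close> is the one whose surgery exchanges \<open>Vert k\<close> and \<open>Horiz k\<close>: for \<open>Vert k\<close> it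
  lies between the two strands, for \<open>Horiz k\<close> it lies above the cap and below the cup.
  \<open>band_east\<close> and \<open>band_west\<close> are the points of the strands at the band which have the band on
  their right-hand and on their left-hand side when traversed upwards.
\<close>

fun band_east :: "piece \<Rightarrow> nat \<Rightarrow> point set" where
  "band_east (Vert k) t = {(t, k), (t + 1, k)}"
| "band_east (Horiz k) t = {(t, k + 1), (t + 1, k + 1)}"
| "band_east p t = {}"

fun band_west :: "piece \<Rightarrow> nat \<Rightarrow> point set" where
  "band_west (Vert k) t = {(t, k + 1), (t + 1, k + 1)}"
| "band_west (Horiz k) t = {(t, k), (t + 1, k)}"
| "band_west p t = {}"

definition band_on_right :: "piece list \<Rightarrow> nat \<Rightarrow> bool" where
  "band_on_right S t \<longleftrightarrow> (\<exists>up. orientation 1 S up \<and> up (0, 0) \<and>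
     (\<exists>p \<in> arc_component S. p \<in> band_east (S ! t) t \<and> up p \<or> p \<in> band_west (S ! t) t \<and> \<not> up p))"


section \<open>Linear maps\<close>

text \<open>All maps are given by their matrices in the standard bases: the last arguments index the
  output, so that for instance \<open>mult_A a b c\<close> is the coefficient of \<open>c\<close> in \<open>m(a \<otimes> b)\<close>.\<close>

datatype basis_A = Ae | Ax

datatype basis_W = Alpha | Beta

fun bideg_A :: "basis_A \<Rightarrow> int \<times> int" where
  "bideg_A Ae = (0, 1)"
| "bideg_A Ax = (0, -1)"

fun bideg_W :: "basis_W \<Rightarrow> int \<times> int" where
  "bideg_W Alpha = (0, 0)"
| "bideg_W Beta = (0, -2)"

definition eta :: "basis_A \<Rightarrow> bit" where "eta a = of_bool (a = Ae)"
definition eta_dot :: "basis_A \<Rightarrow> bit" where "eta_dot a = of_bool (a = Ax)"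
definition eps :: "basis_A \<Rightarrow> bit" where "eps a = of_bool (a = Ax)"
definition eps_dot :: "basis_A \<Rightarrow> bit" where "eps_dot a = of_bool (a = Ae)"

definition mult_A :: "basis_A \<Rightarrow> basis_A \<Rightarrow> basis_A \<Rightarrow> bit" where
  "mult_A a b c = of_bool ((a, b, c) \<in> {(Ae, Ae, Ae), (Ae, Ax, Ax), (Ax, Ae, Ax)})"

definition comult_A :: "basis_A \<Rightarrow> basis_A \<Rightarrow> basis_A \<Rightarrow> bit" where
  "comult_A a b c = of_bool ((a, b, c) \<in> {(Ae, Ae, Ax), (Ae, Ax, Ae), (Ax, Ax, Ax)})"

definition a_0 :: "basis_W \<Rightarrow> basis_W \<Rightarrow> bit" where
  "a_0 w w' = of_bool (w = w')"

definition c_0 :: "basis_W \<Rightarrow> basis_W \<Rightarrow> bit" where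
  "c_0 w w' = of_bool (w = Alpha \<and> w' = Beta)"

type_synonym labelling = "point set \<Rightarrow> basis_A"

text \<open>\<open>id_on K\<close> and \<open>sigma_on K\<close> are the identity and the map \<open>\<Sigma>\<close> of the tensor product of one factor
  \<open>A\<close> for each circle in \<open>K\<close>.\<close>

definition id_on :: "point set set \<Rightarrow> labelling \<Rightarrow> labelling \<Rightarrow> bit" where
  "id_on K l l' = of_bool (\<forall>d\<in>K. l d = l' d)"

definition sigma_on :: "point set set \<Rightarrow> labelling \<Rightarrow> labelling \<Rightarrow> bit" where
  "sigma_on K l l' = (\<Sum>d\<in>K. of_bool (l d = Ax \<and> l' d = Ae) * id_on (K - {d}) l l')"

text \<open>
  The map assigned to the saddle from \<open>S\<close> to \<open>S'\<close> at index \<open>t\<close>.  The points \<open>(t, k)\<close> and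
  \<open>(t + 1, k + 1)\<close> lie on different strands both of \<open>Vert k\<close> and of \<open>Horiz k\<close>, so \<open>u, v\<close> and
  \<open>u', v'\<close> are the components meeting the band before and after the surgery; \<open>K\<close> is the set of
  circles which are not involved.  The last branch never occurs for
  resolutions of a diagram, since there every saddle is a split or a merge.
\<close>

definition saddle_map ::
  "piece list \<Rightarrow> piece list \<Rightarrow> nat \<Rightarrow> basis_W \<times> labelling \<Rightarrow> basis_W \<times> labelling \<Rightarrow> bit" where
  "saddle_map S S' t = (\<lambda>(w, l) (w', l').
     let k = position (S ! t);
         u = component 1 S (t, k); v = component 1 S (t + 1, k + 1);
         u' = component 1 S' (t, k); v' = component 1 S' (t + 1, k + 1);
         K = circles S - {u, v}
     in
       if u = v \<and> u' \<noteq> v' then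
         (if u \<noteq> arc_component S then
            a_0 w w' * comult_A (l u) (l' u') (l' v') * id_on K l l'
          else
            let c = (if u' = arc_component S' then v' else u');
                K_e = {d \<in> K. enclosed_by S' c d}; K_n = K - K_e
            in if band_on_right S' t then
                 (a_0 w w' * eta_dot (l' c) + c_0 w w' * eta (l' c)) * id_on K l l'
                 + c_0 w w' * eta_dot (l' c) * id_on K_n l l' * sigma_on K_e l l'
               else
                 a_0 w w' * eta_dot (l' c) * id_on K l l'
                 + c_0 w w' * eta_dot (l' c) * id_on K_n l l' * sigma_on K_e l l')
       else if u \<noteq> v \<and> u' = v' then
         (if u' \<noteq> arc_component S' then
            a_0 w w' * mult_A (l u) (l v) (l' u') * id_on K l l'
          else
            let c = (if u = arc_component S then v else u);
                K_e = {d \<in> K. enclosed_by S c d}; K_n = K - K_e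
            in if band_on_right S t then
                 (a_0 w w' * eps_dot (l c) + c_0 w w' * eps (l c)) * id_on K l l'
                 + c_0 w w' * eps_dot (l c) * id_on K_n l l' * sigma_on K_e l l'
               else
                 a_0 w w' * eps_dot (l c) * id_on K l l'
                 + c_0 w w' * eps_dot (l c) * id_on K_n l l' * sigma_on K_e l l')
       else 0)"

definition khovanov_map ::
  "piece list \<Rightarrow> piece list \<Rightarrow> nat \<Rightarrow> labelling \<Rightarrow> labelling \<Rightarrow> bit" where
  "khovanov_map S S' t l l' =
     (let k = position (S ! t);
          u = component 0 S (t, k); v = component 0 S (t + 1, k + 1);
          u' = component 0 S' (t, k); v' = component 0 S' (t + 1, k + 1);
          K = components 0 S - {u, v}
      in
        if u = v \<and> u' \<noteq> v' then comult_A (l u) (l' u') (l' v') * id_on K l l'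
        else if u \<noteq> v \<and> u' = v' then mult_A (l u) (l v) (l' u') * id_on K l l'
        else 0)"


section \<open>Bigraded vector spaces and homology\<close>

text \<open>A vector space over the field \<open>bit\<close> with two elements; a bigraded vector space is a family of
  such spaces indexed by bidegrees.\<close>

record 'v f2_space =
  vecs :: "'v set"
  vadd :: "'v \<Rightarrow> 'v \<Rightarrow> 'v"
  vscale :: "bit \<Rightarrow> 'v \<Rightarrow> 'v"

type_synonym 'v bigraded = "int \<times> int \<Rightarrow> 'v f2_space"

definition isomorphic :: "'v f2_space \<Rightarrow> 'w f2_space \<Rightarrow> bool" where
  "isomorphic V W \<longleftrightarrow> (\<exists>f. bij_betw f (vecs V) (vecs W) \<and>
     (\<forall>x\<in>vecs V. \<forall>y\<in>vecs V. f (vadd V x y) = vadd W (f x) (f y)) \<and>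
     (\<forall>a. \<forall>x\<in>vecs V. f (vscale V a x) = vscale W a (f x)))"

definition bigraded_isomorphic :: "'v bigraded \<Rightarrow> 'w bigraded \<Rightarrow> bool" where
  "bigraded_isomorphic V W \<longleftrightarrow> (\<forall>d. isomorphic (V d) (W d))"

text \<open>The tensor product \<open>V \<otimes> M\<close>, where \<open>V\<close> is the bigraded vector space with basis \<open>B\<close> whose
  element \<open>b\<close> has bidegree \<open>deg b\<close>: the function \<open>f\<close> represents \<open>\<Sum>b\<in>B. b \<otimes> f b\<close>.\<close>

definition tensor :: "'b set \<Rightarrow> ('b \<Rightarrow> int \<times> int) \<Rightarrow> 'v bigraded \<Rightarrow> ('b \<Rightarrow> 'v) bigraded" where
  "tensor B deg M d =
     \<lparr>vecs = (\<Pi>\<^sub>E b\<in>B. vecs (M (d - deg b))),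
      vadd = (\<lambda>f g. \<lambda>b\<in>B. vadd (M (d - deg b)) (f b) (g b)),
      vscale = (\<lambda>a f. \<lambda>b\<in>B. vscale (M (d - deg b)) a (f b))\<rparr>"

text \<open>A finitely generated cochain complex with a basis of homogeneous elements; \<open>coeff C g h\<close> is the
  coefficient of \<open>h\<close> in the differential of \<open>g\<close>.  Cochains are coefficient functions.\<close>

record 'g based_complex =
  gens :: "'g set"
  bideg :: "'g \<Rightarrow> int \<times> int"
  coeff :: "'g \<Rightarrow> 'g \<Rightarrow> bit"

definition cochains :: "'g based_complex \<Rightarrow> ('g \<Rightarrow> bit) set" where
  "cochains C = {z. \<forall>g. z g \<noteq> 0 \<longrightarrow> g \<in> gens C}"

definition homogeneous :: "'g based_complex \<Rightarrow> int \<times> int \<Rightarrow> ('g \<Rightarrow> bit) set" where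
  "homogeneous C d = {z \<in> cochains C. \<forall>g. z g \<noteq> 0 \<longrightarrow> bideg C g = d}"

definition differential :: "'g based_complex \<Rightarrow> ('g \<Rightarrow> bit) \<Rightarrow> 'g \<Rightarrow> bit" where
  "differential C z h = (if h \<in> gens C then \<Sum>g\<in>gens C. z g * coeff C g h else 0)"

definition cocycles :: "'g based_complex \<Rightarrow> int \<times> int \<Rightarrow> ('g \<Rightarrow> bit) set" where
  "cocycles C d = {z \<in> homogeneous C d. differential C z = (\<lambda>_. 0)}"

definition coboundaries :: "'g based_complex \<Rightarrow> int \<times> int \<Rightarrow> ('g \<Rightarrow> bit) set" where
  "coboundaries C d = differential C ` cochains C \<inter> homogeneous C d"

text \<open>The quotient of cocycles by coboundaries; its elements are cosets.\<close>

definition cohomology :: "'g based_complex \<Rightarrow> ('g \<Rightarrow> bit) set bigraded" where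
  "cohomology C d =
     \<lparr>vecs = (\<lambda>z. {\<lambda>g. z g + b g | b. b \<in> coboundaries C d}) ` cocycles C d,
      vadd = (\<lambda>X Y. {\<lambda>g. x g + y g | x y. x \<in> X \<and> y \<in> Y}),
      vscale = (\<lambda>a X. {\<lambda>g. a * x g + b g | x b. x \<in> X \<and> b \<in> coboundaries C d})\<rparr>"


section \<open>The complex of a tangle and reduced Khovanov homology\<close>

definition tangle_complex ::
  "piece list \<Rightarrow> (point \<Rightarrow> bool) \<Rightarrow> (nat set \<times> basis_W \<times> labelling) based_complex" where
  "tangle_complex T up =
     \<lparr>gens = {(i, w, l). i \<subseteq> crossings T \<and> l \<in> (\<Pi>\<^sub>E c\<in>circles (resolve T i). UNIV)},
      bideg = (\<lambda>(i, w, l).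
        bideg_W w + (\<Sum>c\<in>circles (resolve T i). bideg_A (l c))
        + (int (card i), 2 * int (card i)) + (- n_neg T up, n_pos T up - 3 * n_neg T up)),
      coeff = (\<lambda>(i, w, l) (j, w', l').
        \<Sum>t | t \<in> crossings T - i \<and> j = insert t i.
          saddle_map (resolve T i) (resolve T j) t (w, l) (w', l'))\<rparr>"

text \<open>
  The reduced Khovanov complex of an oriented link diagram \<open>L\<close> with a marked point \<open>p\<close>: the
  subcomplex of the Khovanov complex in which the circle through \<open>p\<close> is labelled by \<open>x\<close>.  The
  final shift by 1 of the quantum grading puts the homology of the unknot into bidegree \<open>(0, 0)\<close>.
\<close>

definition reduced_khovanov_complex ::
  "piece list \<Rightarrow> (point \<Rightarrow> bool) \<Rightarrow> point \<Rightarrow> (nat set \<times> labelling) based_complex" where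
  "reduced_khovanov_complex L up p =
     \<lparr>gens = {(i, l). i \<subseteq> crossings L \<and> l \<in> (\<Pi>\<^sub>E c\<in>components 0 (resolve L i). UNIV) \<and>
               l (component 0 (resolve L i) p) = Ax},
      bideg = (\<lambda>(i, l).
        (\<Sum>c\<in>components 0 (resolve L i). bideg_A (l c))
        + (int (card i), int (card i)) + (- n_neg L up, n_pos L up - 2 * n_neg L up) + (0, 1)),
      coeff = (\<lambda>(i, l) (j, l').
        \<Sum>t | t \<in> crossings L - i \<and> j = insert t i.
          khovanov_map (resolve L i) (resolve L j) t l l')\<rparr>"

definition Khr ::
  "piece list \<Rightarrow> (point \<Rightarrow> bool) \<Rightarrow> point \<Rightarrow> (nat set \<times> labelling \<Rightarrow> bit) set bigraded" where
  "Khr L up p = cohomology (reduced_khovanov_complex L up p)"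

text \<open>The bigraded vector space \<open>M\<close> with \<open>M\<^bsup>(h,q)\<^esup>\<close> placed in bidegree \<open>(h, h + q)\<close>.\<close>

definition regrade :: "'v bigraded \<Rightarrow> 'v bigraded" where
  "regrade M = (\<lambda>(h, q). M (h, q - h))"

text \<open>\<open>Khr\<close> of the closure, marked at the image \<open>(1, 1)\<close> of \<open>p\<^sub>1\<close>.\<close>

definition Khr_closure ::
  "piece list \<Rightarrow> (point \<Rightarrow> bool) \<Rightarrow> (nat set \<times> labelling \<Rightarrow> bit) set bigraded" where
  "Khr_closure T up = Khr (tangle_closure T) (closure_orientation up) (1, 1)"

end

theory Submission
  imports Defs
begin

text \<open>
  With the arc labelled by \<open>x\<close>, the coefficient of \<open>a\<^sub>0\<close> in the differential of \<open>C\<^sub>0\<close> is the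
  differential \<open>D\<close> of the reduced Khovanov complex of the closure.  Let \<open>h\<close> be the sum of the maps
  \<open>x \<mapsto> e\<close>, \<open>e \<mapsto> 0\<close> over the circles to the right of the arc.  These maps are derivations of \<open>m\<close>
  and coderivations of \<open>\<Delta>\<close>, so they commute with saddles between circles.  A saddle that splits a
  circle \<open>c\<close> from the arc, or merges it, moves exactly the circles enclosed by \<open>c\<close> to the other side
  of the arc; hence the coefficient of \<open>c\<^sub>0\<close> is \<open>D h + h D\<close>, and \<open>id + c\<^sub>0 h\<close> is an isomorphism
  from \<open>W\<^sub>0 \<otimes> D\<close> to \<open>C\<^sub>0\<close>.

  The planar topology is handled by counting modulo 2 the points of a curve to the left of a gap.
\<close>

section \<open>Components of a diagram\<close>

text \<open>The obstacle is that the maps of \<open>C_0\<close> depend on data that Khovanov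
  homology does not see: the side of the arc and enclosure. The homotopy \<open>h\<close> uses only
  the circles on the right because the given maps are asymmetric. A circle split from the arc is
  born with label x; on the right \<open>h\<close> turns x into e, which is the extra term with
  \<open>eta\<close>, and on the left \<open>h\<close> does not act on it. A circle away from the
  band contributes once before and once after the saddle, so modulo 2 it survives only if it changes
  sides, which gives the sum over enclosed circles. As \<open>c_0\<close> squares to zero,
  \<open>(id + c_0 h) D (id + c_0 h) = D + c_0 (D h + h D)\<close>, and \<open>id + c_0 h\<close> is
  its own inverse. It preserves the bigrading because \<open>c_0\<close> lowers the quantum degree
  by 2 and \<open>h\<close> raises it by 2, so \<open>V\<close> is \<open>W_0\<close> itself for
  every tangle. Enclosure is defined by the flood fill \<open>outside\<close>, whereas the effect of
  a merge on sides is additive modulo 2. A discrete Jordan curve theorem reconciles the two.\<close>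

lemma width_0 [simp]: "width n D 0 = n"
  by (simp add: width_def)

lemma width_Suc: "t < length D \<Longrightarrow> width n D (Suc t) = strands_above (width n D t) (D ! t)"
  by (simp add: width_def take_Suc_conv_app_nth)

lemma width_Cons: "width n (p # D) (Suc t) = width (strands_above n p) D t"
  by (simp add: width_def)

lemma width_length: "diagram n D m \<Longrightarrow> width n D (length D) = m"
  by (induction n D m rule: diagram.induct) (auto simp: width_Cons)

lemma diagram_fits: "diagram n D m \<Longrightarrow> t < length D \<Longrightarrow> fits (width n D t) (D ! t)"
proof (induction n D m arbitrary: t rule: diagram.induct)
  case (2 n p D m)
  then show ?case by (cases t) (auto simp: width_Cons)
qed simp

lemma finite_points: "finite (points n D)"
proof -
  have "points n D = (SIGMA t:{..length D}. {..<width n D t})"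
    by (auto simp: points_def)
  then show ?thesis by simp
qed


definition edges :: "nat \<Rightarrow> piece list \<Rightarrow> (point \<times> point) set" where
  "edges n D = runs n D \<union> turns n D"

text \<open>On the points of the diagram these sets are the unions of components. The test is an
  equivalence across each edge, so it passes to complements, and a component is the least saturated
  set through its starting point.\<close>

definition saturated :: "nat \<Rightarrow> piece list \<Rightarrow> point set \<Rightarrow> bool" where
  "saturated n D X \<longleftrightarrow> (\<forall>(p, q) \<in> edges n D. p \<in> X \<longleftrightarrow> q \<in> X)"

lemma saturatedD: "saturated n D X \<Longrightarrow> (p, q) \<in> edges n D \<Longrightarrow> p \<in> X \<longleftrightarrow> q \<in> X"
  by (auto simp: saturated_def)

lemma component_eq: "component n D p = {q. (p, q) \<in> (edges n D \<union> (edges n D)\<inverse>)\<^sup>*}"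
  by (simp add: component_def edges_def)

lemma edges_points: "edges n D \<subseteq> points n D \<times> points n D"
  by (auto simp: edges_def runs_def turns_def)

lemma self_in_component [simp, intro]: "p \<in> component n D p"
  by (simp add: component_eq)

lemma saturated_component: "saturated n D (component n D p)"
  unfolding saturated_def component_eq
  by (auto intro: rtrancl.rtrancl_into_rtrancl)

lemma component_induct [consumes 1, case_names base forward backward]:
  assumes "q \<in> component n D p" and "P p"
    and "\<And>a b. a \<in> component n D p \<Longrightarrow> (a, b) \<in> edges n D \<Longrightarrow> P a \<Longrightarrow> P b"
    and "\<And>a b. a \<in> component n D p \<Longrightarrow> (b, a) \<in> edges n D \<Longrightarrow> P a \<Longrightarrow> P b"
  shows "P q"
proof -
  have "(p, q) \<in> (edges n D \<union> (edges n D)\<inverse>)\<^sup>*" using assms(1) by (simp add: component_eq)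
  then show ?thesis
  proof induction
    case (step a b)
    then have "a \<in> component n D p" by (simp add: component_eq)
    then show ?case using step assms(3,4) by blast
  qed (rule assms(2))
qed

lemma component_subset: "saturated n D X \<Longrightarrow> p \<in> X \<Longrightarrow> component n D p \<subseteq> X"
proof
  fix q assume s: "saturated n D X" and p: "p \<in> X" and "q \<in> component n D p"
  from this(3) show "q \<in> X"
    by (induction rule: component_induct) (use s p in \<open>auto dest: saturatedD\<close>)
qed

lemma component_disjoint: "saturated n D X \<Longrightarrow> p \<notin> X \<Longrightarrow> component n D p \<inter> X = {}"
  using component_subset[of n D "- X" p] by (auto simp: saturated_def)

lemma component_cong: "q \<in> component n D p \<Longrightarrow> component n D q = component n D p"
proof
  assume q: "q \<in> component n D p"
  show "component n D q \<subseteq> component n D p"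
    by (rule component_subset[OF saturated_component q])
  have "p \<in> component n D q"
    using component_disjoint[OF saturated_component, of p n D q] q by blast
  then show "component n D p \<subseteq> component n D q"
    by (rule component_subset[OF saturated_component])
qed

lemma component_eq_iff: "component n D p = component n D q \<longleftrightarrow> q \<in> component n D p"
  using component_cong self_in_component by blast

lemma component_subset_points: "p \<in> points n D \<Longrightarrow> component n D p \<subseteq> points n D"
  by (rule component_subset) (use edges_points in \<open>auto simp: saturated_def\<close>)

lemma components_disjoint:
  "c \<in> components n D \<Longrightarrow> d \<in> components n D \<Longrightarrow> c \<noteq> d \<Longrightarrow> c \<inter> d = {}"
  unfolding components_def using component_cong by blast

lemma component_of_member: "c \<in> components n D \<Longrightarrow> p \<in> c \<Longrightarrow> component n D p = c"
  unfolding components_def using component_cong by blast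

lemma components_nonempty: "c \<in> components n D \<Longrightarrow> c \<noteq> {}"
  unfolding components_def by auto

lemma components_saturated: "c \<in> components n D \<Longrightarrow> saturated n D c"
  unfolding components_def by (auto simp: saturated_component)

lemma components_points: "c \<in> components n D \<Longrightarrow> c \<subseteq> points n D"
  unfolding components_def using component_subset_points by blast

lemma finite_components: "finite (components n D)"
  by (simp add: components_def finite_points)


section \<open>Sides of curves\<close>

fun planar_piece :: "piece \<Rightarrow> bool" where
  "planar_piece (Over_NE k) = False"
| "planar_piece (Over_NW k) = False"
| "planar_piece p = True"

definition planar_diagram :: "nat \<Rightarrow> piece list \<Rightarrow> nat \<Rightarrow> bool" where
  "planar_diagram n S m \<longleftrightarrow> diagram n S m \<and> (\<forall>p \<in> set S. planar_piece p)"

lemma planar_fits: "planar_diagram n S m \<Longrightarrow> t < length S \<Longrightarrow> fits (width n S t) (S ! t)"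
  unfolding planar_diagram_def using diagram_fits by blast

lemma planar_nth: "planar_diagram n S m \<Longrightarrow> t < length S \<Longrightarrow> planar_piece (S ! t)"
  by (simp add: planar_diagram_def)

text \<open>For a closed curve this is the winding number modulo 2 around the gap; for an arc from
  bottom to top it is the side of the arc. A point \<open>(t, i)\<close> is evaluated at the gap
  \<open>i\<close> on its left; if the point is not in \<open>X\<close>, the gap on its right gives
  the same value.\<close>

primrec parity :: "point set \<Rightarrow> nat \<Rightarrow> nat \<Rightarrow> bool" where
  "parity X t 0 = False"
| "parity X t (Suc g) = (parity X t g \<noteq> ((t, g) \<in> X))"

text \<open>The displacement 2 serves the strands to the right of a cup or cap, the displacement 0
  all others.\<close>

lemma parity_transport:
  assumes "parity X t a = parity X t' (a + d)"
    and "\<And>i. a \<le> i \<Longrightarrow> i < g \<Longrightarrow> (t, i) \<in> X \<longleftrightarrow> (t', i + d) \<in> X" and "a \<le> g"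
  shows "parity X t g = parity X t' (g + d)"
  using assms(3,2)
proof (induction g rule: dec_induct)
  case (step g)
  then show ?case by simp
qed (use assms(1) in simp)

lemma run_edge:
  assumes "t < length D" and "passes (D ! t) i j" and "i < width n D t" and "j < width n D (Suc t)"
  shows "((t, i), (Suc t, j)) \<in> edges n D"
  using assms unfolding edges_def runs_def points_def by auto

lemma turn_edge_below:
  assumes "t < length D" and "D ! t \<in> {Cap k, Horiz k}" and "Suc k < width n D t"
  shows "((t, k), (t, Suc k)) \<in> edges n D"
  using assms unfolding edges_def turns_def points_def by auto

lemma turn_edge_above:
  assumes "t < length D" and "D ! t \<in> {Cup k, Horiz k}" and "Suc k < width n D (Suc t)"
  shows "((Suc t, k), (Suc t, Suc k)) \<in> edges n D"
  using assms unfolding edges_def turns_def points_def by auto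

lemma edge_cases:
  assumes "(p, q) \<in> edges n D"
  obtains (run) t i j where "p = (t, i)" "q = (Suc t, j)" "t < length D" "passes (D ! t) i j"
      "i < width n D t" "j < width n D (Suc t)"
  | (below) t k where "p = (t, k)" "q = (t, Suc k)" "t < length D" "D ! t \<in> {Cap k, Horiz k}"
      "Suc k < width n D t"
  | (above) t k where "p = (Suc t, k)" "q = (Suc t, Suc k)" "t < length D"
      "D ! t \<in> {Cup k, Horiz k}" "Suc k < width n D (Suc t)"
  using assms unfolding edges_def runs_def turns_def points_def by fastforce

lemma same_region_width:
  assumes "fits n p" "same_region p g h"
  shows "g \<le> n \<longleftrightarrow> h \<le> strands_above n p"
  using assms by (cases p) auto

text \<open>A cup or cap adds or removes two neighbouring points joined by a turn. A saturated set
  contains both or neither, so their contribution vanishes modulo 2, while the strands to the left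
  and right of them correspond.\<close>

lemma parity_same_region:
  assumes S: "planar_diagram n S m" and X: "saturated n S X" and t: "t < length S"
    and r: "same_region (S ! t) g h" and g: "g \<le> width n S t"
  shows "parity X t g = parity X (Suc t) h"
proof -
  define w where "w = width n S t"
  have f: "fits w (S ! t)" using planar_fits[OF S t] by (simp add: w_def)
  have w': "width n S (Suc t) = strands_above w (S ! t)" using t by (simp add: width_Suc w_def)
  have run: "(t, i) \<in> X \<longleftrightarrow> (Suc t, j) \<in> X"
    if "passes (S ! t) i j" "i < w" "j < strands_above w (S ! t)" for i j
    using saturatedD[OF X run_edge[OF t that(1)]] that w' by (auto simp: w_def)
  have below: "(t, k) \<in> X \<longleftrightarrow> (t, Suc k) \<in> X" if "S ! t \<in> {Cap k, Horiz k}" for k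
    using saturatedD[OF X turn_edge_below[OF t that]] f that by (auto simp: w_def)
  have above: "(Suc t, k) \<in> X \<longleftrightarrow> (Suc t, Suc k) \<in> X" if "S ! t \<in> {Cup k, Horiz k}" for k
    using saturatedD[OF X turn_edge_above[OF t that]] f that w' by (auto simp: w_def)
  note g = g[folded w_def]
  show ?thesis
  proof (cases "S ! t")
    case (Cup k)
    have "(t, i) \<in> X \<longleftrightarrow> (Suc t, i) \<in> X" if "i < k" for i
      using run[of i i] Cup f that by auto
    then have low: "parity X t i = parity X (Suc t) i" if "i \<le> k" for i
      using parity_transport[of X t 0 "Suc t" 0 i] that by auto
    have "(t, i) \<in> X \<longleftrightarrow> (Suc t, i + 2) \<in> X" if "k \<le> i" "i < w" for i
      using run[of i "i + 2"] Cup f that by auto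
    moreover have "parity X t k = parity X (Suc t) (k + 2)"
      using low[of k] above[of k] Cup by auto
    ultimately have "parity X t i = parity X (Suc t) (i + 2)" if "k \<le> i" "i \<le> w" for i
      using parity_transport[of X t k "Suc t" 2 i] that by auto
    then show ?thesis using r g low Cup by auto
  next
    case (Cap k)
    have "(t, i) \<in> X \<longleftrightarrow> (Suc t, i) \<in> X" if "i < k" for i
      using run[of i i] Cap f that by auto
    then have low: "parity X t i = parity X (Suc t) i" if "i \<le> k" for i
      using parity_transport[of X t 0 "Suc t" 0 i] that by auto
    have "(t, i + 2) \<in> X \<longleftrightarrow> (Suc t, i) \<in> X" if "k \<le> i" "i + 2 < w" for i
      using run[of "i + 2" i] Cap f that by auto
    moreover have "parity X t (k + 2) = parity X (Suc t) k"
      using low[of k] below[of k] Cap by auto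
    ultimately have "parity X (Suc t) i = parity X t (i + 2)" if "k \<le> i" "i + 2 \<le> w" for i
      using parity_transport[of X "Suc t" k t 2 i] that by auto
    then show ?thesis using r g low Cap by auto
  next
    case (Vert k)
    have "(t, i) \<in> X \<longleftrightarrow> (Suc t, i) \<in> X" if "i < w" for i
      using run[of i i] Vert that by auto
    then have "parity X t i = parity X (Suc t) i" if "i \<le> w" for i
      using parity_transport[of X t 0 "Suc t" 0 i] that by auto
    then show ?thesis using r g Vert by auto
  next
    case (Horiz k)
    have same: "(t, i) \<in> X \<longleftrightarrow> (Suc t, i) \<in> X" if "i < k \<or> k + 2 \<le> i" "i < w" for i
      using run[of i i] Horiz that by auto
    then have low: "parity X t i = parity X (Suc t) i" if "i \<le> k" for i
      using parity_transport[of X t 0 "Suc t" 0 i] that Horiz f by auto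
    \<comment> \<open>The cap and the cup may belong to different components, but the two points of
      each cancel on their own level.\<close>
    have mid: "parity X t k = parity X t (k + 2)" "parity X (Suc t) k = parity X (Suc t) (k + 2)"
      using above[of k] below[of k] Horiz by auto
    then have "parity X t (k + 2) = parity X (Suc t) (k + 2)" using low[of k] by blast
    then have high: "parity X t i = parity X (Suc t) i" if "k + 2 \<le> i" "i \<le> w" for i
      using parity_transport[of X t "k + 2" "Suc t" 0 i] same that by auto
    have "g = k + 2 \<and> h = k \<or> g = k \<and> h = k + 2 \<or> h = g \<and> (g \<le> k \<or> k + 2 \<le> g)"
      using r Horiz by auto
    then show ?thesis using low[of k] low[of g] mid high[of g] g by blast
  qed (use planar_nth[OF S t] in auto)
qed

lemma passes_same_region:
  "planar_piece p \<Longrightarrow> passes p i j \<Longrightarrow> same_region p i j \<and> same_region p (Suc i) (Suc j)"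
  by (cases p) auto

lemma parity_run:
  assumes "planar_diagram n S m" and "saturated n S X" and "t < length S"
    and "passes (S ! t) i j" and "i < width n S t"
  shows "parity X t i = parity X (Suc t) j"
  using parity_same_region[OF assms(1-3)] passes_same_region[OF planar_nth[OF assms(1,3)] assms(4)]
    assms(5) by simp

text \<open>A run keeps direction and parity. A turn joins neighbouring points of the same
  component, so it reverses the direction and changes the parity by one. The relation therefore
  propagates from the starting point.\<close>

lemma orientation_parity:
  assumes S: "planar_diagram n S m" and up: "orientation n S up" and q: "q \<in> component n S p"
    and p: "up p \<longleftrightarrow> \<not> parity (component n S p) (fst p) (snd p)"
  shows "up q \<longleftrightarrow> \<not> parity (component n S p) (fst q) (snd q)"
proof -
  define X where "X = component n S p"
  have X: "saturated n S X" by (simp add: X_def saturated_component)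
  have step: "(up a \<longleftrightarrow> \<not> parity X (fst a) (snd a)) \<longleftrightarrow> (up b \<longleftrightarrow> \<not> parity X (fst b) (snd b))"
    if e: "(a, b) \<in> edges n S" and a: "a \<in> X" for a b
    using e
  proof (cases rule: edge_cases)
    case (run t i j)
    have "(a, b) \<in> runs n S" using run by (auto simp: runs_def points_def)
    then have "up a = up b" using up by (auto simp: orientation_def)
    then show ?thesis using parity_run[OF S X run(3-5)] run by simp
  next
    case (below t k)
    have "(a, b) \<in> turns n S" using below by (auto simp: turns_def points_def)
    then have "up a \<noteq> up b" using up by (auto simp: orientation_def)
    then show ?thesis using a below by auto
  next
    case (above t k)
    have "(a, b) \<in> turns n S" using above by (auto simp: turns_def points_def)
    then have "up a \<noteq> up b" using up by (auto simp: orientation_def)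
    then show ?thesis using a above by auto
  qed
  show ?thesis using q
  proof (induction rule: component_induct)
    case base
    then show ?case using p .
  next
    case (forward a b)
    then show ?case using step X_def by blast
  next
    case (backward a b)
    then show ?case using step X_def saturatedD[OF X] by blast
  qed
qed

text \<open>Without crossings a strand moves by 0 or 2 positions, and a turn joins neighbouring
  positions. This is the witness for the orientation demanded by
  \<open>band_on_right\<close>.\<close>

lemma alternating_orientation:
  assumes S: "planar_diagram n S m"
  shows "orientation n S (\<lambda>(t, i). even i)"
proof -
  have "even i = even j" if "((t, i), (t', j)) \<in> runs n S" for t i t' j
  proof -
    have "t < length S" "passes (S ! t) i j" using that by (auto simp: runs_def)
    moreover from this(1) have "planar_piece (S ! t)" by (rule planar_nth[OF S])
    ultimately show ?thesis by (cases "S ! t") (auto split: if_splits)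
  qed
  moreover have "even i \<noteq> even j" if "((t, i), (t', j)) \<in> turns n S" for t i t' j
    using that by (auto simp: turns_def)
  ultimately show ?thesis by (auto simp: orientation_def)
qed

text \<open>Along a run the strand stays beside the same regions; the two positions of a turn are
  separated only by a point of the component itself, which is not in \<open>X\<close>.\<close>

lemma parity_const_off:
  assumes S: "planar_diagram n S m" and X: "saturated n S X" and p: "p \<notin> X"
    and q: "q \<in> component n S p"
  shows "parity X (fst q) (snd q) = parity X (fst p) (snd p)"
proof -
  have off: "a \<notin> X" if "a \<in> component n S p" for a
    using component_disjoint[OF X p] that by blast
  have step: "parity X (fst a) (snd a) = parity X (fst b) (snd b)"
    if e: "(a, b) \<in> edges n S" and a: "a \<notin> X" for a b
    using e by (cases rule: edge_cases) (use a parity_run[OF S X] in auto)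
  show ?thesis using q
  proof (induction rule: component_induct)
    case (forward a b)
    then show ?case using step off by metis
  next
    case (backward a b)
    then show ?case using step off saturatedD[OF X] by metis
  qed simp
qed

text \<open>The rightmost gaps of all levels border the region along the right edge of the
  strip.\<close>

lemma parity_total:
  assumes S: "planar_diagram n S m" and X: "saturated n S X" and t: "t \<le> length S"
  shows "parity X t (width n S t) = parity X 0 n"
  using t
proof (induction t)
  case (Suc t)
  then have t: "t < length S" by simp
  have "same_region (S ! t) (width n S t) (width n S (Suc t))"
    using planar_fits[OF S t] planar_nth[OF S t] by (cases "S ! t") (auto simp: width_Suc[OF t])
  then show ?case using parity_same_region[OF S X t] Suc by simp
qed simp

text \<open>The arc has one point on the bottom level, hence an odd number on the top level, which
  has only one point. Counting replaces following the arc.\<close>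

lemma arc_reaches_top:
  assumes S: "planar_diagram 1 S 1"
  shows "(length S, 0) \<in> arc_component S"
proof -
  have "width 1 S (length S) = 1" using S by (simp add: planar_diagram_def width_length)
  then show ?thesis
    using parity_total[OF S saturated_component, of "length S" "(0, 0)"]
    by (simp add: arc_component_def)
qed

section \<open>A discrete Jordan curve theorem\<close>

lemma outside_left_boundary:
  assumes S: "planar_diagram 1 S m" and t: "t \<le> length S"
  shows "outside S c t 0"
  using t
proof (induction t)
  case (Suc t)
  then have t: "t < length S" by simp
  have "same_region (S ! t) 0 0"
    using planar_nth[OF S t] by (cases "S ! t") auto
  then show ?case using outside.upwards[of S c t 0 0] Suc t by simp
qed (rule outside.boundary)

lemma outside_walk:
  assumes "outside S c t g" and "t \<le> length S" and "g \<le> g'" and "g' \<le> width 1 S t"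
    and "\<And>i. g \<le> i \<Longrightarrow> i < g' \<Longrightarrow> (t, i) \<notin> c"
  shows "outside S c t g'"
  using assms(3,4,5)
proof (induction g' rule: dec_induct)
  case (step i)
  then show ?case using outside.to_right[of S c t i] assms(2) by (auto simp: points_def)
qed (use assms(1) in simp)

text \<open>The easy half of the Jordan curve theorem: each move of the flood fill stays in a region
  or passes a point not on \<open>c\<close>. The width bound is carried along so that
  \<open>parity_same_region\<close> stays applicable.\<close>

lemma outside_even:
  assumes S: "planar_diagram 1 S m" and c: "saturated 1 S c" and "outside S c t g"
  shows "g \<le> width 1 S t \<and> \<not> parity c t g"
  using assms(3)
proof induction
  case (upwards t g h)
  then show ?case
    using parity_same_region[OF S c] same_region_width[OF planar_fits[OF S]] width_Suc by auto
next
  case (downwards t h g)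
  then show ?case
    using parity_same_region[OF S c] same_region_width[OF planar_fits[OF S]] width_Suc by auto
qed (auto simp: points_def)

text \<open>The two gaps beside a point of \<open>c\<close> have different parities. Outside gaps
  are even, so this is the only side of the curve that can be outside.\<close>

definition even_gap :: "point set \<Rightarrow> point \<Rightarrow> nat" where
  "even_gap c p = (if parity c (fst p) (snd p) then Suc (snd p) else snd p)"

text \<open>Walking along the curve \<open>c\<close>, the gap on its even side stays in the same component of the
  complement.\<close>

lemma outside_along:
  assumes S: "planar_diagram 1 S m" and c: "saturated 1 S c" and e: "(p, q) \<in> edges 1 S"
    and p: "p \<in> c"
  shows "outside S c (fst p) (even_gap c p) \<longleftrightarrow> outside S c (fst q) (even_gap c q)"
  using e
proof (cases rule: edge_cases)
  case (run t i j)
  have r: "same_region (S ! t) i j" "same_region (S ! t) (Suc i) (Suc j)"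
    using passes_same_region[OF planar_nth[OF S]] run by auto
  have "parity c t i = parity c (Suc t) j" by (rule parity_run[OF S c run(3-5)])
  then show ?thesis
    using r run outside.upwards[OF _ run(3)] outside.downwards[OF _ run(3)]
    by (auto simp: even_gap_def)
next
  case (below t k)
  have "same_region (S ! t) k k" "same_region (S ! t) (k + 2) k" using below by auto
  then have "outside S c t k \<longleftrightarrow> outside S c t (Suc (Suc k))"
    using outside.upwards[OF _ below(3)] outside.downwards[OF _ below(3)] by fastforce
  then show ?thesis using p below by (auto simp: even_gap_def)
next
  case (above t k)
  have "same_region (S ! t) k k" "same_region (S ! t) k (k + 2)" using above by auto
  then have "outside S c (Suc t) k \<longleftrightarrow> outside S c (Suc t) (Suc (Suc k))"
    using outside.upwards[OF _ above(3)] outside.downwards[OF _ above(3)] by fastforce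
  then show ?thesis using p above by (auto simp: even_gap_def)
qed

text \<open>The hard half of the Jordan curve theorem: since \<open>c\<close> is connected, a single
  outside gap beside it can be carried along the whole curve.\<close>

lemma outside_even_gap:
  assumes S: "planar_diagram 1 S m" and c: "c \<in> components 1 S" and q: "q \<in> c"
  shows "outside S c (fst q) (even_gap c q)"
proof -
  note sat = components_saturated[OF c]
  obtain t where t: "\<exists>i. (t, i) \<in> c" using components_nonempty[OF c] by auto
  \<comment> \<open>Up to the leftmost point of \<open>c\<close> on a level nothing obstructs the
    way from the left boundary.\<close>
  define j where "j = (LEAST i. (t, i) \<in> c)"
  have j: "(t, j) \<in> c" using t unfolding j_def by (auto intro: LeastI_ex)
  have less: "(t, i) \<notin> c" if "i < j" for i using that not_less_Least unfolding j_def by blast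
  have pts: "t \<le> length S" "j < width 1 S t" using components_points[OF c] j by (auto simp: points_def)
  have out: "outside S c t j"
    by (rule outside_walk[OF outside_left_boundary[OF S pts(1)]]) (use pts less in auto)
  then have start: "outside S c t (even_gap c (t, j))"
    using outside_even[OF S sat out] by (simp add: even_gap_def)
  have cc: "component 1 S (t, j) = c" by (rule component_of_member[OF c j])
  have "q \<in> component 1 S (t, j)" using q cc by simp
  then show ?thesis
  proof (induction rule: component_induct)
    case base
    then show ?case using start by simp
  next
    case (forward a b)
    then show ?case using outside_along[OF S sat] cc by blast
  next
    case (backward a b)
    then show ?case using outside_along[OF S sat] cc saturatedD[OF sat] by blast
  qed
qed

text \<open>Going right along a level, an even gap is either reached from an even gap past a point
  not on \<open>c\<close>, or it is the even side of a point of \<open>c\<close>, where the walk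
  along the curve is needed.\<close>

lemma outside_iff_even:
  assumes S: "planar_diagram 1 S m" and c: "c \<in> components 1 S"
    and t: "t \<le> length S" and g: "g \<le> width 1 S t"
  shows "outside S c t g \<longleftrightarrow> \<not> parity c t g"
proof
  assume "outside S c t g"
  then show "\<not> parity c t g" using outside_even[OF S components_saturated[OF c]] by blast
next
  assume "\<not> parity c t g"
  then show "outside S c t g" using g
  proof (induction g)
    case 0
    then show ?case using outside_left_boundary[OF S t] by simp
  next
    case (Suc g)
    show ?case
    proof (cases "(t, g) \<in> c")
      case True
      then have "even_gap c (t, g) = Suc g" using Suc.prems by (simp add: even_gap_def)
      then show ?thesis using outside_even_gap[OF S c True] by simp
    next
      case False
      then show ?thesis using Suc outside.to_right[of S c t g] t by (auto simp: points_def)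
    qed
  qed
qed

text \<open>A component other than \<open>c\<close> has constant parity with respect to
  \<open>c\<close>, so a single point decides the condition imposed on all of them.\<close>

lemma enclosed_by_iff_parity:
  assumes S: "planar_diagram 1 S m" and c: "c \<in> components 1 S" and d: "d \<in> components 1 S"
    and ne: "d \<noteq> c" and p: "(t, i) \<in> d"
  shows "enclosed_by S c d \<longleftrightarrow> parity c t i"
proof -
  have dc: "d \<inter> c = {}" using components_disjoint[OF d c ne] .
  have "parity c s j = parity c t i" if "(s, j) \<in> d" for s j
    using parity_const_off[OF S components_saturated[OF c], of "(t, i)" "(s, j)"]
      component_of_member[OF d p] that dc p by auto
  moreover have "outside S c s j \<longleftrightarrow> \<not> parity c s j" if "(s, j) \<in> d" for s j
    using outside_iff_even[OF S c] components_points[OF d] that by (auto simp: points_def)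
  ultimately have "\<not> outside S c s j \<longleftrightarrow> parity c t i" if "(s, j) \<in> d" for s j
    using that by blast
  then show ?thesis using p ne unfolding enclosed_by_def by blast
qed


section \<open>Band surgery\<close>

text \<open>Additivity is the advantage of parity over \<open>outside\<close>: it compares the arc
  before and after a merge with a circle.\<close>

lemma parity_Un:
  "X \<inter> Y = {} \<Longrightarrow> parity (X \<union> Y) t g \<longleftrightarrow> parity X t g \<noteq> parity Y t g"
  by (induction g) auto

lemma saturated_Un: "saturated n D X \<Longrightarrow> saturated n D Y \<Longrightarrow> saturated n D (X \<union> Y)"
  by (auto simp: saturated_def)

lemma arc_in_components: "arc_component S \<in> components 1 S"
  by (auto simp: arc_component_def components_def points_def)

lemma circlesD:
  assumes "d \<in> circles S"
  shows "d \<in> components 1 S" "d \<noteq> arc_component S" "d \<inter> arc_component S = {}"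
proof -
  show *: "d \<in> components 1 S" "d \<noteq> arc_component S" using assms by (simp_all add: circles_def)
  show "d \<inter> arc_component S = {}" by (rule components_disjoint[OF *(1) arc_in_components *(2)])
qed

lemma finite_circles: "finite (circles S)"
  by (simp add: circles_def finite_components)

text \<open>The left edge of the strip has even parity and lies to the left of the arc traversed
  from bottom to top, so odd parity means right. One point decides for the whole circle, as
  \<open>right_circles_iff\<close> shows.\<close>

definition right_circles :: "piece list \<Rightarrow> point set set" where
  "right_circles S = {d \<in> circles S. \<exists>(t, i) \<in> d. parity (arc_component S) t i}"

lemma right_circles_iff:
  assumes S: "planar_diagram 1 S m" and d: "d \<in> circles S" and p: "(t, i) \<in> d"
  shows "d \<in> right_circles S \<longleftrightarrow> parity (arc_component S) t i"
proof -
  note d' = circlesD[OF d]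
  have "parity (arc_component S) s j = parity (arc_component S) t i" if "(s, j) \<in> d" for s j
    using parity_const_off[OF S components_saturated[OF arc_in_components], of "(t, i)" "(s, j)"]
      component_of_member[OF d'(1) p] d' that p by auto
  then show ?thesis using d p unfolding right_circles_def by blast
qed

text \<open>The assumptions are symmetric in \<open>S\<close> and \<open>S'\<close>, so the locale
  describes a split as well as the merge that undoes it, and an inclusion proved in one direction
  yields the other through \<open>reverse\<close>.\<close>

locale surgery =
  fixes S S' :: "piece list" and t k :: nat
  assumes S: "planar_diagram 1 S 1" and S': "planar_diagram 1 S' 1"
    and t: "t < length S" and length: "length S' = length S"
    and other: "\<And>s. s \<noteq> t \<Longrightarrow> s < length S \<Longrightarrow> S' ! s = S ! s"
    and band: "S ! t = Vert k \<and> S' ! t = Horiz k \<or> S ! t = Horiz k \<and> S' ! t = Vert k"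
begin

lemma reverse: "surgery S' S t k"
  by unfold_locales (use S S' t length other band in auto)

abbreviation "u \<equiv> component 1 S (t, k)"
abbreviation "v \<equiv> component 1 S (t + 1, k + 1)"
abbreviation "u' \<equiv> component 1 S' (t, k)"
abbreviation "v' \<equiv> component 1 S' (t + 1, k + 1)"

definition "corners = {(t, k), (t, k + 1), (t + 1, k), (t + 1, k + 1)}"

lemma width_eq: "s \<le> length S \<Longrightarrow> width 1 S' s = width 1 S s"
proof (induction s)
  case (Suc s)
  then show ?case using other[of s] band length by (cases "s = t") (auto simp: width_Suc)
qed simp

lemma points_eq: "points 1 S' = points 1 S"
  unfolding points_def using width_eq length by auto

lemma k_less: "Suc k < width 1 S t" "Suc k < width 1 S (Suc t)"
  using planar_fits[OF S t] band by (auto simp: width_Suc[OF t])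

lemma corners_points: "corners \<subseteq> points 1 S"
  using k_less t by (auto simp: corners_def points_def)

text \<open>The two shapes of the band piece differ only in edges among its four corners; all levels
  keep their widths, so every other edge survives.\<close>

lemma edges_change: "(p, q) \<in> edges 1 S \<Longrightarrow> (p, q) \<in> edges 1 S' \<or> p \<in> corners \<and> q \<in> corners"
proof -
  assume "(p, q) \<in> edges 1 S"
  then show ?thesis
  proof (cases rule: edge_cases)
    case (run s i j)
    show ?thesis
    proof (cases "s = t \<and> i \<in> {k, k + 1}")
      case True
      then show ?thesis using run band by (auto simp: corners_def)
    next
      case False
      then have "passes (S' ! s) i j" using run band other[of s] by (cases "s = t") auto
      then show ?thesis using run_edge[of s S' i j 1] run by (simp add: length width_eq[unfolded One_nat_def])
    qed
  next
    case (below s i)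
    then show ?thesis using band other[of s] turn_edge_below[of s S' i 1]
      by (cases "s = t") (auto simp: corners_def length width_eq[unfolded One_nat_def])
  next
    case (above s i)
    then show ?thesis using band other[of s] turn_edge_above[of s S' i 1]
      by (cases "s = t") (auto simp: corners_def length width_eq[unfolded One_nat_def])
  qed
qed

text \<open>An edge among the corners cannot leave a set that contains all corners or none of
  them.\<close>

lemma saturated_change:
  "saturated 1 S' X \<Longrightarrow> corners \<subseteq> X \<or> corners \<inter> X = {} \<Longrightarrow> saturated 1 S X"
  unfolding saturated_def using edges_change by blast

lemma corner_edges:
  "S ! t = Vert k \<Longrightarrow> ((t, k), (t + 1, k)) \<in> edges 1 S \<and> ((t, k + 1), (t + 1, k + 1)) \<in> edges 1 S"
  "S ! t = Horiz k \<Longrightarrow> ((t, k), (t, k + 1)) \<in> edges 1 S \<and> ((t + 1, k), (t + 1, k + 1)) \<in> edges 1 S"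
  using k_less t run_edge[of t S] turn_edge_below[of t S k 1] turn_edge_above[of t S k 1]
  by (auto intro!: run_edge)

lemma corner_members:
  "(t, k) \<in> u" "(t + 1, k + 1) \<in> v"
  "S ! t = Vert k \<Longrightarrow> (t + 1, k) \<in> u \<and> (t, k + 1) \<in> v"
  "S ! t = Horiz k \<Longrightarrow> (t, k + 1) \<in> u \<and> (t + 1, k) \<in> v"
  using corner_edges saturatedD[OF saturated_component] self_in_component by blast+

lemma corners_subset: "corners \<subseteq> u \<union> v"
  using corner_members band by (auto simp: corners_def)

text \<open>The right-hand side involves only the union of the two components, which turns out to be
  invariant under the surgery. Hence the arc meets the band after the surgery if and only if it did
  before.\<close>

lemma arc_touched_iff: "arc_component S \<in> {u, v} \<longleftrightarrow> (0, 0) \<in> u \<union> v"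
  using component_eq_iff[of 1 S] component_cong[of "(0,0)" 1 S] unfolding arc_component_def by blast

lemma uv_components: "u \<in> components 1 S" "v \<in> components 1 S"
  using corners_points by (auto simp: components_def corners_def)

end

context surgery
begin

interpretation rev: surgery S' S t k by (rule reverse)

lemma corners_rev: "rev.corners = corners"
  by (simp add: corners_def rev.corners_def)

text \<open>The set \<open>u' \<union> v'\<close> contains all four corners, so it is saturated for
  \<open>S\<close> as well.\<close>

lemma uv_subset: "u \<union> v \<subseteq> u' \<union> v'"
proof -
  have "saturated 1 S (u' \<union> v')"
    by (rule saturated_change[OF saturated_Un[OF saturated_component saturated_component]])
      (use rev.corners_subset corners_rev in auto)
  moreover have "(t, k) \<in> u' \<union> v'" "(t + 1, k + 1) \<in> u' \<union> v'" by auto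
  ultimately show ?thesis using component_subset by (metis Un_least)
qed

lemma untouched_disjoint:
  assumes "d \<in> components 1 S - {u, v}"
  shows "d \<inter> (u \<union> v) = {}" "d \<inter> corners = {}"
  using assms components_disjoint[of d 1 S] uv_components corners_subset by blast+

lemma untouched_component:
  assumes d: "d \<in> components 1 S - {u, v}" and p: "p \<in> d"
  shows "component 1 S' p = d"
proof
  have s: "saturated 1 S' d"
    by (rule rev.saturated_change) (use d untouched_disjoint[OF d] components_saturated corners_rev in auto)
  show sub: "component 1 S' p \<subseteq> d" by (rule component_subset[OF s p])
  have "saturated 1 S (component 1 S' p)"
    by (rule saturated_change[OF saturated_component]) (use sub untouched_disjoint[OF d] in auto)
  then have "component 1 S p \<subseteq> component 1 S' p" by (rule component_subset) simp
  then show "d \<subseteq> component 1 S' p" using component_of_member[of d 1 S p] d p by auto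
qed

lemma untouched_subset: "components 1 S - {u, v} \<subseteq> components 1 S' - {u', v'}"
proof
  fix d assume d: "d \<in> components 1 S - {u, v}"
  obtain p where p: "p \<in> d" using components_nonempty d by blast
  have "p \<in> points 1 S'" using components_points d p points_eq by blast
  then have "d \<in> components 1 S'"
    using untouched_component[OF d p] by (auto simp: components_def)
  moreover have "d \<noteq> u'" "d \<noteq> v'"
    using untouched_disjoint(2)[OF d] by (auto simp: corners_def)
  ultimately show "d \<in> components 1 S' - {u', v'}" by blast
qed

end

context surgery
begin

text \<open>The context is reopened and the reversed surgery interpreted again, so that
  \<open>rev\<close> also provides the inclusions just proved.\<close>

interpretation rev: surgery S' S t k by (rule reverse)

lemma uv_eq: "u \<union> v = u' \<union> v'"
  using uv_subset rev.uv_subset by blast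

lemma untouched_eq: "components 1 S - {u, v} = components 1 S' - {u', v'}"
  using untouched_subset rev.untouched_subset by blast

lemma arc_untouched: "arc_component S \<notin> {u, v} \<Longrightarrow> arc_component S' = arc_component S"
  using untouched_component[of "arc_component S" "(0, 0)"] arc_in_components
  by (simp add: arc_component_def)

lemma arc_touched_rev: "arc_component S' \<in> {u', v'} \<longleftrightarrow> arc_component S \<in> {u, v}"
  unfolding arc_touched_iff rev.arc_touched_iff uv_eq ..

lemma circles_untouched: "circles S - {u, v} = circles S' - {u', v'}"
proof (cases "arc_component S \<in> {u, v}")
  case True
  then have "circles S - {u, v} = components 1 S - {u, v}" by (auto simp: circles_def)
  moreover have "circles S' - {u', v'} = components 1 S' - {u', v'}"
    using True arc_touched_rev by (auto simp: circles_def)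
  ultimately show ?thesis using untouched_eq by simp
next
  case False
  have "circles S - {u, v} = (components 1 S - {u, v}) - {arc_component S}"
    "circles S' - {u', v'} = (components 1 S' - {u', v'}) - {arc_component S'}"
    by (auto simp: circles_def)
  then show ?thesis using untouched_eq arc_untouched[OF False] by simp
qed

text \<open>The circles \<open>d\<close> and \<open>d'\<close> may differ, for instance as a circle
  and one of its two parts after a split. At the common point both sides are read off from the same
  arc.\<close>

lemma right_circles_arc_untouched:
  assumes "arc_component S \<notin> {u, v}" and d: "d \<in> circles S" and d': "d' \<in> circles S'"
    and p: "p \<in> d" "p \<in> d'"
  shows "d \<in> right_circles S \<longleftrightarrow> d' \<in> right_circles S'"
proof -
  obtain s i where "p = (s, i)" by fastforce
  with p have "(s, i) \<in> d" "(s, i) \<in> d'" by auto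
  then show ?thesis
    using right_circles_iff[OF S d] right_circles_iff[OF S' d'] arc_untouched[OF assms(1)] by metis
qed

text \<open>The merged arc is the disjoint union of the old arc and \<open>c\<close>, so the two
  parities at \<open>d\<close> differ by the parity with respect to \<open>c\<close>, which is odd
  exactly when \<open>c\<close> encloses \<open>d\<close>.\<close>

lemma right_circles_arc_touched:
  assumes uv: "{u, v} = {arc_component S, c}" and ne: "u \<noteq> v" "u' = v'"
    and d: "d \<in> circles S - {u, v}"
  shows "(d \<in> right_circles S) \<noteq> (d \<in> right_circles S') \<longleftrightarrow> enclosed_by S c d"
proof -
  have c: "c \<in> components 1 S" "c \<noteq> arc_component S"
    using uv ne uv_components by (auto simp: doubleton_eq_iff)
  have dc: "d \<in> components 1 S" "d \<noteq> c" using d uv by (auto simp: circles_def)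
  obtain s i where p: "(s, i) \<in> d" using components_nonempty[OF dc(1)] by auto
  have d': "d \<in> circles S'" using d circles_untouched by blast
  have "arc_component S' = arc_component S \<union> c"
  proof -
    have "arc_component S' \<in> {u', v'}" using arc_touched_rev uv by blast
    then have "arc_component S' = u' \<union> v'" using ne(2) by auto
    moreover have "arc_component S \<union> c = u \<union> v" using uv by (metis Union_insert Sup_empty sup_bot.right_neutral)
    ultimately show ?thesis using uv_eq by simp
  qed
  moreover have "arc_component S \<inter> c = {}"
    using components_disjoint[OF arc_in_components c(1)] c(2) by auto
  ultimately have "parity (arc_component S') s i
      \<longleftrightarrow> parity (arc_component S) s i \<noteq> parity c s i"
    by (simp add: parity_Un)
  then show ?thesis
    using right_circles_iff[OF S _ p] right_circles_iff[OF S' d' p]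
      enclosed_by_iff_parity[OF S c(1) dc p] d by blast
qed

text \<open>An orientation for which the arc starts upwards is determined on the arc by parity, so
  it can be eliminated; the alternating orientation shows that one exists.\<close>

lemma band_on_right_iff_parity:
  "band_on_right S t \<longleftrightarrow> (\<exists>(s, i) \<in> arc_component S.
     (s, i) \<in> band_east (S ! t) t \<and> \<not> parity (arc_component S) s i \<or>
     (s, i) \<in> band_west (S ! t) t \<and> parity (arc_component S) s i)"
proof -
  have *: "up p \<longleftrightarrow> \<not> parity (arc_component S) (fst p) (snd p)"
    if "orientation 1 S up" "up (0, 0)" "p \<in> arc_component S" for up p
    using orientation_parity[OF S that(1), of p "(0, 0)"] that(2,3)
    by (simp add: arc_component_def)
  have ev: "orientation 1 S (\<lambda>(t, i). even i)" by (rule alternating_orientation[OF S])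
  show ?thesis
  proof
    assume "band_on_right S t"
    then obtain up p where "orientation 1 S up" "up (0, 0)" "p \<in> arc_component S"
      and "p \<in> band_east (S ! t) t \<and> up p \<or> p \<in> band_west (S ! t) t \<and> \<not> up p"
      unfolding band_on_right_def by blast
    then show "\<exists>(s, i) \<in> arc_component S.
     (s, i) \<in> band_east (S ! t) t \<and> \<not> parity (arc_component S) s i \<or>
     (s, i) \<in> band_west (S ! t) t \<and> parity (arc_component S) s i"
      using *[of up p] by (cases p) auto
  next
    assume "\<exists>(s, i) \<in> arc_component S.
     (s, i) \<in> band_east (S ! t) t \<and> \<not> parity (arc_component S) s i \<or>
     (s, i) \<in> band_west (S ! t) t \<and> parity (arc_component S) s i"
    then obtain s i where p: "(s, i) \<in> arc_component S"
      and side: "(s, i) \<in> band_east (S ! t) t \<and> \<not> parity (arc_component S) s i \<or>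
        (s, i) \<in> band_west (S ! t) t \<and> parity (arc_component S) s i"
      by blast
    have "even i \<longleftrightarrow> \<not> parity (arc_component S) s i" using *[OF ev _ p] by simp
    with side have "(s, i) \<in> band_east (S ! t) t \<and> (\<lambda>(t, i). even i) (s, i) \<or>
        (s, i) \<in> band_west (S ! t) t \<and> \<not> (\<lambda>(t, i). even i) (s, i)" by simp
    then show "band_on_right S t"
      unfolding band_on_right_def
      by (intro exI[of _ "\<lambda>(t, i). even i"] conjI bexI[OF _ p] ev) auto
  qed
qed

text \<open>One end of the band is on the arc and the other on \<open>c\<close>, with nothing in
  between, so the band leaves the arc on the side where \<open>c\<close> lies. The four cases are
  the two shapes of the piece and the two roles of \<open>u\<close> and \<open>v\<close>.\<close>

lemma band_on_right_iff:
  assumes uv: "{u, v} = {arc_component S, c}" and ne: "u \<noteq> v"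
  shows "band_on_right S t \<longleftrightarrow> c \<in> right_circles S"
proof -
  let ?A = "arc_component S"
  have sat: "saturated 1 S ?A" using arc_in_components components_saturated by blast
  have c: "c \<in> circles S"
    using uv ne uv_components by (auto simp: doubleton_eq_iff circles_def)
  have disj: "u \<inter> v = {}" using components_disjoint uv_components ne by blast
  have cases: "?A = u \<and> c = v \<or> ?A = v \<and> c = u" using uv by (auto simp: doubleton_eq_iff)
  have right: "c \<in> right_circles S \<longleftrightarrow> parity ?A s i" if "(s, i) \<in> c" for s i
    using right_circles_iff[OF S c that] .
  \<comment> \<open>In both shapes the gap \<open>k\<close> borders the same region below and above,
    which makes the band ends on the two levels comparable.\<close>
  have level: "parity ?A t k = parity ?A (t + 1) k"
    using parity_same_region[OF S sat t, of k k] k_less band by auto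
  have ex: "(\<exists>(s, i)\<in>A. (s, i) \<in> {(a, a'), (b, b')} \<and> P s i \<or> (s, i) \<in> {(c, c'), (d, d')} \<and> Q s i) \<longleftrightarrow>
      (a, a') \<in> A \<and> P a a' \<or> (b, b') \<in> A \<and> P b b' \<or> (c, c') \<in> A \<and> Q c c' \<or> (d, d') \<in> A \<and> Q d d'"
    for A :: "point set" and a a' b b' c c' d d' P Q by blast
  note m = corner_members
  show ?thesis
  proof (cases "S ! t = Vert k")
    case True
    note m = m(1,2) m(3)[OF True]
    have b: "band_east (S ! t) t = {(t, k), (t + 1, k)}" "band_west (S ! t) t = {(t, k + 1), (t + 1, k + 1)}"
      by (simp_all add: True)
    from cases show ?thesis
    proof
      assume A: "?A = u \<and> c = v"
      then have mem: "(t, k) \<in> ?A" "(t + 1, k) \<in> ?A" "(t, k + 1) \<notin> ?A" "(t + 1, k + 1) \<notin> ?A"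
        using m disj by auto
      have "(t, k + 1) \<in> c" using A m by auto
      from right[OF this] show ?thesis
        unfolding band_on_right_iff_parity b ex using mem level by simp
    next
      assume A: "?A = v \<and> c = u"
      then have mem: "(t, k) \<notin> ?A" "(t + 1, k) \<notin> ?A" "(t, k + 1) \<in> ?A" "(t + 1, k + 1) \<in> ?A"
        using m disj by auto
      have "(t, k) \<in> c" using A m by auto
      from right[OF this] show ?thesis
        unfolding band_on_right_iff_parity b ex using mem level by simp
    qed
  next
    case False
    then have H: "S ! t = Horiz k" using band by auto
    note m = m(1,2) m(4)[OF H]
    have b: "band_east (S ! t) t = {(t, k + 1), (t + 1, k + 1)}" "band_west (S ! t) t = {(t, k), (t + 1, k)}"
      by (simp_all add: H)
    from cases show ?thesis
    proof
      assume A: "?A = u \<and> c = v"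
      then have mem: "(t, k) \<in> ?A" "(t + 1, k) \<notin> ?A" "(t, k + 1) \<in> ?A" "(t + 1, k + 1) \<notin> ?A"
        using m disj by auto
      have "(t + 1, k) \<in> c" using A m by auto
      from right[OF this] show ?thesis
        unfolding band_on_right_iff_parity b ex using mem level by simp
    next
      assume A: "?A = v \<and> c = u"
      then have mem: "(t, k) \<notin> ?A" "(t + 1, k) \<in> ?A" "(t, k + 1) \<notin> ?A" "(t + 1, k + 1) \<in> ?A"
        using m disj by auto
      have "(t, k) \<in> c" using A m by auto
      from right[OF this] show ?thesis
        unfolding band_on_right_iff_parity b ex using mem level by simp
    qed
  qed
qed

end


section \<open>Twisted complexes\<close>

text \<open>Sums and products over the two-element field stay in ring form instead of becoming
  bitwise operations, so that the laws of rings and of finite sums apply.\<close>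

declare add_bit_eq_xor [simp del] mult_bit_eq_and [simp del]

lemma bit_add_self: "x + x = (0::bit)"
  by (cases x) simp_all

section \<open>Cohomology classes as cosets\<close>

definition coset :: "'g based_complex \<Rightarrow> int \<times> int \<Rightarrow> ('g \<Rightarrow> bit) \<Rightarrow> ('g \<Rightarrow> bit) set" where
  "coset C d z = {\<lambda>g. z g + b g | b. b \<in> coboundaries C d}"

lemma vecs_cohomology: "vecs (cohomology C d) = coset C d ` cocycles C d"
  by (simp add: cohomology_def coset_def)

lemma vadd_cohomology:
  "vadd (cohomology C d) X Y = {\<lambda>g. x g + y g | x y. x \<in> X \<and> y \<in> Y}"
  by (simp add: cohomology_def)

lemma vscale_cohomology:
  "vscale (cohomology C d) a X = {\<lambda>g. a * x g + b g | x b. x \<in> X \<and> b \<in> coboundaries C d}"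
  by (simp add: cohomology_def)

lemma cochains_add: "x \<in> cochains C \<Longrightarrow> y \<in> cochains C \<Longrightarrow> (\<lambda>g. x g + y g) \<in> cochains C"
  by (force simp: cochains_def)

lemma cochains_outside: "x \<in> cochains C \<Longrightarrow> g \<notin> gens C \<Longrightarrow> x g = 0"
  unfolding cochains_def by blast

lemma cochains_scale: "x \<in> cochains C \<Longrightarrow> (\<lambda>g. a * x g) \<in> cochains C"
  by (force simp: cochains_def)

lemma cochains_zero: "(\<lambda>g. 0) \<in> cochains C"
  by (simp add: cochains_def)

lemma differential_cochain: "differential C z \<in> cochains C"
  by (simp add: cochains_def differential_def)

lemma differential_zero: "differential C (\<lambda>g. 0) = (\<lambda>g. 0)"
  by (simp add: differential_def fun_eq_iff)

lemma coboundaries_cochains: "b \<in> coboundaries C d \<Longrightarrow> b \<in> cochains C"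
  by (auto simp: coboundaries_def homogeneous_def)

lemma cocycles_cochains: "z \<in> cocycles C d \<Longrightarrow> z \<in> cochains C"
  by (auto simp: cocycles_def homogeneous_def)

lemma zero_coboundary: "(\<lambda>g. 0) \<in> coboundaries C d"
  unfolding coboundaries_def homogeneous_def
  using differential_zero[of C, symmetric] cochains_zero[of C] by (auto intro!: image_eqI)

lemma coset_cochains: "z \<in> cocycles C d \<Longrightarrow> coset C d z \<subseteq> cochains C"
  unfolding coset_def using cocycles_cochains coboundaries_cochains cochains_add by blast

lemma self_in_coset: "z \<in> coset C d z"
  unfolding coset_def using zero_coboundary[of C d] by force

text \<open>\<open>\<Phi>\<close> takes two copies of \<open>K\<close> to \<open>C\<close>; bidegree \<open>d\<close> of \<open>C\<close> corresponds to bidegree \<open>e b d\<close> in copy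
  \<open>b\<close> of \<open>K\<close>.\<close>

locale double_complex =
  fixes K :: "'k based_complex" and C :: "'c based_complex"
    and \<Phi> :: "('k \<Rightarrow> bit) \<Rightarrow> ('k \<Rightarrow> bit) \<Rightarrow> 'c \<Rightarrow> bit"
    and e :: "nat \<Rightarrow> int \<times> int \<Rightarrow> int \<times> int"
  assumes add: "\<And>x y x' y'. \<lbrakk>x \<in> cochains K; y \<in> cochains K; x' \<in> cochains K; y' \<in> cochains K\<rbrakk> \<Longrightarrow>
      \<Phi> (\<lambda>g. x g + x' g) (\<lambda>g. y g + y' g) = (\<lambda>c. \<Phi> x y c + \<Phi> x' y' c)"
    and scale: "\<And>x y a. x \<in> cochains K \<Longrightarrow> y \<in> cochains K \<Longrightarrow>
      \<Phi> (\<lambda>g. a * x g) (\<lambda>g. a * y g) = (\<lambda>c. a * \<Phi> x y c)"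
    and inj: "\<And>x y x' y'. \<lbrakk>x \<in> cochains K; y \<in> cochains K; x' \<in> cochains K; y' \<in> cochains K;
      \<Phi> x y = \<Phi> x' y'\<rbrakk> \<Longrightarrow> x = x' \<and> y = y'"
    and cochain: "\<And>x y. x \<in> cochains K \<Longrightarrow> y \<in> cochains K \<Longrightarrow> \<Phi> x y \<in> cochains C"
    and surj: "\<And>z. z \<in> cochains C \<Longrightarrow> \<exists>x\<in>cochains K. \<exists>y\<in>cochains K. z = \<Phi> x y"
    and differential: "\<And>x y. x \<in> cochains K \<Longrightarrow> y \<in> cochains K \<Longrightarrow>
      differential C (\<Phi> x y) = \<Phi> (differential K x) (differential K y)"
    and homogeneous: "\<And>x y d. x \<in> cochains K \<Longrightarrow> y \<in> cochains K \<Longrightarrow>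
      \<Phi> x y \<in> homogeneous C d \<longleftrightarrow> x \<in> homogeneous K (e 0 d) \<and> y \<in> homogeneous K (e 1 d)"
begin

lemma zero: "\<Phi> (\<lambda>g. 0) (\<lambda>g. 0) = (\<lambda>c. 0)"
  using scale[OF cochains_zero cochains_zero, of 0] by simp

lemma cocycles_iff:
  "x \<in> cochains K \<Longrightarrow> y \<in> cochains K \<Longrightarrow>
    \<Phi> x y \<in> cocycles C d \<longleftrightarrow> x \<in> cocycles K (e 0 d) \<and> y \<in> cocycles K (e 1 d)"
  unfolding cocycles_def mem_Collect_eq homogeneous differential
  using inj[OF differential_cochain differential_cochain cochains_zero cochains_zero] zero by metis

lemma coboundaries_iff:
  assumes x: "x \<in> cochains K" and y: "y \<in> cochains K"
  shows "\<Phi> x y \<in> coboundaries C d \<longleftrightarrow> x \<in> coboundaries K (e 0 d) \<and> y \<in> coboundaries K (e 1 d)"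
proof
  assume A: "\<Phi> x y \<in> coboundaries C d"
  then obtain z where z: "z \<in> cochains C" "\<Phi> x y = Defs.differential C z"
    by (auto simp: coboundaries_def)
  obtain x' y' where "x' \<in> cochains K" "y' \<in> cochains K" "z = \<Phi> x' y'" using surj z by blast
  with z have "\<Phi> x y = \<Phi> (Defs.differential K x') (Defs.differential K y')"
    "x' \<in> cochains K" "y' \<in> cochains K"
    using differential by auto
  with inj[OF x y differential_cochain differential_cochain]
  show "x \<in> coboundaries K (e 0 d) \<and> y \<in> coboundaries K (e 1 d)"
    using A homogeneous[OF x y] by (auto simp: coboundaries_def)
next
  assume "x \<in> coboundaries K (e 0 d) \<and> y \<in> coboundaries K (e 1 d)"
  then obtain x' y' where "x' \<in> cochains K" "y' \<in> cochains K"
    "x = Defs.differential K x'" "y = Defs.differential K y'"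
    and "x \<in> Defs.homogeneous K (e 0 d)" "y \<in> Defs.homogeneous K (e 1 d)"
    by (auto simp: coboundaries_def)
  then show "\<Phi> x y \<in> coboundaries C d"
    using differential[of x' y'] homogeneous[OF x y] cochain
    unfolding coboundaries_def by (metis IntI image_eqI)
qed

lemma coboundaries_eq:
  "coboundaries C d = {\<Phi> b b' | b b'. b \<in> coboundaries K (e 0 d) \<and> b' \<in> coboundaries K (e 1 d)}"
proof
  show "coboundaries C d \<subseteq> {\<Phi> b b' | b b'. b \<in> coboundaries K (e 0 d) \<and> b' \<in> coboundaries K (e 1 d)}"
  proof
    fix z assume z: "z \<in> coboundaries C d"
    then obtain x y where "x \<in> cochains K" "y \<in> cochains K" "z = \<Phi> x y"
      using surj coboundaries_cochains by blast
    then show "z \<in> {\<Phi> b b' | b b'. b \<in> coboundaries K (e 0 d) \<and> b' \<in> coboundaries K (e 1 d)}"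
      using z coboundaries_iff by blast
  qed
  show "{\<Phi> b b' | b b'. b \<in> coboundaries K (e 0 d) \<and> b' \<in> coboundaries K (e 1 d)} \<subseteq> coboundaries C d"
    using coboundaries_iff coboundaries_cochains by blast
qed

lemma coset_eq:
  assumes "x \<in> cochains K" "y \<in> cochains K"
  shows "coset C d (\<Phi> x y) = {\<Phi> x' y' | x' y'. x' \<in> coset K (e 0 d) x \<and> y' \<in> coset K (e 1 d) y}"
proof -
  have "(\<lambda>c. \<Phi> x y c + \<Phi> b b' c) = \<Phi> (\<lambda>g. x g + b g) (\<lambda>g. y g + b' g)"
    if "b \<in> coboundaries K (e 0 d)" "b' \<in> coboundaries K (e 1 d)" for b b'
    using add[of x y b b'] assms that coboundaries_cochains by metis
  note eq = this
  have "coset C d (\<Phi> x y) = {\<lambda>c. \<Phi> x y c + \<Phi> b b' c | b b'.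
      b \<in> coboundaries K (e 0 d) \<and> b' \<in> coboundaries K (e 1 d)}"
    unfolding coset_def coboundaries_eq by blast
  also have "\<dots> = {\<Phi> (\<lambda>g. x g + b g) (\<lambda>g. y g + b' g) | b b'.
      b \<in> coboundaries K (e 0 d) \<and> b' \<in> coboundaries K (e 1 d)}"
    by (intro Collect_cong ex_cong1) (use eq in auto)
  finally show ?thesis unfolding coset_def by blast
qed

text \<open>Whole cosets are mapped, so no representatives are chosen and independence of a choice
  needs no proof.\<close>

definition transfer :: "(nat \<Rightarrow> ('k \<Rightarrow> bit) set) \<Rightarrow> ('c \<Rightarrow> bit) set" where
  "transfer f = {\<Phi> x y | x y. x \<in> f 0 \<and> y \<in> f 1}"

text \<open>The premise makes a vector of the tensor product in degree \<open>d\<close> a pair of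
  cosets of \<open>K\<close>, which \<Phi> carries to a coset of \<open>C\<close>.\<close>

lemma tensor_cohomology:
  assumes e: "\<And>b. b < 2 \<Longrightarrow> regrade (cohomology K) (d - deg b) = cohomology K (e b d)"
  shows "isomorphic (tensor {0, 1} deg (regrade (cohomology K)) d) (cohomology C d)"
proof -
  let ?V = "tensor {0, 1} deg (regrade (cohomology K)) d"
  have V: "vecs ?V = (\<Pi>\<^sub>E b\<in>{0, 1}. coset K (e b d) ` cocycles K (e b d))"
    unfolding tensor_def f2_space.simps by (rule PiE_cong) (auto simp: e vecs_cohomology)
  have Vadd: "vadd ?V f g = (\<lambda>b\<in>{0, 1}. {\<lambda>k. x k + y k | x y. x \<in> f b \<and> y \<in> g b})" for f g
    unfolding tensor_def f2_space.simps
    by (rule ext) (auto simp: restrict_def e vadd_cohomology)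
  have Vscale: "vscale ?V a f = (\<lambda>b\<in>{0, 1}. {\<lambda>k. a * x k + y k | x y. x \<in> f b \<and> y \<in> coboundaries K (e b d)})"
    for a f
    unfolding tensor_def f2_space.simps
    by (rule ext) (auto simp: restrict_def e vscale_cohomology)
  have mem: "\<exists>x\<in>cocycles K (e b d). f b = coset K (e b d) x" if "f \<in> vecs ?V" "b < 2" for f b
  proof -
    have "f b \<in> coset K (e b d) ` cocycles K (e b d)" using that unfolding V by (auto simp: less_2_cases_iff)
    then show ?thesis by blast
  qed
  have sub: "f b \<subseteq> cochains K" if "f \<in> vecs ?V" "b < 2" for f b
    using mem[OF that] coset_cochains by metis
  have sub0: "x \<in> cochains K" if "f \<in> vecs ?V" "x \<in> f 0" for f x using sub[of f 0] that by auto
  have sub1: "x \<in> cochains K" if "f \<in> vecs ?V" "x \<in> f 1" for f x using sub[of f 1] that by auto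
  have ne: "f b \<noteq> {}" if "f \<in> vecs ?V" "b < 2" for f b
    using mem[OF that] self_in_coset by blast
  have transfer: "transfer f = coset C d (\<Phi> x y)"
    if "f 0 = coset K (e 0 d) x" "f 1 = coset K (e 1 d) y" "x \<in> cochains K" "y \<in> cochains K" for f x y
    unfolding coset_eq[OF that(3,4)] transfer_def that(1,2) ..
  have le: "f 0 \<subseteq> g 0 \<and> f 1 \<subseteq> g 1" if f: "f \<in> vecs ?V" and g: "g \<in> vecs ?V" and eq: "transfer f = transfer g" for f g
  proof -
    have "x \<in> g 0 \<and> y \<in> g 1" if xy: "x \<in> f 0" "y \<in> f 1" for x y
    proof -
      have "\<Phi> x y \<in> transfer f" using xy unfolding transfer_def by blast
      then have "\<Phi> x y \<in> transfer g" by (simp only: eq)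
      then obtain x' y' where *: "x' \<in> g 0" "y' \<in> g 1" "\<Phi> x y = \<Phi> x' y'" unfolding transfer_def by blast
      then have "x = x' \<and> y = y'"
        using inj[of x y x' y'] sub0[OF f xy(1)] sub1[OF f xy(2)] sub0[OF g] sub1[OF g] by blast
      then show ?thesis using * by blast
    qed
    \<comment> \<open>Since neither coset is empty, a member of one can be completed to a pair, so
      each coset is determined by the set of pairs.\<close>
    then show ?thesis using ne[OF f, of 0] ne[OF f, of 1] by auto
  qed
  have "inj_on transfer (vecs ?V)"
  proof (rule inj_onI)
    fix f g assume fg: "f \<in> vecs ?V" "g \<in> vecs ?V" "transfer f = transfer g"
    have "f 0 = g 0" "f 1 = g 1" using le[OF fg] le[OF fg(2,1) fg(3)[symmetric]] by auto
    then show "f = g" using fg(1,2) unfolding V by (intro PiE_ext) auto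
  qed
  moreover have "transfer ` vecs ?V = vecs (cohomology C d)"
  proof
    show "transfer ` vecs ?V \<subseteq> vecs (cohomology C d)"
    proof
      fix A assume "A \<in> transfer ` vecs ?V"
      then obtain f where f: "f \<in> vecs ?V" "A = transfer f" by blast
      obtain x where x: "x \<in> cocycles K (e 0 d)" "f 0 = coset K (e 0 d) x" using mem[OF f(1), of 0] by auto
      obtain y where y: "y \<in> cocycles K (e 1 d)" "f 1 = coset K (e 1 d) y" using mem[OF f(1), of 1] by auto
      note xy = cocycles_cochains[OF x(1)] cocycles_cochains[OF y(1)]
      have "\<Phi> x y \<in> cocycles C d" using cocycles_iff[OF xy] x y by simp
      then show "A \<in> vecs (cohomology C d)"
        using transfer[of f, OF x(2) y(2) xy] f(2) by (simp add: vecs_cohomology)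
    qed
    show "vecs (cohomology C d) \<subseteq> transfer ` vecs ?V"
    proof
      fix A assume "A \<in> vecs (cohomology C d)"
      then obtain z where z: "z \<in> cocycles C d" "A = coset C d z" by (auto simp: vecs_cohomology)
      then obtain x y where xy: "x \<in> cochains K" "y \<in> cochains K" "z = \<Phi> x y"
        using surj[OF cocycles_cochains] by blast
      define f where "f = (\<lambda>b\<in>{0, 1::nat}. if b = 0 then coset K (e 0 d) x else coset K (e 1 d) y)"
      have "f \<in> vecs ?V"
        unfolding V using z xy cocycles_iff[of x y d] by (auto simp: f_def)
      moreover have "transfer f = A"
        using transfer[of f x y] xy z by (simp add: f_def)
      ultimately show "A \<in> transfer ` vecs ?V" by blast
    qed
  qed
  moreover have "transfer (vadd ?V f g) = vadd (cohomology C d) (transfer f) (transfer g)"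
    if f: "f \<in> vecs ?V" and g: "g \<in> vecs ?V" for f g
  proof -
    have eq: "\<Phi> (\<lambda>k. x k + x' k) (\<lambda>k. y k + y' k) = (\<lambda>c. \<Phi> x y c + \<Phi> x' y' c)"
      if "x \<in> f 0" "y \<in> f 1" "x' \<in> g 0" "y' \<in> g 1" for x y x' y'
      using add sub0 sub1 f g that by metis
    have "transfer (vadd ?V f g) =
      {\<Phi> (\<lambda>k. x k + x' k) (\<lambda>k. y k + y' k) | x y x' y'. x \<in> f 0 \<and> y \<in> f 1 \<and> x' \<in> g 0 \<and> y' \<in> g 1}"
      unfolding transfer_def Vadd by (simp, blast)
    also have "\<dots> = {\<lambda>c. \<Phi> x y c + \<Phi> x' y' c | x y x' y'. x \<in> f 0 \<and> y \<in> f 1 \<and> x' \<in> g 0 \<and> y' \<in> g 1}"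
      by (intro Collect_cong ex_cong1) (use eq in auto)
    also have "\<dots> = vadd (cohomology C d) (transfer f) (transfer g)"
      unfolding vadd_cohomology transfer_def by blast
    finally show ?thesis .
  qed
  moreover have "transfer (vscale ?V a f) = vscale (cohomology C d) a (transfer f)"
    if f: "f \<in> vecs ?V" for f a
  proof -
    have eq: "\<Phi> (\<lambda>k. a * x k + b k) (\<lambda>k. a * y k + b' k) = (\<lambda>c. a * \<Phi> x y c + \<Phi> b b' c)"
      if "x \<in> f 0" "y \<in> f 1" "b \<in> coboundaries K (e 0 d)" "b' \<in> coboundaries K (e 1 d)" for x y b b'
    proof -
      have xy: "x \<in> cochains K" "y \<in> cochains K" using sub0 sub1 f that by blast+
      show ?thesis
        using add[of "\<lambda>k. a * x k" "\<lambda>k. a * y k" b b'] cochains_scale[OF xy(1)] cochains_scale[OF xy(2)]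
          coboundaries_cochains that(3,4) scale[OF xy] by metis
    qed
    have "transfer (vscale ?V a f) =
      {\<Phi> (\<lambda>k. a * x k + b k) (\<lambda>k. a * y k + b' k) | x y b b'. x \<in> f 0 \<and> y \<in> f 1 \<and>
        b \<in> coboundaries K (e 0 d) \<and> b' \<in> coboundaries K (e 1 d)}"
      unfolding transfer_def Vscale by (simp, blast)
    also have "\<dots> = {\<lambda>c. a * \<Phi> x y c + \<Phi> b b' c | x y b b'. x \<in> f 0 \<and> y \<in> f 1 \<and>
        b \<in> coboundaries K (e 0 d) \<and> b' \<in> coboundaries K (e 1 d)}"
      by (intro Collect_cong ex_cong1) (use eq in auto)
    also have "\<dots> = vscale (cohomology C d) a (transfer f)"
      unfolding vscale_cohomology transfer_def coboundaries_eq by blast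
    finally show ?thesis .
  qed
  ultimately show ?thesis
    unfolding isomorphic_def bij_betw_def by (intro exI[of _ transfer] conjI ballI allI)
qed

end

text \<open>The complex \<open>C\<close> is the tensor product of \<open>W\<^sub>0\<close> and \<open>K\<close> with the differential twisted by the
  homotopy \<open>h\<close>, so that \<open>id + c\<^sub>0 h\<close> untwists it.\<close>

locale twisted_complex =
  fixes K :: "'k based_complex" and C :: "'c based_complex"
    and \<omega> :: "'c \<Rightarrow> basis_W" and \<pi> :: "'c \<Rightarrow> 'k" and h :: "'k \<Rightarrow> 'k \<Rightarrow> bit"
  assumes bij: "bij_betw (\<lambda>c. (\<omega> c, \<pi> c)) (gens C) (UNIV \<times> gens K)"
    and coeff: "\<And>c c'. c \<in> gens C \<Longrightarrow> c' \<in> gens C \<Longrightarrow>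
      coeff C c c' = a_0 (\<omega> c) (\<omega> c') * coeff K (\<pi> c) (\<pi> c')
        + c_0 (\<omega> c) (\<omega> c') * ((\<Sum>m\<in>gens K. coeff K (\<pi> c) m * h m (\<pi> c'))
          + (\<Sum>m\<in>gens K. h (\<pi> c) m * coeff K m (\<pi> c')))"
    and bideg: "\<And>c. c \<in> gens C \<Longrightarrow> bideg C c = bideg_W (\<omega> c)
      + (fst (bideg K (\<pi> c)), fst (bideg K (\<pi> c)) + snd (bideg K (\<pi> c)))"
    and h_bideg: "\<And>k k'. k \<in> gens K \<Longrightarrow> k' \<in> gens K \<Longrightarrow> h k k' \<noteq> 0 \<Longrightarrow>
      bideg K k' = bideg K k + (0, 2)"
begin

definition homotopy :: "('k \<Rightarrow> bit) \<Rightarrow> 'k \<Rightarrow> bit" where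
  "homotopy x k = (if k \<in> gens K then \<Sum>g\<in>gens K. x g * h g k else 0)"

text \<open>The coordinates of \<open>id + c_0 h\<close> applied to \<alpha> times \<open>x\<close>
  plus \<beta> times \<open>y\<close>: as \<open>c_0\<close> sends \<alpha> to \<beta>, the term
  \<open>h x\<close> appears beside \<open>y\<close>.\<close>

definition coord :: "('k \<Rightarrow> bit) \<Rightarrow> ('k \<Rightarrow> bit) \<Rightarrow> basis_W \<Rightarrow> 'k \<Rightarrow> bit" where
  "coord x y w k = (case w of Alpha \<Rightarrow> x k | Beta \<Rightarrow> y k + homotopy x k)"

definition untwist :: "('k \<Rightarrow> bit) \<Rightarrow> ('k \<Rightarrow> bit) \<Rightarrow> 'c \<Rightarrow> bit" where
  "untwist x y c = (if c \<in> gens C then coord x y (\<omega> c) (\<pi> c) else 0)"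

text \<open>This undoes the regrading of \<open>(h, q)\<close> to \<open>(h, h + q)\<close>; the 2
  compensates the quantum degree -2 of \<beta>, to which copy 1 belongs.\<close>

definition shift :: "nat \<Rightarrow> int \<times> int \<Rightarrow> int \<times> int" where
  "shift b d = (fst d, snd d - fst d + (if b = 0 then 0 else 2))"

lemma gen_exists: "k \<in> gens K \<Longrightarrow> \<exists>c\<in>gens C. \<omega> c = w \<and> \<pi> c = k"
proof -
  assume "k \<in> gens K"
  then have "(w, k) \<in> (\<lambda>c. (\<omega> c, \<pi> c)) ` gens C" using bij by (auto simp: bij_betw_def)
  then show ?thesis by auto
qed

lemma \<pi>_gen: "c \<in> gens C \<Longrightarrow> \<pi> c \<in> gens K"
  using bij_betw_apply[OF bij] by fastforce

lemma gen_unique: "c \<in> gens C \<Longrightarrow> c' \<in> gens C \<Longrightarrow> \<omega> c = \<omega> c' \<Longrightarrow> \<pi> c = \<pi> c' \<Longrightarrow> c = c'"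
  using bij by (auto simp: bij_betw_def inj_on_def)

lemma sum_gens: "(\<Sum>c\<in>gens C. f (\<omega> c) (\<pi> c)) = (\<Sum>k\<in>gens K. f Alpha k) + (\<Sum>k\<in>gens K. f Beta k)"
  for f :: "basis_W \<Rightarrow> 'k \<Rightarrow> bit"
proof -
  have U: "(UNIV :: basis_W set) = {Alpha, Beta}" using basis_W.exhaust by auto
  have "(\<Sum>c\<in>gens C. f (\<omega> c) (\<pi> c)) = (\<Sum>(w, k)\<in>UNIV \<times> gens K. f w k)"
    using sum.reindex_bij_betw[OF bij, of "\<lambda>(w, k). f w k"] by simp
  then show ?thesis by (simp add: sum.cartesian_product[symmetric] U)
qed

lemma homotopy_add: "homotopy (\<lambda>g. x g + y g) k = homotopy x k + homotopy y k"
  by (simp add: homotopy_def distrib_right sum.distrib)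

lemma homotopy_scale: "homotopy (\<lambda>g. a * x g) k = a * homotopy x k"
  by (simp add: homotopy_def sum_distrib_left mult.assoc)

text \<open>At \<beta> the twist contributes \<open>h D x + D h x\<close>, and \<open>D\<close>
  applied to the coordinate \<open>y + h x\<close> contributes \<open>D y + D h x\<close>. Modulo 2
  the terms \<open>D h x\<close> cancel, leaving the \<beta> coordinate of the right-hand
  side.\<close>

lemma differential_untwist:
  assumes "x \<in> cochains K" "y \<in> cochains K"
  shows "differential C (untwist x y) = untwist (differential K x) (differential K y)"
proof
  fix c'
  show "differential C (untwist x y) c' = untwist (differential K x) (differential K y) c'"
  proof (cases "c' \<in> gens C")
    case True
    let ?D = "coeff K" and ?k' = "\<pi> c'"
    define F where "F k = (\<Sum>m\<in>gens K. ?D k m * h m ?k') + (\<Sum>m\<in>gens K. h k m * ?D m ?k')" for k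
    have k': "?k' \<in> gens K" using True by (rule \<pi>_gen)
    have "differential C (untwist x y) c' = (\<Sum>c\<in>gens C. coord x y (\<omega> c) (\<pi> c) *
        (a_0 (\<omega> c) (\<omega> c') * ?D (\<pi> c) ?k' + c_0 (\<omega> c) (\<omega> c') * F (\<pi> c)))"
      unfolding differential_def using True by (simp add: untwist_def coeff F_def)
    also have "\<dots> = (\<Sum>k\<in>gens K. x k * (a_0 Alpha (\<omega> c') * ?D k ?k' + c_0 Alpha (\<omega> c') * F k))
        + (\<Sum>k\<in>gens K. (y k + homotopy x k) * (a_0 Beta (\<omega> c') * ?D k ?k' + c_0 Beta (\<omega> c') * F k))"
      by (subst sum_gens[of "\<lambda>w k. coord x y w k * (a_0 w (\<omega> c') * ?D k ?k' + c_0 w (\<omega> c') * F k)"])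
        (simp add: coord_def)
    also have "\<dots> = coord (differential K x) (differential K y) (\<omega> c') ?k'"
    proof (cases "\<omega> c'")
      case Alpha
      then show ?thesis using k' by (simp add: a_0_def c_0_def coord_def differential_def)
    next
      case Beta
      have "(\<Sum>k\<in>gens K. x k * F k) = (\<Sum>k\<in>gens K. \<Sum>m\<in>gens K. x k * ?D k m * h m ?k')
          + (\<Sum>k\<in>gens K. \<Sum>m\<in>gens K. x k * h k m * ?D m ?k')"
        by (simp add: F_def distrib_left sum_distrib_left sum.distrib mult.assoc)
      \<comment> \<open>The second index of a matrix is the output, so this double sum is
        \<open>h\<close> applied after \<open>D\<close>, and the next one is \<open>D\<close> after
        \<open>h\<close>.\<close>
      also have "(\<Sum>k\<in>gens K. \<Sum>m\<in>gens K. x k * ?D k m * h m ?k') = homotopy (differential K x) ?k'"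
        by (subst sum.swap) (simp add: homotopy_def differential_def k' sum_distrib_right)
      also have "(\<Sum>k\<in>gens K. \<Sum>m\<in>gens K. x k * h k m * ?D m ?k')
          = (\<Sum>k\<in>gens K. homotopy x k * ?D k ?k')"
        by (subst sum.swap) (simp add: homotopy_def sum_distrib_right)
      finally have F: "(\<Sum>k\<in>gens K. x k * F k) = homotopy (differential K x) ?k'
          + (\<Sum>k\<in>gens K. homotopy x k * ?D k ?k')" .
      have dy: "differential K y ?k' = (\<Sum>k\<in>gens K. y k * ?D k ?k')"
        using k' by (simp add: differential_def)
      show ?thesis
        using Beta by (simp add: a_0_def c_0_def coord_def F dy distrib_right sum.distrib)
    qed
    finally show ?thesis using True by (simp add: untwist_def)
  qed (simp add: differential_def untwist_def)
qed

lemma untwist_values: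
  assumes "k \<in> gens K"
  obtains c c' where "c \<in> gens C" "\<omega> c = Alpha" "\<pi> c = k" "\<And>x y. untwist x y c = x k"
    and "c' \<in> gens C" "\<omega> c' = Beta" "\<pi> c' = k" "\<And>x y. untwist x y c' = y k + homotopy x k"
  using gen_exists[OF assms, of Alpha] gen_exists[OF assms, of Beta]
  by (auto simp: untwist_def coord_def)

lemma untwist_inj:
  assumes x: "x \<in> cochains K" "x' \<in> cochains K" and y: "y \<in> cochains K" "y' \<in> cochains K"
    and eq: "untwist x y = untwist x' y'"
  shows "x = x' \<and> y = y'"
proof -
  have *: "x k = x' k \<and> y k + homotopy x k = y' k + homotopy x' k" if k: "k \<in> gens K" for k
    using untwist_values[OF k] eq by metis
  have x_eq: "x = x'"
  proof
    fix k show "x k = x' k" using * x by (cases "k \<in> gens K") (auto simp: cochains_outside)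
  qed
  have "y = y'"
  proof
    fix k show "y k = y' k" using * y x_eq by (cases "k \<in> gens K") (auto simp: cochains_outside)
  qed
  with x_eq show ?thesis by blast
qed

lemma untwist_surj:
  assumes z: "z \<in> cochains C"
  shows "\<exists>x\<in>cochains K. \<exists>y\<in>cochains K. z = untwist x y"
proof -
  define s where "s w k = (SOME c. c \<in> gens C \<and> \<omega> c = w \<and> \<pi> c = k)" for w k
  have s: "s w k \<in> gens C \<and> \<omega> (s w k) = w \<and> \<pi> (s w k) = k" if "k \<in> gens K" for w k
    unfolding s_def by (rule someI_ex) (use gen_exists[OF that] in blast)
  define x where "x k = (if k \<in> gens K then z (s Alpha k) else 0)" for k
  \<comment> \<open>The map \<open>id + c_0 h\<close> is its own inverse, so adding
    \<open>h x\<close> once more recovers \<open>y\<close>.\<close>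
  define y where "y k = (if k \<in> gens K then z (s Beta k) + homotopy x k else 0)" for k
  have "z = untwist x y"
  proof
    fix c show "z c = untwist x y c"
    proof (cases "c \<in> gens C")
      case True
      have "s (\<omega> c) (\<pi> c) = c"
        using gen_unique[OF _ True] s[OF \<pi>_gen[OF True]] by blast
      then show ?thesis
        using True \<pi>_gen[OF True]
        by (cases "\<omega> c") (simp_all add: untwist_def coord_def x_def y_def add.assoc bit_add_self)
    qed (use z in \<open>simp add: untwist_def cochains_outside\<close>)
  qed
  moreover have "x \<in> cochains K" "y \<in> cochains K" by (simp_all add: x_def y_def cochains_def)
  ultimately show ?thesis by blast
qed

text \<open>The homotopy raises the quantum degree by 2, which is the difference between the degrees
  of the two copies of \<open>K\<close>.\<close>

lemma homotopy_homogeneous: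
  assumes "x \<in> homogeneous K (shift 0 d)" and "homotopy x k \<noteq> 0"
  shows "k \<in> gens K \<and> bideg K k = shift 1 d"
proof -
  have k: "k \<in> gens K" using assms(2) by (auto simp: homotopy_def split: if_splits)
  then have "(\<Sum>g\<in>gens K. x g * h g k) \<noteq> 0" using assms(2) by (simp add: homotopy_def)
  then obtain g where g: "g \<in> gens K" "x g * h g k \<noteq> 0" by (meson sum.neutral)
  then have "bideg K k = bideg K g + (0, 2)" using h_bideg[OF g(1) k] by auto
  moreover have "bideg K g = shift 0 d" using g assms(1) by (auto simp: homogeneous_def)
  ultimately show ?thesis using k by (simp add: shift_def)
qed

lemma untwist_homogeneous:
  assumes x: "x \<in> cochains K" and y: "y \<in> cochains K"
  shows "untwist x y \<in> homogeneous C d \<longleftrightarrow> x \<in> homogeneous K (shift 0 d) \<and> y \<in> homogeneous K (shift 1 d)"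
proof
  assume A: "untwist x y \<in> homogeneous C d"
  have x': "x \<in> homogeneous K (shift 0 d)"
  proof -
    have "bideg K k = shift 0 d" if "x k \<noteq> 0" for k
    proof -
      have k: "k \<in> gens K" using x that by (auto simp: cochains_def)
      then obtain c where c: "c \<in> gens C" "\<omega> c = Alpha" "\<pi> c = k" "untwist x y c = x k"
        using untwist_values by metis
      then have "bideg C c = d" using A that by (auto simp: homogeneous_def)
      then show ?thesis using bideg[OF c(1)] c by (auto simp: shift_def prod_eq_iff)
    qed
    then show ?thesis using x by (auto simp: homogeneous_def)
  qed
  have "bideg K k = shift 1 d" if "y k \<noteq> 0" for k
  \<comment> \<open>Only the sum \<open>y k + homotopy x k\<close> is visible at \<beta>, and it
    could cancel. If the second term is nonzero, it already determines the degree of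
    \<open>k\<close>.\<close>
  proof (cases "homotopy x k = 0")
    case True
    have k: "k \<in> gens K" using y that by (auto simp: cochains_def)
    then obtain c where c: "c \<in> gens C" "\<omega> c = Beta" "\<pi> c = k" "untwist x y c = y k + homotopy x k"
      using untwist_values by metis
    then have "bideg C c = d" using A that True by (auto simp: homogeneous_def)
    then show ?thesis using bideg[OF c(1)] c by (auto simp: shift_def prod_eq_iff)
  qed (use homotopy_homogeneous[OF x'] in blast)
  then have "y \<in> homogeneous K (shift 1 d)" using y by (auto simp: homogeneous_def)
  with x' show "x \<in> homogeneous K (shift 0 d) \<and> y \<in> homogeneous K (shift 1 d)" ..
next
  assume A: "x \<in> homogeneous K (shift 0 d) \<and> y \<in> homogeneous K (shift 1 d)"
  have "bideg C c = d" if c: "c \<in> gens C" "untwist x y c \<noteq> 0" for c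
  proof (cases "\<omega> c")
    case Alpha
    then have "bideg K (\<pi> c) = shift 0 d"
      using A c by (auto simp: untwist_def coord_def homogeneous_def)
    then show ?thesis using bideg[OF c(1)] Alpha by (simp add: shift_def prod_eq_iff)
  next
    case Beta
    then have "y (\<pi> c) \<noteq> 0 \<or> homotopy x (\<pi> c) \<noteq> 0"
      using c by (auto simp: untwist_def coord_def)
    then have "bideg K (\<pi> c) = shift 1 d"
      using A homotopy_homogeneous[of x d "\<pi> c"] by (auto simp: homogeneous_def)
    then show ?thesis using bideg[OF c(1)] Beta by (simp add: shift_def prod_eq_iff)
  qed
  then show "untwist x y \<in> homogeneous C d"
    by (auto simp: homogeneous_def cochains_def untwist_def)
qed

sublocale double_complex K C untwist shift
proof
  show "untwist (\<lambda>g. x g + x' g) (\<lambda>g. y g + y' g) = (\<lambda>c. untwist x y c + untwist x' y' c)"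
    for x y x' y'
    by (auto simp: untwist_def coord_def homotopy_add fun_eq_iff ac_simps split: basis_W.split)
  show "untwist (\<lambda>g. a * x g) (\<lambda>g. a * y g) = (\<lambda>c. a * untwist x y c)" for x y a
    by (auto simp: untwist_def coord_def homotopy_scale fun_eq_iff distrib_left split: basis_W.split)
  show "untwist x y \<in> cochains C" for x y by (simp add: untwist_def cochains_def)
qed (use untwist_inj untwist_surj differential_untwist untwist_homogeneous in blast)+

lemma regrade_shift:
  fixes deg :: "nat \<Rightarrow> int \<times> int"
  assumes "deg 0 = (0, 0)" "deg 1 = (0, -2)" "b < 2"
  shows "regrade M (d - deg b) = M (shift b d)"
proof -
  have "b = 0 \<or> b = 1" using assms(3) by auto
  then show ?thesis using assms(1,2) by (cases d) (auto simp: regrade_def shift_def algebra_simps)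
qed

lemma cohomology_untwisted:
  fixes deg :: "nat \<Rightarrow> int \<times> int"
  assumes "deg 0 = (0, 0)" "deg 1 = (0, -2)"
  shows "bigraded_isomorphic (tensor {0, 1} deg (regrade (cohomology K))) (cohomology C)"
  unfolding bigraded_isomorphic_def
  by (intro allI tensor_cohomology regrade_shift) (use assms in auto)

end


section \<open>The maps assigned to saddles\<close>

lemma id_on_update: "d \<notin> Q \<Longrightarrow> id_on Q (l(d := a)) l' = id_on Q l l'" "d \<notin> Q \<Longrightarrow> id_on Q l (l'(d := a)) = id_on Q l l'"
  by (auto simp: id_on_def of_bool_def intro: ball_cong)

lemma id_on_insert: "id_on (insert d Q) l l' = of_bool (l d = l' d) * id_on Q l l'"
  by (simp add: id_on_def)

lemma id_on_Un: "id_on (P \<union> Q) l l' = id_on P l l' * id_on Q l l'"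
  by (auto simp: id_on_def)

text \<open>Replacing x by e on one circle after the identity or before it gives the same matrix,
  which is one summand of \<open>sigma_on Q\<close>.\<close>

lemma id_on_change:
  assumes "d \<in> Q"
  shows "of_bool (l' d = Ae) * id_on Q l (l'(d := Ax)) = of_bool (l d = Ax \<and> l' d = Ae) * id_on (Q - {d}) l l'"
    and "of_bool (l d = Ax) * id_on Q (l(d := Ae)) l' = of_bool (l d = Ax \<and> l' d = Ae) * id_on (Q - {d}) l l'"
proof -
  have Q: "Q = insert d (Q - {d})" using assms by blast
  show "of_bool (l' d = Ae) * id_on Q l (l'(d := Ax)) = of_bool (l d = Ax \<and> l' d = Ae) * id_on (Q - {d}) l l'"
    by (subst Q, subst id_on_insert) (auto simp: id_on_update)
  show "of_bool (l d = Ax) * id_on Q (l(d := Ae)) l' = of_bool (l d = Ax \<and> l' d = Ae) * id_on (Q - {d}) l l'"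
    by (subst Q, subst id_on_insert) (auto simp: id_on_update)
qed

lemma sigma_on_empty: "sigma_on {} l l' = 0"
  by (simp add: sigma_on_def)

text \<open>Elements in both sets are counted twice and cancel modulo 2. These will be the circles
  that stay on the right during a saddle.\<close>

lemma sum_symmetric_difference:
  fixes g :: "'a \<Rightarrow> bit"
  assumes "finite Q"
  shows "sum g (R' \<inter> Q) + sum g (R \<inter> Q) = sum g {d \<in> Q. (d \<in> R) \<noteq> (d \<in> R')}"
proof -
  have filter: "sum g {d \<in> Q. P d} = (\<Sum>d\<in>Q. if P d then g d else 0)" for P
    by (rule sum.inter_filter[OF assms])
  have "R' \<inter> Q = {d \<in> Q. d \<in> R'}" "R \<inter> Q = {d \<in> Q. d \<in> R}" by auto
  then have "sum g (R' \<inter> Q) + sum g (R \<inter> Q)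
      = (\<Sum>d\<in>Q. (if d \<in> R' then g d else 0) + (if d \<in> R then g d else 0))"
    by (simp add: filter sum.distrib)
  also have "\<dots> = (\<Sum>d\<in>Q. if (d \<in> R) \<noteq> (d \<in> R') then g d else 0)"
    by (intro sum.cong) (auto simp: bit_add_self)
  finally show ?thesis by (simp add: filter)
qed

text \<open>\<open>homotopy_boundary R R' M\<close> is the commutator of the saddle \<open>M\<close> with the sum of the maps
  \<open>x \<mapsto> e\<close> over the circles in \<open>R\<close> before and in \<open>R'\<close> after the saddle.\<close>

definition homotopy_boundary ::
  "point set set \<Rightarrow> point set set \<Rightarrow> (labelling \<Rightarrow> labelling \<Rightarrow> bit) \<Rightarrow> labelling \<Rightarrow> labelling \<Rightarrow> bit" where
  "homotopy_boundary R R' M l l' =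
     (\<Sum>d\<in>R'. of_bool (l' d = Ae) * M l (l'(d := Ax))) + (\<Sum>d\<in>R. of_bool (l d = Ax) * M (l(d := Ae)) l')"

text \<open>The map is \<open>B\<close> tensored with the identity on \<open>Q\<close>. Circles
  outside \<open>Q\<close> give the commutator with \<open>B\<close>; a circle of \<open>Q\<close>
  that keeps its side contributes twice or not at all, and those that change sides, the set
  \<open>E\<close>, give the map \<open>sigma_on E\<close>.\<close>

lemma homotopy_boundary_local:
  assumes fin: "finite Q" "finite R" "finite R'"
    and M: "\<And>l l'. M l l' = B l l' * id_on Q l l'"
    and B: "\<forall>d\<in>Q. \<forall>l l' a. B l (l'(d := a)) = B l l' \<and> B (l(d := a)) l' = B l l'"
    and E: "E = {d \<in> Q. (d \<in> R) \<noteq> (d \<in> R')}"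
  shows "homotopy_boundary R R' M l l' =
    homotopy_boundary (R - Q) (R' - Q) B l l' * id_on Q l l' + B l l' * id_on (Q - E) l l' * sigma_on E l l'"
proof -
  let ?g = "\<lambda>d. of_bool (l d = Ax \<and> l' d = Ae) * id_on (Q - {d}) l l'"
  have split: "sum f X = sum f (X - Q) + sum f (X \<inter> Q)" if "finite X" for X and f :: "point set \<Rightarrow> bit"
    using sum.Int_Diff[OF that, of f Q] by (simp add: add.commute)
  have inner': "(\<Sum>d\<in>R' \<inter> Q. of_bool (l' d = Ae) * M l (l'(d := Ax))) = B l l' * sum ?g (R' \<inter> Q)"
    unfolding sum_distrib_left
    by (intro sum.cong refl) (use B id_on_change(1)[of _ Q l' l] in \<open>auto simp: M mult.left_commute\<close>)
  have inner: "(\<Sum>d\<in>R \<inter> Q. of_bool (l d = Ax) * M (l(d := Ae)) l') = B l l' * sum ?g (R \<inter> Q)"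
    unfolding sum_distrib_left
    by (intro sum.cong refl) (use B id_on_change(2)[of _ Q l l'] in \<open>auto simp: M mult.left_commute\<close>)
  have outer': "(\<Sum>d\<in>R' - Q. of_bool (l' d = Ae) * M l (l'(d := Ax)))
      = (\<Sum>d\<in>R' - Q. of_bool (l' d = Ae) * B l (l'(d := Ax))) * id_on Q l l'"
    unfolding sum_distrib_right by (intro sum.cong refl) (simp add: M id_on_update mult.assoc)
  have outer: "(\<Sum>d\<in>R - Q. of_bool (l d = Ax) * M (l(d := Ae)) l')
      = (\<Sum>d\<in>R - Q. of_bool (l d = Ax) * B (l(d := Ae)) l') * id_on Q l l'"
    unfolding sum_distrib_right by (intro sum.cong refl) (simp add: M id_on_update mult.assoc)
  have "sum ?g (R' \<inter> Q) + sum ?g (R \<inter> Q) = sum ?g E"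
    unfolding E by (rule sum_symmetric_difference[OF fin(1)])
  also have "\<dots> = id_on (Q - E) l l' * sigma_on E l l'"
    unfolding sigma_on_def sum_distrib_left
  proof (intro sum.cong refl)
    fix d assume d: "d \<in> E"
    then have "Q - {d} = (Q - E) \<union> (E - {d})" by (auto simp: E)
    then show "?g d = id_on (Q - E) l l' * (of_bool (l d = Ax \<and> l' d = Ae) * id_on (E - {d}) l l')"
      by (simp add: id_on_Un mult.left_commute)
  qed
  finally have "B l l' * sum ?g (R' \<inter> Q) + B l l' * sum ?g (R \<inter> Q) = B l l' * id_on (Q - E) l l' * sigma_on E l l'"
    by (simp flip: distrib_left add: mult.assoc)
  then show ?thesis
    unfolding homotopy_boundary_def split[OF fin(2)] split[OF fin(3)] inner inner' outer outer'
    by (simp only: distrib_right distrib_left ac_simps)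
qed

text \<open>The coefficient of \<open>a\<^sub>0\<close> in the map of a saddle; with the arc component labelled by \<open>x\<close> this is the
  map of Khovanov homology.\<close>

definition reduced_map :: "piece list \<Rightarrow> piece list \<Rightarrow> nat \<Rightarrow> labelling \<Rightarrow> labelling \<Rightarrow> bit" where
  "reduced_map S S' t l l' =
    (let k = position (S ! t);
         u = component 1 S (t, k); v = component 1 S (t + 1, k + 1);
         u' = component 1 S' (t, k); v' = component 1 S' (t + 1, k + 1);
         Q = circles S - {u, v}
     in
       if u = v \<and> u' \<noteq> v' then
         (if u \<noteq> arc_component S then comult_A (l u) (l' u') (l' v')
          else eta_dot (l' (if u' = arc_component S' then v' else u'))) * id_on Q l l'
       else if u \<noteq> v \<and> u' = v' then
         (if u' \<noteq> arc_component S' then mult_A (l u) (l v) (l' u')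
          else eps_dot (l (if u = arc_component S then v else u))) * id_on Q l l'
       else 0)"

lemma finite_right_circles: "finite (right_circles S)"
  by (rule finite_subset[OF _ finite_circles]) (auto simp: right_circles_def)

lemma right_circles_subset: "right_circles S \<subseteq> circles S"
  by (auto simp: right_circles_def)

lemma arc_not_right: "arc_component S \<notin> right_circles S"
  by (simp add: right_circles_def circles_def)

lemma homotopy_boundary_empty: "homotopy_boundary {} {} M l l' = 0"
  by (simp add: homotopy_boundary_def)

section \<open>Commutators for the four kinds of saddle\<close>

context surgery
begin

interpretation rev: surgery S' S t k by (rule reverse)

lemma position: "position (S ! t) = k"
  using band by auto

abbreviation "Q \<equiv> circles S - {u, v}"

lemma finite_Q: "finite Q"
  by (simp add: finite_circles)

lemma not_in_Q: "u \<notin> Q" "v \<notin> Q" "u' \<notin> Q" "v' \<notin> Q" "arc_component S \<notin> Q" "arc_component S' \<notin> Q"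
proof -
  show "u \<notin> Q" "v \<notin> Q" "arc_component S \<notin> Q" by (simp_all add: circles_def)
  show "u' \<notin> Q" "v' \<notin> Q" "arc_component S' \<notin> Q"
    unfolding circles_untouched by (simp_all add: circles_def)
qed

lemma right_circles_minus_Q:
  "right_circles S - Q = right_circles S \<inter> {u, v}" "right_circles S' - Q = right_circles S' \<inter> {u', v'}"
proof -
  have *: "X - (Y - Z) = X \<inter> Z" if "X \<subseteq> Y" for X Y Z :: "point set set" using that by blast
  show "right_circles S - Q = right_circles S \<inter> {u, v}" by (rule *[OF right_circles_subset])
  show "right_circles S' - Q = right_circles S' \<inter> {u', v'}"
    unfolding circles_untouched by (rule *[OF right_circles_subset])
qed

lemma in_Q: "d \<in> Q \<Longrightarrow> u \<noteq> d \<and> v \<noteq> d \<and> u' \<noteq> d \<and> v' \<noteq> d"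
  using not_in_Q by blast

lemma boundary_arc_untouched:
  assumes arc: "arc_component S \<notin> {u, v}"
  shows "{d \<in> Q. (d \<in> right_circles S) \<noteq> (d \<in> right_circles S')} = {}"
proof -
  have "d \<in> right_circles S \<longleftrightarrow> d \<in> right_circles S'" if d: "d \<in> Q" for d
  proof -
    obtain p where "p \<in> d" using d circlesD(1) components_nonempty by blast
    then show ?thesis
      using right_circles_arc_untouched[OF arc, of d d p] d circles_untouched by blast
  qed
  then show ?thesis by blast
qed

text \<open>The circle and its two parts lie on the same side of the arc, and no other circle
  changes sides. On the left the homotopy does not act on the three circles; on the right the
  coderivation property applies.\<close>

lemma boundary_split_circle:
  assumes uv: "u = v" "u' \<noteq> v'" and arc: "u \<noteq> arc_component S"
  shows "homotopy_boundary (right_circles S) (right_circles S') (reduced_map S S' t) l l' = 0"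
proof -
  define B where "B l l' = comult_A (l u) (l' u') (l' v')" for l l'
  have arc': "arc_component S \<notin> {u, v}" using uv arc by auto
  have M: "reduced_map S S' t l l' = B l l' * id_on Q l l'" for l l'
    using uv arc by (simp add: reduced_map_def position B_def Let_def)
  have BQ: "\<forall>d\<in>Q. \<forall>l l' a. B l (l'(d := a)) = B l l' \<and> B (l(d := a)) l' = B l l'"
  proof (intro ballI allI)
    fix d l l' a assume "d \<in> Q"
    note ne = in_Q[OF this]
    show "B l (l'(d := a)) = B l l' \<and> B (l(d := a)) l' = B l l'"
      unfolding B_def fun_upd_apply using ne by (simp only: if_False simp_thms)
  qed
  have u'v': "u' \<in> circles S'" "v' \<in> circles S'"
    using rev.uv_components arc_untouched[OF arc'] arc_touched_rev arc' by (auto simp: circles_def)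
  have u: "u \<in> circles S" using uv_components arc by (auto simp: circles_def)
  have R: "right_circles S - Q = (if u \<in> right_circles S then {u} else {})"
    unfolding right_circles_minus_Q using uv by auto
  have R': "right_circles S' - Q = (if u \<in> right_circles S then {u', v'} else {})"
  proof -
    have "u \<in> right_circles S \<longleftrightarrow> u' \<in> right_circles S'"
      by (rule right_circles_arc_untouched[OF arc' u u'v'(1), of "(t, k)"]) auto
    moreover have "u \<in> right_circles S \<longleftrightarrow> v' \<in> right_circles S'"
      by (rule right_circles_arc_untouched[OF arc' u u'v'(2), of "(t + 1, k + 1)"]) (use uv in auto)
    ultimately show ?thesis unfolding right_circles_minus_Q by auto
  qed
  \<comment> \<open>The coproduct of e goes to ee + ee = 0, and the coproduct xx of x goes to ex +
    xe, the coproduct of e.\<close>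
  have "homotopy_boundary {u} {u', v'} B l l' = 0"
    using uv by (cases "l u"; cases "l' u'"; cases "l' v'")
      (simp_all add: homotopy_boundary_def B_def comult_A_def)
  then show ?thesis
    unfolding homotopy_boundary_local[OF finite_Q finite_right_circles finite_right_circles M BQ refl]
      boundary_arc_untouched[OF arc'] R R' sigma_on_empty
    by (simp add: homotopy_boundary_empty)
qed

lemma boundary_merge_circles:
  assumes uv: "u \<noteq> v" "u' = v'" and arc: "u' \<noteq> arc_component S'"
  shows "homotopy_boundary (right_circles S) (right_circles S') (reduced_map S S' t) l l' = 0"
proof -
  define B where "B l l' = mult_A (l u) (l v) (l' u')" for l l'
  have "arc_component S' \<notin> {u', v'}" using arc unfolding uv(2) by blast
  then have arc': "arc_component S \<notin> {u, v}" using arc_touched_rev by blast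
  have M: "reduced_map S S' t l l' = B l l' * id_on Q l l'" for l l'
    using uv arc by (simp add: reduced_map_def position B_def Let_def)
  have BQ: "\<forall>d\<in>Q. \<forall>l l' a. B l (l'(d := a)) = B l l' \<and> B (l(d := a)) l' = B l l'"
  proof (intro ballI allI)
    fix d l l' a assume "d \<in> Q"
    note ne = in_Q[OF this]
    show "B l (l'(d := a)) = B l l' \<and> B (l(d := a)) l' = B l l'"
      unfolding B_def fun_upd_apply using ne by (simp only: if_False simp_thms)
  qed
  have uv_circles: "u \<in> circles S" "v \<in> circles S"
    using uv_components arc' by (auto simp: circles_def)
  have u': "u' \<in> circles S'" using rev.uv_components arc by (auto simp: circles_def)
  have R': "right_circles S' - Q = (if u' \<in> right_circles S' then {u'} else {})"
    unfolding right_circles_minus_Q using uv by auto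
  have R: "right_circles S - Q = (if u' \<in> right_circles S' then {u, v} else {})"
  proof -
    have "u \<in> right_circles S \<longleftrightarrow> u' \<in> right_circles S'"
      by (rule right_circles_arc_untouched[OF arc' uv_circles(1) u', of "(t, k)"]) auto
    moreover have "v \<in> right_circles S \<longleftrightarrow> u' \<in> right_circles S'"
      by (rule right_circles_arc_untouched[OF arc' uv_circles(2) u', of "(t + 1, k + 1)"]) (use uv in auto)
    ultimately show ?thesis unfolding right_circles_minus_Q by auto
  qed
  \<comment> \<open>Both xe and ex go to ee, matching x going to e in the product; xx goes to ex +
    xe, whose product is x + x = 0.\<close>
  have "homotopy_boundary {u, v} {u'} B l l' = 0"
    using uv by (cases "l u"; cases "l v"; cases "l' u'")
      (simp_all add: homotopy_boundary_def B_def mult_A_def)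
  then show ?thesis
    unfolding homotopy_boundary_local[OF finite_Q finite_right_circles finite_right_circles M BQ refl]
      boundary_arc_untouched[OF arc'] R R' sigma_on_empty
    by (simp add: homotopy_boundary_empty)
qed

text \<open>The new circle \<open>c\<close> carries x. If it lies to the right of the new arc, the
  homotopy turns this label into e, which is the summand with \<open>eta\<close>. The circles
  enclosed by \<open>c\<close> are those that change sides when the arc loses
  \<open>c\<close>.\<close>

lemma boundary_split_arc:
  assumes uv: "u = v" "u' \<noteq> v'" and arc: "u = arc_component S"
    and c: "c = (if u' = arc_component S' then v' else u')"
    and E: "E = {d \<in> Q. enclosed_by S' c d}"
  shows "homotopy_boundary (right_circles S) (right_circles S') (reduced_map S S' t) l l' =
    of_bool (band_on_right S' t) * eta (l' c) * id_on Q l l' + eta_dot (l' c) * id_on (Q - E) l l' * sigma_on E l l'"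
proof -
  define B :: "labelling \<Rightarrow> labelling \<Rightarrow> bit" where "B l l' = eta_dot (l' c)" for l l'
  have M: "reduced_map S S' t l l' = B l l' * id_on Q l l'" for l l'
    unfolding reduced_map_def position Let_def B_def c if_P[OF conjI[OF uv]]
    by (simp only: arc not_True_eq_False simp_thms if_False)
  have cQ: "c \<notin> Q" unfolding c using not_in_Q by (simp only: split: if_split) blast
  have BQ: "\<forall>d\<in>Q. \<forall>l l' a. B l (l'(d := a)) = B l l' \<and> B (l(d := a)) l' = B l l'"
  proof (intro ballI allI)
    fix d l l' a assume "d \<in> Q"
    then have ne: "c \<noteq> d" using cQ by blast
    show "B l (l'(d := a)) = B l l' \<and> B (l(d := a)) l' = B l l'"
      unfolding B_def fun_upd_apply using ne by (simp only: if_False simp_thms)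
  qed
  have "arc_component S' \<in> {u', v'}" using arc_touched_rev arc by blast
  then have arc': "{u', v'} = {arc_component S', c}" by (auto simp: c)
  have Q': "Q = circles S' - {u', v'}" by (rule circles_untouched)
  \<comment> \<open>The split is read backwards, as the merge of \<open>c\<close> with the arc of
    \<open>S'\<close>.\<close>
  have "enclosed_by S' c d \<longleftrightarrow> (d \<in> right_circles S) \<noteq> (d \<in> right_circles S')" if "d \<in> Q" for d
    using rev.right_circles_arc_touched[OF arc' uv(2) uv(1), of d] that unfolding Q' by argo
  then have "E = {d \<in> Q. (d \<in> right_circles S) \<noteq> (d \<in> right_circles S')}"
    unfolding E by (intro Collect_cong conj_cong refl)
  note * = homotopy_boundary_local[OF finite_Q finite_right_circles finite_right_circles M BQ this]
  have R: "right_circles S - Q = {}"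
    unfolding right_circles_minus_Q using uv(1) arc arc_not_right by simp
  have right: "band_on_right S' t \<longleftrightarrow> c \<in> right_circles S'" by (rule rev.band_on_right_iff[OF arc' uv(2)])
  have R': "right_circles S' - Q = (if band_on_right S' t then {c} else {})"
    unfolding right by (subst right_circles_minus_Q, subst arc') (use arc_not_right in auto)
  show ?thesis
    unfolding * R R' by (cases "l' c") (simp_all add: homotopy_boundary_def B_def eta_def eta_dot_def)
qed

text \<open>Before the merge the homotopy can turn x on \<open>c\<close> into e, the label that
  \<open>eps_dot\<close> accepts; the composite is \<open>eps\<close> and occurs only for
  \<open>c\<close> on the right.\<close>

lemma boundary_merge_arc:
  assumes uv: "u \<noteq> v" "u' = v'" and arc: "u' = arc_component S'"
    and c: "c = (if u = arc_component S then v else u)"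
    and E: "E = {d \<in> Q. enclosed_by S c d}"
  shows "homotopy_boundary (right_circles S) (right_circles S') (reduced_map S S' t) l l' =
    of_bool (band_on_right S t) * eps (l c) * id_on Q l l' + eps_dot (l c) * id_on (Q - E) l l' * sigma_on E l l'"
proof -
  define B :: "labelling \<Rightarrow> labelling \<Rightarrow> bit" where "B l l' = eps_dot (l c)" for l l'
  have M: "reduced_map S S' t l l' = B l l' * id_on Q l l'" for l l'
    unfolding reduced_map_def position Let_def B_def c if_P[OF conjI[OF uv]]
    by (simp only: uv(1) arc not_True_eq_False simp_thms if_False)
  have cQ: "c \<notin> Q" unfolding c using not_in_Q by (simp only: split: if_split) blast
  have BQ: "\<forall>d\<in>Q. \<forall>l l' a. B l (l'(d := a)) = B l l' \<and> B (l(d := a)) l' = B l l'"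
  proof (intro ballI allI)
    fix d l l' a assume "d \<in> Q"
    then have ne: "c \<noteq> d" using cQ by blast
    show "B l (l'(d := a)) = B l l' \<and> B (l(d := a)) l' = B l l'"
      unfolding B_def fun_upd_apply using ne by (simp only: if_False simp_thms)
  qed
  have "arc_component S \<in> {u, v}" using arc_touched_rev arc by blast
  then have arc': "{u, v} = {arc_component S, c}" by (auto simp: c)
  have "enclosed_by S c d \<longleftrightarrow> (d \<in> right_circles S) \<noteq> (d \<in> right_circles S')" if "d \<in> Q" for d
    using right_circles_arc_touched[OF arc' uv that] by argo
  then have "E = {d \<in> Q. (d \<in> right_circles S) \<noteq> (d \<in> right_circles S')}"
    unfolding E by (intro Collect_cong conj_cong refl)
  note * = homotopy_boundary_local[OF finite_Q finite_right_circles finite_right_circles M BQ this]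
  have R': "right_circles S' - Q = {}"
    unfolding right_circles_minus_Q using uv(2) arc arc_not_right by simp
  have right: "band_on_right S t \<longleftrightarrow> c \<in> right_circles S" by (rule band_on_right_iff[OF arc' uv(1)])
  have R: "right_circles S - Q = (if band_on_right S t then {c} else {})"
    unfolding right by (subst right_circles_minus_Q, subst arc') (use arc_not_right in auto)
  show ?thesis
    unfolding * R R' by (cases "l c") (simp_all add: homotopy_boundary_def B_def eps_def eps_dot_def)
qed

text \<open>All \<open>c_0\<close> terms, for both sides of the arc, come from one homotopy, which
  is why a single change of basis can remove them. If the band surgery is neither a split nor a
  merge, both sides are zero by convention.\<close>

lemma saddle_map_eq:
  "saddle_map S S' t (w, l) (w', l') = a_0 w w' * reduced_map S S' t l l'
    + c_0 w w' * homotopy_boundary (right_circles S) (right_circles S') (reduced_map S S' t) l l'"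
proof -
  consider "u = v" "u' \<noteq> v'" "u \<noteq> arc_component S" | "u = v" "u' \<noteq> v'" "u = arc_component S"
    | "u \<noteq> v" "u' = v'" "u' \<noteq> arc_component S'" | "u \<noteq> v" "u' = v'" "u' = arc_component S'"
    | "(u = v) = (u' = v')" by argo
  then show ?thesis
  proof cases
    case 1
    show ?thesis
      unfolding boundary_split_circle[OF 1] saddle_map_def reduced_map_def position Let_def prod.case
        if_P[OF conjI[OF 1(1,2)]] if_P[OF 1(3)]
      by (simp only: mult_zero_right add_0_right mult.assoc)
  next
    case 2
    show ?thesis
      unfolding boundary_split_arc[OF 2 refl refl] saddle_map_def reduced_map_def position Let_def prod.case
        if_P[OF conjI[OF 2(1,2)]]
      by (cases "band_on_right S' t") (simp_all only: 2(3) not_True_eq_False simp_thms if_True if_False of_bool_eq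
        mult_1_left mult_zero_left add_0_left distrib_left distrib_right ac_simps)
  next
    case 3
    show ?thesis
      unfolding boundary_merge_circles[OF 3] saddle_map_def reduced_map_def position Let_def prod.case
        if_P[OF conjI[OF 3(1,2)]] if_P[OF 3(3)]
      by (simp only: 3(1) simp_thms if_False mult_zero_right add_0_right mult.assoc)
  next
    case 4
    show ?thesis
      unfolding boundary_merge_arc[OF 4 refl refl] saddle_map_def reduced_map_def position Let_def prod.case
        if_P[OF conjI[OF 4(1,2)]]
      by (simp only: 4(1,3) not_True_eq_False simp_thms if_False)
        (cases "band_on_right S t"; simp only: if_True if_False of_bool_eq mult_1_left mult_zero_left
          add_0_left distrib_left distrib_right ac_simps)
  next
    case 5
    then have neither: "\<not> (u = v \<and> u' \<noteq> v')" "\<not> (u \<noteq> v \<and> u' = v')" by blast+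
    have "reduced_map S S' t = (\<lambda>l l'. 0)"
      unfolding reduced_map_def position Let_def if_not_P[OF neither(1)] if_not_P[OF neither(2)] ..
    moreover have "saddle_map S S' t (w, l) (w', l') = 0"
      unfolding saddle_map_def position Let_def prod.case if_not_P[OF neither(1)] if_not_P[OF neither(2)] ..
    ultimately show ?thesis by (simp add: homotopy_boundary_def)
  qed
qed

end


section \<open>Closures\<close>

definition lift :: "point \<Rightarrow> point" where
  "lift p = (Suc (fst p), Suc (snd p))"

text \<open>The closing cup is the first piece and the closing cap the last, so the closing strand
  meets the levels 1 to \<open>Suc (length S)\<close>, at position 0. It is added to the component
  of \<open>(0, 0)\<close>, the arc.\<close>

definition closed_component :: "piece list \<Rightarrow> point set \<Rightarrow> point set" where
  "closed_component S c = lift ` c \<union> (if (0, 0) \<in> c then {(t, 0) | t. 1 \<le> t \<and> t \<le> Suc (length S)} else {})"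

lemma lift_in_closed_component [simp]: "lift p \<in> closed_component S c \<longleftrightarrow> p \<in> c"
  by (cases p) (force simp: closed_component_def lift_def image_iff)

lemma strand_in_closed_component:
  "(t, 0) \<in> closed_component S c \<longleftrightarrow> (0, 0) \<in> c \<and> 1 \<le> t \<and> t \<le> Suc (length S)"
  by (auto simp: closed_component_def lift_def)

lemma vimage_closed_component: "lift -` closed_component S c = c"
  by (intro set_eqI) (simp only: vimage_eq lift_in_closed_component)

lemma closed_component_eq_iff: "closed_component S c = closed_component S d \<longleftrightarrow> c = d"
  using vimage_closed_component by metis

lemma length_tangle_closure: "length (tangle_closure S) = Suc (Suc (length S))"
  by (simp add: tangle_closure_def)

lemma nth_tangle_closure:
  "tangle_closure S ! 0 = Cup 0" "tangle_closure S ! Suc (length S) = Cap 0"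
  "t < length S \<Longrightarrow> tangle_closure S ! Suc t = shift_piece (S ! t)"
  by (simp_all add: tangle_closure_def nth_append)

lemma strands_above_shift:
  "fits n p \<Longrightarrow> strands_above (Suc n) (shift_piece p) = Suc (strands_above n p)"
  by (cases p) auto

lemma width_tangle_closure:
  assumes "diagram 1 S m" and "s \<le> length S"
  shows "width 0 (tangle_closure S) (Suc s) = Suc (width 1 S s)"
  using assms(2)
proof (induction s)
  case 0
  then show ?case by (simp add: width_Suc length_tangle_closure nth_tangle_closure)
next
  case (Suc s)
  then have "width 0 (tangle_closure S) (Suc (Suc s)) = strands_above (Suc (width 1 S s)) (shift_piece (S ! s))"
    by (simp add: width_Suc[of "Suc s"] length_tangle_closure nth_tangle_closure)
  then show ?case using Suc diagram_fits[OF assms(1), of s] by (simp add: strands_above_shift width_Suc)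
qed

lemma passes_shift:
  assumes "planar_piece p"
  shows "passes (shift_piece p) (Suc i) (Suc j) \<longleftrightarrow> passes p i j" "passes (shift_piece p) 0 0"
    "passes (shift_piece p) 0 j \<longleftrightarrow> j = 0" "passes (shift_piece p) i 0 \<longleftrightarrow> i = 0"
  using assms by (cases p; auto)+

lemma shift_piece_eq:
  "shift_piece p = Cap k \<longleftrightarrow> (\<exists>k'. k = Suc k' \<and> p = Cap k')"
  "shift_piece p = Cup k \<longleftrightarrow> (\<exists>k'. k = Suc k' \<and> p = Cup k')"
  "shift_piece p = Horiz k \<longleftrightarrow> (\<exists>k'. k = Suc k' \<and> p = Horiz k')"
  by (cases p; auto)+

locale planar_tangle =
  fixes S :: "piece list"
  assumes S: "planar_diagram 1 S 1"
begin

abbreviation "L \<equiv> tangle_closure S"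

lemma diagram: "diagram 1 S 1"
  using S by (simp add: planar_diagram_def)

lemma width_top: "width 0 L (Suc (Suc (length S))) = 0"
proof -
  have "width 1 S (length S) = 1" using width_length[OF diagram] .
  then have "width 0 L (Suc (length S)) = 2" using width_tangle_closure[OF diagram, of "length S"] by simp
  then show ?thesis
    by (simp add: width_Suc[of "Suc (length S)"] length_tangle_closure nth_tangle_closure)
qed

lemma points_lift: "lift p \<in> points 0 L \<longleftrightarrow> p \<in> points 1 S"
proof (cases p)
  case (Pair t i)
  have "t = Suc (length S) \<or> t \<le> length S" if "t \<le> Suc (length S)" using that by auto
  then show ?thesis
    using Pair width_tangle_closure[OF diagram, of t] width_top
    by (auto simp: lift_def points_def length_tangle_closure)
qed

lemma points_strand: "(t, 0) \<in> points 0 L \<longleftrightarrow> 1 \<le> t \<and> t \<le> Suc (length S)"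
proof (cases t)
  case (Suc s)
  have "s = Suc (length S) \<or> s \<le> length S" if "s \<le> Suc (length S)" using that by auto
  then show ?thesis
    using Suc width_tangle_closure[OF diagram, of s] width_top
    by (auto simp: points_def length_tangle_closure)
qed (simp add: points_def)

lemma points_cases:
  assumes "p \<in> points 0 L"
  obtains (lift) q where "p = lift q" "q \<in> points 1 S"
    | (strand) t where "p = (t, 0)" "1 \<le> t" "t \<le> Suc (length S)"
proof (cases p)
  case (Pair t i)
  show ?thesis
  proof (cases i)
    case 0
    then show ?thesis using assms Pair points_strand strand by blast
  next
    case (Suc j)
    have "t \<noteq> 0" using assms Pair by (cases t) (auto simp: points_def)
    then have "p = lift (t - 1, j)" using Pair Suc by (simp add: lift_def)
    then show ?thesis using assms points_lift lift by blast
  qed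
qed

lemma nth_shift: "t < length S \<Longrightarrow> L ! Suc t = shift_piece (S ! t)"
  by (rule nth_tangle_closure)

lemma edges_lift: "(p, q) \<in> edges 1 S \<Longrightarrow> (lift p, lift q) \<in> edges 0 L"
proof -
  assume "(p, q) \<in> edges 1 S"
  then show ?thesis
  proof (cases rule: edge_cases)
    case (run t i j)
    then show ?thesis
      using run_edge[of "Suc t" L "Suc i" "Suc j" 0] passes_shift(1)[OF planar_nth[OF S]]
        width_tangle_closure[OF diagram, of t] width_tangle_closure[OF diagram, of "Suc t"]
      by (simp add: lift_def length_tangle_closure nth_shift)
  next
    case (below t k)
    then show ?thesis
      using turn_edge_below[of "Suc t" L "Suc k" 0] width_tangle_closure[OF diagram, of t]
      by (simp add: lift_def length_tangle_closure nth_shift shift_piece_eq)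
  next
    case (above t k)
    then show ?thesis
      using turn_edge_above[of "Suc t" L "Suc k" 0] width_tangle_closure[OF diagram, of "Suc t"]
      by (simp add: lift_def length_tangle_closure nth_shift shift_piece_eq)
  qed
qed

lemma strand_edges:
  "t < length S \<Longrightarrow> ((Suc t, 0), (Suc (Suc t), 0)) \<in> edges 0 L"
  "((1, 0), lift (0, 0)) \<in> edges 0 L"
proof -
  show "((Suc t, 0), (Suc (Suc t), 0)) \<in> edges 0 L" if t: "t < length S"
    using run_edge[of "Suc t" L 0 0 0] passes_shift(2)[OF planar_nth[OF S t]] t
      width_tangle_closure[OF diagram, of t] width_tangle_closure[OF diagram, of "Suc t"]
    by (simp add: length_tangle_closure nth_shift)
  show "((1, 0), lift (0, 0)) \<in> edges 0 L"
    using turn_edge_above[of 0 L 0 0] width_tangle_closure[OF diagram, of 0]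
    by (simp add: lift_def length_tangle_closure nth_tangle_closure)
qed

text \<open>The strand is added according to the bottom end point, but the closing cap also ties it
  to the top end point, so the two ends must agree about membership.\<close>

lemma saturated_closed_component:
  assumes c: "saturated 1 S c" and ends: "(0, 0) \<in> c \<longleftrightarrow> (length S, 0) \<in> c"
  shows "saturated 0 L (closed_component S c)"
proof -
  let ?X = "closed_component S c"
  have lift_mem: "(Suc t, Suc i) \<in> ?X \<longleftrightarrow> (t, i) \<in> c" for t i
    using lift_in_closed_component[of "(t, i)"] by (simp add: lift_def)
  have "p \<in> ?X \<longleftrightarrow> q \<in> ?X" if "(p, q) \<in> edges 0 L" for p q
    using that
  proof (cases rule: edge_cases)
    case (run s i j)
    have "s \<noteq> 0" using run by (cases s) auto
    moreover have "s \<noteq> Suc (length S)" using run width_top by auto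
    ultimately obtain t where t: "s = Suc t" "t < length S"
      using run(3) by (cases s) (auto simp: length_tangle_closure)
    have pass: "passes (shift_piece (S ! t)) i j" using run(4) t by (simp add: nth_shift)
    note shift = passes_shift[OF planar_nth[OF S t(2)]]
    show ?thesis
    proof (cases i)
      case 0
      then show ?thesis using pass shift(3) run t by (simp add: strand_in_closed_component)
    next
      case (Suc i')
      then obtain j' where j: "j = Suc j'" using pass shift(4) by (cases j) auto
      then have "((t, i'), (Suc t, j')) \<in> edges 1 S"
        using pass shift(1) Suc run t width_tangle_closure[OF diagram, of t]
          width_tangle_closure[OF diagram, of "Suc t"]
        by (intro run_edge) auto
      then show ?thesis using saturatedD[OF c] run t Suc j by (simp add: lift_mem)
    qed
  next
    case (below s k)
    have "s \<noteq> 0" using below by (cases s) (auto simp: nth_tangle_closure)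
    then obtain t where t: "s = Suc t" "t \<le> length S"
      using below(3) by (cases s) (auto simp: length_tangle_closure)
    show ?thesis
    proof (cases "t = length S")
      case True
      then have "k = 0" using below(4) t by (auto simp: nth_tangle_closure)
      then show ?thesis using below t True ends by (simp add: strand_in_closed_component lift_mem)
    next
      case False
      then have "t < length S" using t by simp
      then obtain k' where k: "k = Suc k'" "S ! t \<in> {Cap k', Horiz k'}"
        using below(4) t by (auto simp: nth_shift shift_piece_eq)
      then have "((t, k'), (t, Suc k')) \<in> edges 1 S"
        using below t \<open>t < length S\<close> width_tangle_closure[OF diagram, of t]
        by (intro turn_edge_below) auto
      then show ?thesis using saturatedD[OF c] below t k by (simp add: lift_mem)
    qed
  next
    case (above s k)
    show ?thesis
    proof (cases s)
      case 0
      then have "k = 0" using above(4) by (auto simp: nth_tangle_closure)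
      then show ?thesis using above 0 by (simp add: strand_in_closed_component lift_mem)
    next
      case (Suc t)
      have "s \<noteq> Suc (length S)" using above(4) by (auto simp: nth_tangle_closure)
      then have t: "t < length S" using above(3) Suc by (simp add: length_tangle_closure)
      then obtain k' where k: "k = Suc k'" "S ! t \<in> {Cup k', Horiz k'}"
        using above(4) Suc by (auto simp: nth_shift shift_piece_eq)
      then have "((Suc t, k'), (Suc t, Suc k')) \<in> edges 1 S"
        using above t Suc width_tangle_closure[OF diagram, of "Suc t"]
        by (intro turn_edge_above) auto
      then show ?thesis using saturatedD[OF c] above Suc k by (simp add: lift_mem)
    qed
  qed
  then show ?thesis by (auto simp: saturated_def)
qed

lemma ends_same_component:
  assumes "c \<in> components 1 S"
  shows "(0, 0) \<in> c \<longleftrightarrow> c = arc_component S" "(length S, 0) \<in> c \<longleftrightarrow> c = arc_component S"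
proof -
  have "c = arc_component S" if "p \<in> c" "p \<in> arc_component S" for p
    using component_of_member[OF assms that(1)] component_of_member[OF arc_in_components that(2)] by simp
  moreover have "(0, 0) \<in> arc_component S" by (simp add: arc_component_def)
  ultimately show "(0, 0) \<in> c \<longleftrightarrow> c = arc_component S" "(length S, 0) \<in> c \<longleftrightarrow> c = arc_component S"
    using arc_reaches_top[OF S] by blast+
qed

lemma strand_component:
  assumes "1 \<le> t" "t \<le> Suc (length S)"
  shows "(t, 0) \<in> component 0 L (lift (0, 0))"
  using assms
proof (induction t rule: dec_induct)
  case base
  then show ?case
    using saturatedD[OF saturated_component strand_edges(2)] by blast
next
  case (step t)
  obtain s where s: "t = Suc s" using step(1) by (cases t) auto
  then show ?case
    using saturatedD[OF saturated_component strand_edges(1)[of s], of "lift (0, 0)"] step by simp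
qed

lemma component_lift:
  assumes p: "p \<in> points 1 S"
  shows "component 0 L (lift p) = closed_component S (component 1 S p)"
proof
  have c: "component 1 S p \<in> components 1 S" using p by (auto simp: components_def)
  have "saturated 0 L (closed_component S (component 1 S p))"
    by (rule saturated_closed_component[OF saturated_component]) (simp only: ends_same_component[OF c])
  then show "component 0 L (lift p) \<subseteq> closed_component S (component 1 S p)"
    by (rule component_subset) simp
  have lift: "lift q \<in> component 0 L (lift p)" if "q \<in> component 1 S p" for q
    using that
  proof (induction rule: component_induct)
    case (forward a b)
    then show ?case using saturatedD[OF saturated_component edges_lift] by blast
  next
    case (backward a b)
    then show ?case using saturatedD[OF saturated_component edges_lift] by blast
  qed simp
  have "(t, 0) \<in> component 0 L (lift p)"
    if "(0, 0) \<in> component 1 S p" "1 \<le> t" "t \<le> Suc (length S)" for t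
    using strand_component[OF that(2,3)] component_cong[OF lift[OF that(1)]] by blast
  then show "closed_component S (component 1 S p) \<subseteq> component 0 L (lift p)"
    using lift unfolding closed_component_def by (auto split: if_splits)
qed

lemma components_closure: "components 0 L = closed_component S ` components 1 S"
proof
  show "components 0 L \<subseteq> closed_component S ` components 1 S"
  proof
    fix d assume "d \<in> components 0 L"
    then obtain p where p: "p \<in> points 0 L" "d = component 0 L p" by (auto simp: components_def)
    from p(1) show "d \<in> closed_component S ` components 1 S"
    proof (cases rule: points_cases)
      case (lift q)
      then show ?thesis using p(2) component_lift by (auto simp: components_def)
    next
      case (strand t)
      have "(0, 0) \<in> points 1 S" by (simp add: points_def)
      moreover have "d = component 0 L (lift (0, 0))"
        using component_cong[OF strand_component] strand p(2) by simp
      ultimately show ?thesis using component_lift by (auto simp: components_def)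
    qed
  qed
  show "closed_component S ` components 1 S \<subseteq> components 0 L"
  proof
    fix d assume "d \<in> closed_component S ` components 1 S"
    then obtain p where p: "p \<in> points 1 S" "d = closed_component S (component 1 S p)"
      by (auto simp: components_def)
    then have "d = component 0 L (lift p)" "lift p \<in> points 0 L"
      using component_lift points_lift by auto
    then show "d \<in> components 0 L" by (auto simp: components_def)
  qed
qed

text \<open>The inverse image under \<open>lift\<close> recovers the tangle component from its
  closure. The component through \<open>(0, 0)\<close> is the marked one, and x on it is the
  condition defining the reduced complex.\<close>

definition label :: "labelling \<Rightarrow> labelling" where
  "label l = (\<lambda>c\<in>components 0 L. if (0, 0) \<in> lift -` c then Ax else l (lift -` c))"

lemma label_closed:
  "c \<in> components 1 S \<Longrightarrow> label l (closed_component S c) = (if c = arc_component S then Ax else l c)"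
  using ends_same_component(1)[of c]
  by (simp add: label_def components_closure vimage_closed_component)

lemma component_mark: "component 0 L (1, 1) = closed_component S (arc_component S)"
  using component_lift[of "(0, 0)"] by (simp add: lift_def points_def arc_component_def)

lemma label_update:
  assumes "d \<in> circles S"
  shows "label (l(d := a)) = (label l)(closed_component S d := a)"
proof
  fix c
  have d: "d \<in> components 1 S" "d \<noteq> arc_component S" using circlesD[OF assms] by auto
  show "label (l(d := a)) c = ((label l)(closed_component S d := a)) c"
  proof (cases "c \<in> components 0 L")
    case True
    then obtain c' where "c' \<in> components 1 S" "c = closed_component S c'" by (auto simp: components_closure)
    then show ?thesis using d by (simp add: label_closed closed_component_eq_iff)
  next
    case False
    then have "c \<noteq> closed_component S d" using d components_closure by auto
    then show ?thesis using False by (simp add: label_def)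
  qed
qed

lemma bij_label:
  "bij_betw label (\<Pi>\<^sub>E c\<in>circles S. UNIV)
    {l. l \<in> (\<Pi>\<^sub>E c\<in>components 0 L. UNIV) \<and> l (component 0 L (1, 1)) = Ax}"
proof (rule bij_betw_byWitness[where f' = "\<lambda>l. \<lambda>c\<in>circles S. l (closed_component S c)"])
  show "\<forall>l\<in>\<Pi>\<^sub>E c\<in>circles S. UNIV. (\<lambda>c\<in>circles S. label l (closed_component S c)) = l"
  proof (intro ballI ext)
    fix l c assume l: "l \<in> (\<Pi>\<^sub>E c\<in>circles S. (UNIV :: basis_A set))"
    show "(\<lambda>c\<in>circles S. label l (closed_component S c)) c = l c"
    proof (cases "c \<in> circles S")
      case True
      then show ?thesis using label_closed[OF circlesD(1)[OF True], of l] circlesD(2)[OF True] by simp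
    next
      case False
      then show ?thesis using PiE_arb[OF l False] by simp
    qed
  qed
  show "\<forall>l\<in>{l. l \<in> (\<Pi>\<^sub>E c\<in>components 0 L. UNIV) \<and> l (component 0 L (1, 1)) = Ax}.
      label (\<lambda>c\<in>circles S. l (closed_component S c)) = l"
  proof
    fix l assume l: "l \<in> {l. l \<in> (\<Pi>\<^sub>E c\<in>components 0 L. UNIV) \<and> l (component 0 L (1, 1)) = Ax}"
    show "label (\<lambda>c\<in>circles S. l (closed_component S c)) = l"
    proof
      fix c
      show "label (\<lambda>c\<in>circles S. l (closed_component S c)) c = l c"
      proof (cases "c \<in> components 0 L")
        case True
        then obtain c' where c': "c' \<in> components 1 S" "c = closed_component S c'"
          by (auto simp: components_closure)
        then show ?thesis
          using l by (auto simp: label_closed circles_def component_mark[unfolded One_nat_def])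
      next
        case False
        moreover have "l \<in> (\<Pi>\<^sub>E c\<in>components 0 L. UNIV)" using l by blast
        ultimately have "l c = undefined" using PiE_arb by blast
        then show ?thesis using False by (simp add: label_def)
      qed
    qed
  qed
  show "label ` (\<Pi>\<^sub>E c\<in>circles S. UNIV) \<subseteq> {l. l \<in> (\<Pi>\<^sub>E c\<in>components 0 L. UNIV) \<and> l (component 0 L (1, 1)) = Ax}"
  proof (intro image_subsetI CollectI conjI)
    fix l show "label l \<in> (\<Pi>\<^sub>E c\<in>components 0 L. UNIV)" by (simp add: label_def)
    show "label l (component 0 L (1, 1)) = Ax"
      unfolding component_mark using label_closed[OF arc_in_components, of l] by simp
  qed
qed (intro image_subsetI, simp)

text \<open>The -1 is the degree of x on the marked component; the final shift by 1 in the reduced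
  complex compensates it.\<close>

lemma sum_label:
  "(\<Sum>c\<in>components 0 L. bideg_A (label l c)) = (0, -1) + (\<Sum>c\<in>circles S. bideg_A (l c))"
proof -
  have "inj_on (closed_component S) (components 1 S)"
    by (rule inj_onI) (simp add: closed_component_eq_iff)
  then have "(\<Sum>c\<in>components 0 L. bideg_A (label l c))
      = (\<Sum>c\<in>components 1 S. bideg_A (if c = arc_component S then Ax else l c))"
    unfolding components_closure by (simp add: sum.reindex label_closed)
  also have "\<dots> = bideg_A Ax + (\<Sum>c\<in>circles S. bideg_A (if c = arc_component S then Ax else l c))"
    unfolding circles_def by (subst sum.remove[OF finite_components arc_in_components]) simp
  also have "(\<Sum>c\<in>circles S. bideg_A (if c = arc_component S then Ax else l c)) = (\<Sum>c\<in>circles S. bideg_A (l c))"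
    by (intro sum.cong) (auto simp: circles_def)
  finally show ?thesis by simp
qed

end

sublocale surgery \<subseteq> before: planar_tangle S
  by unfold_locales (rule S)

sublocale surgery \<subseteq> after: planar_tangle S'
  by unfold_locales (rule S')

lemma closed_component_cong: "length S = length S' \<Longrightarrow> closed_component S = closed_component S'"
  by (simp add: closed_component_def fun_eq_iff)

context surgery
begin

interpretation rev: surgery S' S t k by (rule reverse)

lemma id_on_label:
  "id_on (components 0 before.L - {closed_component S u, closed_component S v}) (before.label l) (after.label l')
    = id_on Q l l'"
proof -
  have cc: "closed_component S' = closed_component S" by (rule closed_component_cong[OF length])
  have same: "before.label l (closed_component S d) = after.label l' (closed_component S d) \<longleftrightarrow>
      d = arc_component S \<or> l d = l' d" if d: "d \<in> components 1 S - {u, v}" for d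
  proof -
    have d': "d \<in> components 1 S' - {u', v'}" using d unfolding untouched_eq .
    \<comment> \<open>An arc away from the band is an uninvolved component of the closure but not a
      circle of the tangle. It carries x before and after, so it imposes no condition.\<close>
    have "d = arc_component S \<longleftrightarrow> d = arc_component S'"
    proof
      assume A: "d = arc_component S"
      then have "arc_component S \<notin> {u, v}" using d by blast
      then show "d = arc_component S'" using arc_untouched A by simp
    next
      assume A: "d = arc_component S'"
      then have "arc_component S' \<notin> {u', v'}" using d' by blast
      then show "d = arc_component S" using rev.arc_untouched A by simp
    qed
    then show ?thesis
      using before.label_closed[of d l] after.label_closed[of d l', unfolded cc]
        DiffD1[OF d] DiffD1[OF d'] by (simp only: if_splits simp_thms) auto
  qed
  have "components 0 before.L - {closed_component S u, closed_component S v}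
      = closed_component S ` (components 1 S - {u, v})"
    unfolding before.components_closure by (auto simp: closed_component_eq_iff)
  then have "(\<forall>c\<in>components 0 before.L - {closed_component S u, closed_component S v}.
      before.label l c = after.label l' c) \<longleftrightarrow>
      (\<forall>d\<in>components 1 S - {u, v}. d = arc_component S \<or> l d = l' d)"
    using same by simp
  also have "\<dots> \<longleftrightarrow> (\<forall>d\<in>Q. l d = l' d)" by (auto simp: circles_def)
  finally show ?thesis by (simp only: id_on_def)
qed

lemma khovanov_map_label:
  "khovanov_map before.L after.L (Suc t) (before.label l) (after.label l') = reduced_map S S' t l l'"
proof -
  have cc: "closed_component S' = closed_component S" by (rule closed_component_cong[OF length])
  have "position (shift_piece (S ! t)) = Suc k" using band by auto
  then have pos: "position (before.L ! Suc t) = Suc k" using before.nth_shift[OF t] by simp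
  have P: "(t, k) \<in> points 1 S" "(t + 1, k + 1) \<in> points 1 S" "(t, k) \<in> points 1 S'" "(t + 1, k + 1) \<in> points 1 S'"
    using corners_points points_eq by (auto simp: corners_def)
  have comps: "component 0 before.L (Suc t, Suc k) = closed_component S u"
    "component 0 before.L (Suc t + 1, Suc k + 1) = closed_component S v"
    "component 0 after.L (Suc t, Suc k) = closed_component S u'"
    "component 0 after.L (Suc t + 1, Suc k + 1) = closed_component S v'"
    using before.component_lift[OF P(1)] before.component_lift[OF P(2)]
      after.component_lift[OF P(3)] after.component_lift[OF P(4)]
    by (simp_all add: lift_def cc)
  note labels = before.label_closed[OF uv_components(1)] before.label_closed[OF uv_components(2)]
    after.label_closed[OF rev.uv_components(1), unfolded cc] after.label_closed[OF rev.uv_components(2), unfolded cc]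
  \<comment> \<open>Here \<open>r\<close> and \<open>s\<close> stand for the arcs before and after.
    The coproduct of x is xx, so a circle split from the arc must carry x, as in
    \<open>eta_dot\<close>. The form \<open>{a, a}\<close> fits \<open>arc_touched_rev\<close> when
    \<open>u = v\<close>.\<close>
  have split: "comult_A (if a = r then Ax else l a) (if b = s then Ax else l' b) (if c = s then Ax else l' c) =
      (if a \<noteq> r then comult_A (l a) (l' b) (l' c) else eta_dot (l' (if b = s then c else b)))"
    if "(s \<in> {b, c}) = (r \<in> {a, a})" "b \<noteq> c" for a b c r s :: "point set"
    using that by (cases "a = r"; cases "l' b"; cases "l' c") (auto simp: comult_A_def eta_dot_def)
  \<comment> \<open>Since xx = 0 and xe = x, a circle merged into the arc must carry e, as in
    \<open>eps_dot\<close>.\<close>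
  have merge: "mult_A (if a = r then Ax else l a) (if b = r then Ax else l b) (if c = s then Ax else l' c) =
      (if c \<noteq> s then mult_A (l a) (l b) (l' c) else eps_dot (l (if a = r then b else a)))"
    if "(s \<in> {c, c}) = (r \<in> {a, b})" "a \<noteq> b" for a b c r s :: "point set"
    using that by (cases "c = s"; cases "l a"; cases "l b") (auto simp: mult_A_def eps_dot_def)
  note arcs = arc_touched_rev
  show ?thesis
    unfolding khovanov_map_def reduced_map_def pos position Let_def comps closed_component_eq_iff
      id_on_label labels
  proof (intro if_cong refl arg_cong2[where f = "(*)"])
    assume uv: "u = v \<and> u' \<noteq> v'"
    show "comult_A (if u = arc_component S then Ax else l u) (if u' = arc_component S' then Ax else l' u')
        (if v' = arc_component S' then Ax else l' v') =
      (if u \<noteq> arc_component S then comult_A (l u) (l' u') (l' v')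
       else eta_dot (l' (if u' = arc_component S' then v' else u')))"
      by (rule split) (use arcs uv in \<open>simp_all only: simp_thms\<close>)
  next
    assume uv: "u \<noteq> v \<and> u' = v'"
    show "mult_A (if u = arc_component S then Ax else l u) (if v = arc_component S then Ax else l v)
        (if u' = arc_component S' then Ax else l' u') =
      (if u' \<noteq> arc_component S' then mult_A (l u) (l v) (l' u')
       else eps_dot (l (if u = arc_component S then v else u)))"
      by (rule merge) (use arcs uv in \<open>simp_all only: simp_thms\<close>)
  qed
qed

end


section \<open>The complex of a tangle\<close>

lemma position_shift: "position (shift_piece p) = Suc (position p)"
  by (cases p) auto

lemma smooth_shift: "smooth b (shift_piece p) = shift_piece (smooth b p)"
  by (cases p) auto

lemma crossing_shift:
  "(\<exists>k. shift_piece p \<in> {Over_NE k, Over_NW k}) \<longleftrightarrow> (\<exists>k. p \<in> {Over_NE k, Over_NW k})"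
  by (cases p) auto

lemma positive_shift: "positive_piece (shift_piece p) a b \<longleftrightarrow> positive_piece p a b"
  by (cases p) auto

lemma less_Suc_Suc_cases:
  "t < Suc (Suc n) \<Longrightarrow> t = 0 \<or> t = Suc n \<or> (\<exists>s<n. t = Suc s)"
  by (cases t) auto

lemma crossings_closure: "crossings (tangle_closure T) = Suc ` crossings T"
proof -
  have "Suc s \<in> crossings (tangle_closure T) \<longleftrightarrow> s \<in> crossings T" for s
  proof (cases "s < length T")
    case True
    then show ?thesis
      using crossing_shift[of "T ! s"] by (simp add: crossings_def nth_tangle_closure length_tangle_closure)
  next
    case False
    then have "s = length T" if "s < Suc (length T)" using that by simp
    then show ?thesis
      using False by (cases "s = length T") (auto simp: crossings_def nth_tangle_closure length_tangle_closure)
  qed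
  moreover have "0 \<notin> crossings (tangle_closure T)" by (simp add: crossings_def nth_tangle_closure)
  ultimately show ?thesis by (auto simp: image_iff) (metis not0_implies_Suc)
qed

lemma positive_crossings_closure:
  "positive_crossings (tangle_closure T) (closure_orientation up) = Suc ` positive_crossings T up"
proof -
  have "Suc t \<in> positive_crossings (tangle_closure T) (closure_orientation up) \<longleftrightarrow> t \<in> positive_crossings T up"
    if "t \<in> crossings T" for t
  proof -
    have "t < length T" using that by (simp add: crossings_def)
    then show ?thesis
      using that by (simp add: positive_crossings_def crossings_closure nth_tangle_closure position_shift
          positive_shift closure_orientation_def inj_image_mem_iff)
  qed
  moreover have "positive_crossings (tangle_closure T) (closure_orientation up) \<subseteq> Suc ` crossings T"
    "positive_crossings T up \<subseteq> crossings T"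
    by (auto simp: positive_crossings_def crossings_closure)
  ultimately show ?thesis by (auto simp: subset_iff)
qed

lemma n_pos_closure: "n_pos (tangle_closure T) (closure_orientation up) = n_pos T up"
  by (simp add: n_pos_def positive_crossings_closure card_image)

lemma n_neg_closure: "n_neg (tangle_closure T) (closure_orientation up) = n_neg T up"
proof -
  have "Suc ` crossings T - Suc ` positive_crossings T up = Suc ` (crossings T - positive_crossings T up)"
    by (simp add: image_set_diff)
  then show ?thesis by (simp add: n_neg_def positive_crossings_closure crossings_closure card_image)
qed

lemma length_resolve: "length (resolve T i) = length T"
  by (simp add: resolve_def)

lemma nth_resolve: "t < length T \<Longrightarrow> resolve T i ! t = smooth (t \<in> i) (T ! t)"
  by (simp add: resolve_def)

lemma resolve_closure: "resolve (tangle_closure T) (Suc ` i) = tangle_closure (resolve T i)"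
proof (rule nth_equalityI)
  show len: "length (resolve (tangle_closure T) (Suc ` i)) = length (tangle_closure (resolve T i))"
    by (simp add: length_resolve length_tangle_closure)
  fix t assume "t < length (resolve (tangle_closure T) (Suc ` i))"
  then have "t < Suc (Suc (length T))" by (simp add: length_resolve length_tangle_closure)
  from less_Suc_Suc_cases[OF this]
  show "resolve (tangle_closure T) (Suc ` i) ! t = tangle_closure (resolve T i) ! t"
    using nth_tangle_closure(2)[of "resolve T i", unfolded length_resolve]
    by (auto simp: nth_resolve length_tangle_closure length_resolve nth_tangle_closure smooth_shift inj_image_mem_iff)
qed

lemma diagram_cong:
  "list_all2 (\<lambda>p q. \<forall>n. fits n p = fits n q \<and> strands_above n p = strands_above n q) D D' \<Longrightarrow>
    diagram n D m = diagram n D' m"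
  by (induction D D' arbitrary: n rule: list_all2_induct) auto

lemma planar_resolve:
  assumes "diagram n T m"
  shows "planar_diagram n (resolve T i) m"
proof -
  have "fits n (smooth b p) = fits n p \<and> strands_above n (smooth b p) = strands_above n p" for n b p
    by (cases p) simp_all
  then have "list_all2 (\<lambda>p q. \<forall>n. fits n p = fits n q \<and> strands_above n p = strands_above n q) T (resolve T i)"
    by (simp add: list_all2_conv_all_nth length_resolve nth_resolve)
  then have "diagram n (resolve T i) m" using diagram_cong assms by blast
  moreover have "planar_piece (smooth b p)" for b p by (cases p) auto
  ultimately show ?thesis by (auto simp: planar_diagram_def resolve_def)
qed

text \<open>Changing one bit exchanges the two smoothings \<open>Vert\<close> and
  \<open>Horiz\<close> of that crossing; which of them comes first depends on the overpass.\<close>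

lemma surgery_resolve:
  assumes T: "diagram 1 T 1" and t: "t \<in> crossings T - i"
  shows "surgery (resolve T i) (resolve T (insert t i)) t (position (T ! t))"
proof
  have len: "t < length T" using t by (simp add: crossings_def)
  show "planar_diagram 1 (resolve T i) 1" "planar_diagram 1 (resolve T (insert t i)) 1"
    using T by (rule planar_resolve)+
  show "t < length (resolve T i)" "length (resolve T (insert t i)) = length (resolve T i)"
    using len by (simp_all add: length_resolve)
  show "resolve T (insert t i) ! s = resolve T i ! s" if "s \<noteq> t" "s < length (resolve T i)" for s
    using that by (simp add: length_resolve nth_resolve)
  show "resolve T i ! t = Vert (position (T ! t)) \<and> resolve T (insert t i) ! t = Horiz (position (T ! t)) \<or>
    resolve T i ! t = Horiz (position (T ! t)) \<and> resolve T (insert t i) ! t = Vert (position (T ! t))"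
    using t len by (auto simp: nth_resolve crossings_def)
qed

section \<open>Generators and matrices of the two complexes\<close>

locale tangle =
  fixes T :: "piece list" and up :: "point \<Rightarrow> bool"
  assumes T: "diagram 1 T 1"
begin

abbreviation "K \<equiv> reduced_khovanov_complex (tangle_closure T) (closure_orientation up) (1, 1)"
abbreviation "C \<equiv> tangle_complex T up"
abbreviation "S \<equiv> resolve T"

sublocale res: planar_tangle "S i" for i
  by unfold_locales (rule planar_resolve[OF T])

text \<open>The closing cup precedes all other pieces, so crossing \<open>t\<close> of the tangle is
  crossing \<open>Suc t\<close> of the closure.\<close>

definition closed :: "nat set \<Rightarrow> labelling \<Rightarrow> nat set \<times> labelling" where
  "closed i l = (Suc ` i, res.label i l)"

lemma closed_gens:
  "bij_betw (\<lambda>(i, l). closed i l) {(i, l). i \<subseteq> crossings T \<and> l \<in> (\<Pi>\<^sub>E c\<in>circles (S i). UNIV)} (gens K)"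
proof -
  have inj: "inj_on (res.label i) (\<Pi>\<^sub>E c\<in>circles (S i). UNIV)" for i
    using res.bij_label[of i] by (auto simp: bij_betw_def)
  have im: "res.label i ` (\<Pi>\<^sub>E c\<in>circles (S i). UNIV) =
      {l. l \<in> (\<Pi>\<^sub>E c\<in>components 0 (tangle_closure (S i)). UNIV) \<and> l (component 0 (tangle_closure (S i)) (1, 1)) = Ax}" for i
    using res.bij_label[of i] by (auto simp: bij_betw_def)
  have gens: "gens K = {(j, l). j \<subseteq> Suc ` crossings T \<and>
      l \<in> {l. l \<in> (\<Pi>\<^sub>E c\<in>components 0 (resolve (tangle_closure T) j). UNIV) \<and>
        l (component 0 (resolve (tangle_closure T) j) (1, 1)) = Ax}}"
    by (simp add: reduced_khovanov_complex_def crossings_closure)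
  have "gens K = (\<lambda>(i, l). closed i l) ` {(i, l). i \<subseteq> crossings T \<and> l \<in> (\<Pi>\<^sub>E c\<in>circles (S i). UNIV)}" (is "_ = ?R")
  proof
    show "gens K \<subseteq> ?R"
    proof
      fix g assume g: "g \<in> gens K"
      obtain j l' where jl: "g = (j, l')" by (cases g)
      have j: "j \<subseteq> Suc ` crossings T" and l': "l' \<in> {l. l \<in> (\<Pi>\<^sub>E c\<in>components 0 (resolve (tangle_closure T) j). UNIV) \<and>
          l (component 0 (resolve (tangle_closure T) j) (1, 1)) = Ax}"
        using g unfolding gens jl by (simp_all only: mem_Collect_eq prod.case)
      from j obtain i where i: "i \<subseteq> crossings T" "j = Suc ` i" by (auto simp: subset_image_iff)
      have "l' \<in> res.label i ` (\<Pi>\<^sub>E c\<in>circles (S i). UNIV)"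
        using l' unfolding im i(2) resolve_closure .
      then show "g \<in> ?R" using i jl by (auto simp: closed_def image_iff)
    qed
    show "?R \<subseteq> gens K"
    proof
      fix g assume "g \<in> ?R"
      then obtain i l where il: "i \<subseteq> crossings T" "l \<in> (\<Pi>\<^sub>E c\<in>circles (S i). UNIV)" "g = (Suc ` i, res.label i l)"
        by (auto simp: closed_def)
      have "res.label i l \<in> res.label i ` (\<Pi>\<^sub>E c\<in>circles (S i). UNIV)" using il(2) by (rule imageI)
      moreover have "Suc ` i \<subseteq> Suc ` crossings T" using il(1) by (rule image_mono)
      ultimately show "g \<in> gens K"
        unfolding gens il(3) mem_Collect_eq prod.case im resolve_closure by (intro conjI) simp_all
    qed
  qed
  moreover have "inj_on (\<lambda>(i, l). closed i l) {(i, l). i \<subseteq> crossings T \<and> l \<in> (\<Pi>\<^sub>E c\<in>circles (S i). UNIV)}"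
  proof (rule inj_onI, clarify)
    fix i l j l'
    assume A: "l \<in> (\<Pi>\<^sub>E c\<in>circles (S i). (UNIV :: basis_A set))" "l' \<in> (\<Pi>\<^sub>E c\<in>circles (S j). (UNIV :: basis_A set))"
      and eq: "closed i l = closed j l'"
    have "Suc ` i = Suc ` j" using eq by (simp add: closed_def)
    then have "i = j" by (simp add: inj_image_eq_iff)
    moreover have "l = l'" using eq A inj_onD[OF inj] \<open>i = j\<close> by (simp add: closed_def)
    ultimately show "i = j \<and> l = l'" ..
  qed
  ultimately show ?thesis by (simp add: bij_betw_def)
qed

lemma closed_gen:
  "i \<subseteq> crossings T \<Longrightarrow> l \<in> (\<Pi>\<^sub>E c\<in>circles (S i). UNIV) \<Longrightarrow> closed i l \<in> gens K"
  using bij_betw_apply[OF closed_gens, of "(i, l)"] by simp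

lemma closed_exists:
  assumes "g \<in> gens K"
  shows "\<exists>i l. i \<subseteq> crossings T \<and> l \<in> (\<Pi>\<^sub>E c\<in>circles (S i). UNIV) \<and> g = closed i l"
proof -
  have "g \<in> (\<lambda>(i, l). closed i l) ` {(i, l). i \<subseteq> crossings T \<and> l \<in> (\<Pi>\<^sub>E c\<in>circles (S i). UNIV)}"
    using assms bij_betw_imp_surj_on[OF closed_gens] by simp
  then show ?thesis by auto
qed

lemma closed_inj:
  assumes "i \<subseteq> crossings T" "l \<in> (\<Pi>\<^sub>E c\<in>circles (S i). UNIV)"
    and "j \<subseteq> crossings T" "l' \<in> (\<Pi>\<^sub>E c\<in>circles (S j). UNIV)" and "closed i l = closed j l'"
  shows "i = j \<and> l = l'"
  using inj_onD[OF bij_betw_imp_inj_on[OF closed_gens], of "(i, l)" "(j, l')"] assms by simp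

lemma gens_C: "gens C = {(i, w, l). i \<subseteq> crossings T \<and> l \<in> (\<Pi>\<^sub>E c\<in>circles (S i). UNIV)}"
  by (simp add: tangle_complex_def)

lemma finite_gens_K: "finite (gens K)"
proof -
  have fin: "finite (crossings T)" by (simp add: crossings_def)
  have "(UNIV :: basis_A set) = {Ae, Ax}" using basis_A.exhaust by auto
  then have "finite (UNIV :: basis_A set)" by (metis finite.emptyI finite_insert)
  then have "finite (SIGMA i:Pow (crossings T). \<Pi>\<^sub>E c\<in>circles (S i). (UNIV :: basis_A set))"
    using fin by (intro finite_SigmaI finite_PiE) (auto simp: finite_circles)
  moreover have "{(i, l). i \<subseteq> crossings T \<and> l \<in> (\<Pi>\<^sub>E c\<in>circles (S i). (UNIV :: basis_A set))}
      = (SIGMA i:Pow (crossings T). \<Pi>\<^sub>E c\<in>circles (S i). UNIV)" by auto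
  ultimately show ?thesis using bij_betw_finite[OF closed_gens] by simp
qed

definition reduced_coeff :: "nat set \<Rightarrow> nat set \<Rightarrow> labelling \<Rightarrow> labelling \<Rightarrow> bit" where
  "reduced_coeff i j l l' =
    (\<Sum>t | t \<in> crossings T - i \<and> j = insert t i. reduced_map (S i) (S j) t l l')"

lemma coeff_K: "coeff K (closed i l) (closed j l') = reduced_coeff i j l l'"
proof -
  have reindex: "(\<Sum>t\<in>Suc ` A. f t) = (\<Sum>t\<in>A. f (Suc t))" for A and f :: "nat \<Rightarrow> bit"
    by (simp add: sum.reindex)
  have "{t. t \<in> crossings (tangle_closure T) - Suc ` i \<and> Suc ` j = insert t (Suc ` i)}
      = Suc ` {t. t \<in> crossings T - i \<and> j = insert t i}"
  proof -
    have "Suc ` j = insert (Suc t) (Suc ` i) \<longleftrightarrow> j = insert t i" for t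
      by (metis image_insert inj_Suc inj_image_eq_iff)
    note eq = this
    show ?thesis
    proof (intro set_eqI)
      fix x
      show "x \<in> {t. t \<in> crossings (tangle_closure T) - Suc ` i \<and> Suc ` j = insert t (Suc ` i)} \<longleftrightarrow>
          x \<in> Suc ` {t. t \<in> crossings T - i \<and> j = insert t i}"
        by (cases x) (auto simp: crossings_closure eq inj_image_mem_iff simp del: image_insert)
    qed
  qed
  moreover have "coeff K (closed i l) (closed j l') =
      (\<Sum>t | t \<in> crossings (tangle_closure T) - Suc ` i \<and> Suc ` j = insert t (Suc ` i).
        khovanov_map (tangle_closure (S i)) (tangle_closure (S j)) t (res.label i l) (res.label j l'))"
    by (simp only: reduced_khovanov_complex_def closed_def resolve_closure based_complex.simps prod.case)
  ultimately have "coeff K (closed i l) (closed j l') = (\<Sum>t | t \<in> crossings T - i \<and> j = insert t i.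
      khovanov_map (tangle_closure (S i)) (tangle_closure (S j)) (Suc t) (res.label i l) (res.label j l'))"
    by (simp only: reindex)
  also have "\<dots> = reduced_coeff i j l l'"
    unfolding reduced_coeff_def
    by (intro sum.cong refl) (use surgery.khovanov_map_label[OF surgery_resolve[OF T]] in auto)
  finally show ?thesis .
qed

text \<open>For fixed vertices the right circles do not depend on \<open>t\<close>, so the
  commutator is linear in the saddle map and passes through the sum.\<close>

lemma coeff_C: "coeff C (i, w, l) (j, w', l') = a_0 w w' * reduced_coeff i j l l' + c_0 w w' *
    homotopy_boundary (right_circles (S i)) (right_circles (S j)) (reduced_coeff i j) l l'"
proof -
  let ?J = "{t. t \<in> crossings T - i \<and> j = insert t i}"
  have "coeff C (i, w, l) (j, w', l') = (\<Sum>t\<in>?J. a_0 w w' * reduced_map (S i) (S j) t l l' + c_0 w w' *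
      homotopy_boundary (right_circles (S i)) (right_circles (S j)) (reduced_map (S i) (S j) t) l l')"
    by (simp add: tangle_complex_def)
      (intro sum.cong refl, use surgery.saddle_map_eq[OF surgery_resolve[OF T]] in auto)
  also have "\<dots> = a_0 w w' * reduced_coeff i j l l' + c_0 w w' *
      (\<Sum>t\<in>?J. homotopy_boundary (right_circles (S i)) (right_circles (S j)) (reduced_map (S i) (S j) t) l l')"
    by (simp add: sum.distrib sum_distrib_left reduced_coeff_def)
  also have "(\<Sum>t\<in>?J. homotopy_boundary (right_circles (S i)) (right_circles (S j)) (reduced_map (S i) (S j) t) l l')
      = homotopy_boundary (right_circles (S i)) (right_circles (S j)) (reduced_coeff i j) l l'"
    unfolding homotopy_boundary_def reduced_coeff_def sum_distrib_left sum.distrib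
    by (intro arg_cong2[where f = "(+)"] sum.swap)
  finally show ?thesis .
qed

text \<open>The homotopy acts on generators of the closure, but the side of the arc is a notion of
  the tangle; hence the return to the tangle's vertex by an inverse image under
  \<open>Suc\<close>.\<close>

definition homotopy_coeff :: "nat set \<times> labelling \<Rightarrow> nat set \<times> labelling \<Rightarrow> bit" where
  "homotopy_coeff = (\<lambda>(j, l) (j', l'). \<Sum>d\<in>right_circles (S (Suc -` j)).
     let d' = closed_component (S (Suc -` j)) d in of_bool (j = j' \<and> l d' = Ax \<and> l' = l(d' := Ae)))"

text \<open>This row form evaluates composites in which the homotopy comes first; the column form
  \<open>homotopy_coeff_to\<close> serves those in which it comes last.\<close>

lemma homotopy_coeff_from:
  "homotopy_coeff (closed i l) m
    = (\<Sum>d\<in>right_circles (S i). of_bool (l d = Ax) * of_bool (m = closed i (l(d := Ae))))"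
proof -
  have i: "Suc -` Suc ` i = i" by (simp add: inj_vimage_image_eq)
  have "of_bool (Suc ` i = fst m \<and> res.label i l (closed_component (S i) d) = Ax \<and>
      snd m = (res.label i l)(closed_component (S i) d := Ae))
    = (of_bool (l d = Ax) * of_bool (m = closed i (l(d := Ae))) :: bit)" if "d \<in> right_circles (S i)" for d
  proof -
    have d: "d \<in> circles (S i)" using that right_circles_subset by blast
    show ?thesis
      using res.label_closed[OF circlesD(1)[OF d], of l] circlesD(2)[OF d]
      by (cases m) (auto simp: closed_def res.label_update[OF d])
  qed
  then show ?thesis by (cases m) (simp add: homotopy_coeff_def closed_def i Let_def)
qed

lemma homotopy_coeff_to:
  assumes m: "m \<in> gens K"
  shows "homotopy_coeff m (closed j l')
    = (\<Sum>d\<in>right_circles (S j). of_bool (l' d = Ae) * of_bool (m = closed j (l'(d := Ax))))"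
proof -
  obtain i l where il: "m = closed i l"
    using closed_exists[OF m] by blast
  show ?thesis
  proof (cases "i = j")
    case True
    have "of_bool (l d = Ax) * of_bool (closed j l' = closed i (l(d := Ae)))
      = (of_bool (l' d = Ae) * of_bool (m = closed j (l'(d := Ax))) :: bit)" if "d \<in> right_circles (S j)" for d
    proof -
      have d: "d \<in> circles (S j)" using that right_circles_subset by blast
      let ?d = "closed_component (S j) d"
      have lab: "res.label j l ?d = l d" "res.label j l' ?d = l' d"
        using res.label_closed[OF circlesD(1)[OF d]] circlesD(2)[OF d] by simp_all
      \<comment> \<open>Both sides say that the labellings agree away from \<open>?d\<close>, where
        the first has x and the second e.\<close>
      have "l d = Ax \<and> res.label j l' = (res.label j l)(?d := Ae) \<longleftrightarrow>
          l' d = Ae \<and> res.label j l = (res.label j l')(?d := Ax)"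
        using lab by (metis fun_upd_same fun_upd_triv fun_upd_upd)
      then show ?thesis
        by (auto simp: il closed_def True res.label_update[OF d])
    qed
    then show ?thesis unfolding il homotopy_coeff_from using True by (simp add: il)
  next
    case False
    then have "closed j x \<noteq> closed i y" "closed i x \<noteq> closed j y" for x y
      by (auto simp: closed_def inj_image_eq_iff)
    then show ?thesis unfolding il homotopy_coeff_from by simp
  qed
qed

lemma homotopy_coeff_bideg:
  assumes g: "g \<in> gens K" "g' \<in> gens K" and ne: "homotopy_coeff g g' \<noteq> 0"
  shows "bideg K g' = bideg K g + (0, 2)"
proof -
  obtain i l where il: "g = closed i l"
    using closed_exists[OF g(1)] by blast
  have "(\<Sum>d\<in>right_circles (S i). of_bool (l d = Ax) * of_bool (g' = closed i (l(d := Ae)))) \<noteq> (0 :: bit)"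
    using ne unfolding il homotopy_coeff_from .
  then obtain d where "d \<in> right_circles (S i)" "of_bool (l d = Ax) * of_bool (g' = closed i (l(d := Ae))) \<noteq> (0 :: bit)"
    by (meson sum.neutral)
  then have d: "d \<in> circles (S i)" "l d = Ax" "g' = closed i (l(d := Ae))"
    using right_circles_subset by (auto split: if_splits)
  have "(\<Sum>c\<in>circles (S i). bideg_A ((l(d := Ae)) c)) = (0, 1) + (\<Sum>c\<in>circles (S i) - {d}. bideg_A (l c))"
    by (subst sum.remove[OF finite_circles d(1)]) simp
  moreover have "(\<Sum>c\<in>circles (S i). bideg_A (l c)) = (0, -1) + (\<Sum>c\<in>circles (S i) - {d}. bideg_A (l c))"
    by (subst sum.remove[OF finite_circles d(1)]) (simp add: d(2))
  ultimately have "(\<Sum>c\<in>circles (S i). bideg_A ((l(d := Ae)) c)) = (\<Sum>c\<in>circles (S i). bideg_A (l c)) + (0, 2)"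
    by (simp add: prod_eq_iff)
  then show ?thesis
    by (simp add: il d(3) reduced_khovanov_complex_def closed_def resolve_closure res.sum_label ac_simps)
qed

text \<open>The shifts \<open>2 r(i)\<close> and \<open>m_+ - 3 m_-\<close> are the Khovanov shifts
  \<open>r(i)\<close> and \<open>m_+ - 2 m_-\<close> plus the homological degree
  \<open>r(i) - m_-\<close>, as the regrading to \<open>(h, h + q)\<close> requires.\<close>

lemma bideg_C:
  "bideg C (i, w, l) = bideg_W w + (fst (bideg K (closed i l)), fst (bideg K (closed i l)) + snd (bideg K (closed i l)))"
proof -
  have 0: "fst (bideg_A a) = 0" for a by (cases a) simp_all
  have "fst (\<Sum>c\<in>circles (S i). bideg_A (l c)) = 0"
    using sum_comp_morphism[of fst "\<lambda>c. bideg_A (l c)"] by (simp add: o_def 0)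
  then show ?thesis
    by (simp add: tangle_complex_def reduced_khovanov_complex_def closed_def resolve_closure res.sum_label
        n_pos_closure n_neg_closure card_image prod_eq_iff)
qed

sublocale twisted_complex K C "\<lambda>(i, w, l). w" "\<lambda>(i, w, l). closed i l" homotopy_coeff
proof
  show "bij_betw (\<lambda>c. ((\<lambda>(i, w, l). w) c, (\<lambda>(i, w, l). closed i l) c)) (gens C) (UNIV \<times> gens K)"
  proof (rule bij_betw_imageI)
    show "inj_on (\<lambda>c. ((\<lambda>(i, w, l). w) c, (\<lambda>(i, w, l). closed i l) c)) (gens C)"
      by (rule inj_onI) (auto simp: gens_C dest: closed_inj)
    show "(\<lambda>c. ((\<lambda>(i, w, l). w) c, (\<lambda>(i, w, l). closed i l) c)) ` gens C = UNIV \<times> gens K"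
    proof
      show "(\<lambda>c. ((\<lambda>(i, w, l). w) c, (\<lambda>(i, w, l). closed i l) c)) ` gens C \<subseteq> UNIV \<times> gens K"
        by (auto simp: gens_C simp del: One_nat_def intro: closed_gen)
      show "(UNIV :: basis_W set) \<times> gens K \<subseteq> (\<lambda>c. ((\<lambda>(i, w, l). w) c, (\<lambda>(i, w, l). closed i l) c)) ` gens C"
      proof
        fix y assume y: "y \<in> (UNIV :: basis_W set) \<times> gens K"
        then obtain i l where "i \<subseteq> crossings T" "l \<in> (\<Pi>\<^sub>E c\<in>circles (S i). UNIV)" "snd y = closed i l"
          using closed_exists[of "snd y"] by auto
        then show "y \<in> (\<lambda>c. ((\<lambda>(i, w, l). w) c, (\<lambda>(i, w, l). closed i l) c)) ` gens C"
          by (intro image_eqI[of _ _ "(i, fst y, l)"]) (auto simp: gens_C prod_eq_iff)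
      qed
    qed
  qed
  show "bideg C c = bideg_W ((\<lambda>(i, w, l). w) c) + (fst (bideg K ((\<lambda>(i, w, l). closed i l) c)),
      fst (bideg K ((\<lambda>(i, w, l). closed i l) c)) + snd (bideg K ((\<lambda>(i, w, l). closed i l) c)))" for c
    by (cases c) (simp add: bideg_C)
  show "bideg K k' = bideg K k + (0, 2)" if "k \<in> gens K" "k' \<in> gens K" "homotopy_coeff k k' \<noteq> 0" for k k'
    using homotopy_coeff_bideg that by blast
next
  fix c c' assume c: "c \<in> gens C" and c': "c' \<in> gens C"
  obtain i w l where ci: "c = (i, w, l)" "i \<subseteq> crossings T" "l \<in> (\<Pi>\<^sub>E c\<in>circles (S i). UNIV)"
    using c by (auto simp: gens_C)
  obtain j w' l' where cj: "c' = (j, w', l')" "j \<subseteq> crossings T" "l' \<in> (\<Pi>\<^sub>E c\<in>circles (S j). UNIV)"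
    using c' by (auto simp: gens_C)
  \<comment> \<open>For each circle the homotopy relates a generator to at most one other, so the
    sum over intermediate generators collapses in both composites.\<close>
  have delta: "(\<Sum>m\<in>gens K. f m * of_bool (m = a)) = f a" if "a \<in> gens K" for f :: "_ \<Rightarrow> bit" and a
    by (subst sum.remove[OF finite_gens_K that]) (auto intro!: sum.neutral)
  have upd: "x(d := a) \<in> (\<Pi>\<^sub>E c\<in>circles (S k). UNIV)"
    if "x \<in> (\<Pi>\<^sub>E c\<in>circles (S k). (UNIV :: basis_A set))" "d \<in> right_circles (S k)" for x k d a
    using that right_circles_subset by (auto simp: PiE_def extensional_def)
  have "(\<Sum>m\<in>gens K. coeff K (closed i l) m * homotopy_coeff m (closed j l'))
      = (\<Sum>d\<in>right_circles (S j). of_bool (l' d = Ae) * (\<Sum>m\<in>gens K. coeff K (closed i l) m * of_bool (m = closed j (l'(d := Ax)))))"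
    by (simp add: homotopy_coeff_to sum_distrib_left mult.left_commute) (rule sum.swap)
  also have "\<dots> = (\<Sum>d\<in>right_circles (S j). of_bool (l' d = Ae) * reduced_coeff i j l (l'(d := Ax)))"
    by (intro sum.cong refl) (simp only: delta[OF closed_gen[OF cj(2) upd[OF cj(3)]]] coeff_K)
  finally have 1: "(\<Sum>m\<in>gens K. coeff K (closed i l) m * homotopy_coeff m (closed j l')) = \<dots>" .
  have "(\<Sum>m\<in>gens K. homotopy_coeff (closed i l) m * coeff K m (closed j l'))
      = (\<Sum>d\<in>right_circles (S i). of_bool (l d = Ax) * (\<Sum>m\<in>gens K. coeff K m (closed j l') * of_bool (m = closed i (l(d := Ae)))))"
    by (simp add: homotopy_coeff_from sum_distrib_left sum_distrib_right mult_ac) (rule sum.swap)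
  also have "\<dots> = (\<Sum>d\<in>right_circles (S i). of_bool (l d = Ax) * reduced_coeff i j (l(d := Ae)) l')"
    by (intro sum.cong refl) (simp only: delta[OF closed_gen[OF ci(2) upd[OF ci(3)]]] coeff_K)
  finally have 2: "(\<Sum>m\<in>gens K. homotopy_coeff (closed i l) m * coeff K m (closed j l')) = \<dots>" .
  show "coeff C c c' = a_0 ((\<lambda>(i, w, l). w) c) ((\<lambda>(i, w, l). w) c') *
        coeff K ((\<lambda>(i, w, l). closed i l) c) ((\<lambda>(i, w, l). closed i l) c')
      + c_0 ((\<lambda>(i, w, l). w) c) ((\<lambda>(i, w, l). w) c') *
        ((\<Sum>m\<in>gens K. coeff K ((\<lambda>(i, w, l). closed i l) c) m * homotopy_coeff m ((\<lambda>(i, w, l). closed i l) c'))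
        + (\<Sum>m\<in>gens K. homotopy_coeff ((\<lambda>(i, w, l). closed i l) c) m * coeff K m ((\<lambda>(i, w, l). closed i l) c')))"
    unfolding ci(1) cj(1) prod.case coeff_C 1 2 coeff_K homotopy_boundary_def ..
qed

end

theorem theorem1p8:
  shows "\<exists>(V_basis :: nat set) (V_deg :: nat \<Rightarrow> int \<times> int). card V_basis = 2 \<and>
    (\<forall>(T :: piece list) (up :: point \<Rightarrow> bool). oriented_tangle T up \<longrightarrow>
       bigraded_isomorphic
         (tensor V_basis V_deg (regrade (Khr_closure T up)))
         (cohomology (tangle_complex T up)))"
proof (intro exI conjI allI impI)
  \<comment> \<open>The bidegrees of \<open>Alpha\<close> and \<open>Beta\<close>: \<open>V\<close>
    is \<open>W_0\<close> with its basis renamed 0 and 1.\<close>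
  let ?deg = "\<lambda>b::nat. (0, if b = 0 then 0 else -2) :: int \<times> int"
  show "card {0, 1::nat} = 2" by simp
  fix T up assume "oriented_tangle T up"
  then interpret tangle T up by unfold_locales (simp add: oriented_tangle_def)
  show "bigraded_isomorphic (tensor {0, 1} ?deg (regrade (Khr_closure T up))) (cohomology (tangle_complex T up))"
    unfolding Khr_closure_def Khr_def by (rule cohomology_untwisted) simp_all
qed

end
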